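(* Let $\lambda\in(0,\infty)$ and $\lambda_0=2\cos(\pi/5)$. (i) Let $P$ be a convex pentagon in $\mathbb{RP}^2$. (a) If $\lambda\in(0,\lambda_0)$, then $P$ collapses to a point under iteration of $H_\lambda$: there is a point $p\in\mathbb{RP}^2$ (the point of collapse) such that all vertices of $H_\lambda^k(P)$ converge to $p$ as $k\to\infty$. (b) If $\lambda=\lambda_0$, then the even iterates $H_\lambda^{2k}(P)$ converge as $k\to\infty$ (without rescaling or any other normalization) to a projectively regular pentagon, and the odd iterates $H_\lambda^{2k+1}(P)$ converge to another projectively regular pentagon; the vertices of these two pentagons together form a projectively regular decagon. (c) If $\lambda\in(\lambda_0,\infty)$, then there is a line $\ell\subset\mathbb{RP}^2$ (the line of collapse) such that all the vertices of $H_\lambda^k(P)$ approach $\ell$ as $k\to\infty$, i.e. their distance to $\ell$ tends to $0$. (ii) For $\lambda\in(0,\lambda_0)$ the point of collapse, and for $\lambda\in(\lambda_0,\infty)$ the line of collapse, depend real-analytically on the vertices of the original convex pentagon $P$.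
   Context: A pentagon is an ordered $5$-tuple $A=(A_0,A_2,A_4,A_6,A_8)$ of points of $\mathbb{RP}^2$ (even indices modulo $10$). It is convex if some projective transformation carries it to a pentagon in $\mathbb{R}^2\subset\mathbb{RP}^2$ whose vertices are, in cyclic order, the vertices of a strictly convex polygon. A polygon is projectively regular if it is the image of a regular polygon of $\mathbb{R}^2$ under a projective transformation. Distances in $\mathbb{RP}^2$ are with respect to any fixed metric inducing its topology; the set of convex pentagons is an open subset of $(\mathbb{RP}^2)^5$, and lines are viewed as points of the dual projective plane. The heat map $H_\lambda$: for four points $a,b,c,d$ of $\mathbb{RP}^2$ (in this order), no three collinear, let $T\in PGL(3,\mathbb{R})$ be the unique projective transformation with $T(a)=(-1,1)$, $T(b)=(1,1)$, $T(c)=(1,-1)$, $T(d)=(-1,-1)$, and set $h_\lambda(a,b,c,d)=T^{-1}(\lambda,0)$. For a pentagon $A$ with no three vertices collinear, $H_\lambda(A)=(B_0,B_2,B_4,B_6,B_8)$ with $B_k=h_\lambda(A_{k+2},A_{k+4},A_{k+6},A_{k+8})$. For $\lambda>0$ the map $H_\lambda$ carries convex pentagons to convex pentagons, so all iterates are defined. *)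

theory Defs
  imports "HOL-Analysis.Analysis"
begin

subsection \<open>The real projective plane\<close>

definition proj_rel :: "real^3 \<Rightarrow> real^3 \<Rightarrow> bool" where
  "proj_rel v w \<longleftrightarrow> v \<noteq> 0 \<and> w \<noteq> 0 \<and> (\<exists>c. c \<noteq> 0 \<and> w = c *\<^sub>R v)"

lemma proj_rel_sym: "proj_rel v w \<Longrightarrow> proj_rel w v"
proof -
  assume "proj_rel v w"
  then obtain c where c: "v \<noteq> 0" "w \<noteq> 0" "c \<noteq> 0" "w = c *\<^sub>R v"
    unfolding proj_rel_def by blast
  then have "v = inverse c *\<^sub>R w" by simp
  moreover have "inverse c \<noteq> 0" using c(3) by simp
  ultimately show "proj_rel w v"
    unfolding proj_rel_def using c(1,2) by blast
qed

lemma proj_rel_trans: "proj_rel u v \<Longrightarrow> proj_rel v w \<Longrightarrow> proj_rel u w"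
  unfolding proj_rel_def by (metis mult_eq_0_iff scaleR_scaleR)

lemma part_equivp_proj_rel: "part_equivp proj_rel"
proof (rule part_equivpI)
  have "proj_rel (axis 1 1) (axis 1 1)"
    unfolding proj_rel_def
    by (intro conjI exI[of _ "1::real"]) (auto simp: axis_eq_0_iff)
  then show "\<exists>x. proj_rel x x" by blast
  show "symp proj_rel" by (rule sympI) (rule proj_rel_sym)
  show "transp proj_rel" by (rule transpI) (rule proj_rel_trans)
qed

quotient_type rp2 = "real^3" / partial: proj_rel
  by (rule part_equivp_proj_rel)

text \<open>The point with the given homogeneous coordinates; it is meaningful only for nonzero
  vectors.\<close>

definition point :: "real^3 \<Rightarrow> rp2" where
  "point v = abs_rp2 v"

text \<open>The quotient topology of \<open>real^3 - {0}\<close>; openness in that open subset is openness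
  in \<open>real^3\<close>.\<close>

instantiation rp2 :: topological_space
begin

definition open_rp2 :: "rp2 set \<Rightarrow> bool" where
  "open_rp2 U \<longleftrightarrow> open {v. v \<noteq> 0 \<and> point v \<in> U}"

instance
proof
  have "{v::real^3. v \<noteq> 0 \<and> point v \<in> UNIV} = - {0}" by auto
  then show "open (UNIV :: rp2 set)"
    unfolding open_rp2_def by (simp add: open_Compl)
next
  fix S T :: "rp2 set"
  assume "open S" "open T"
  moreover have "{v. v \<noteq> 0 \<and> point v \<in> S \<inter> T}
      = {v. v \<noteq> 0 \<and> point v \<in> S} \<inter> {v. v \<noteq> 0 \<and> point v \<in> T}"
    by auto
  ultimately show "open (S \<inter> T)"
    unfolding open_rp2_def by (simp add: open_Int)
next
  fix K :: "rp2 set set"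
  assume "\<forall>S\<in>K. open S"
  moreover have "{v. v \<noteq> 0 \<and> point v \<in> \<Union>K} = (\<Union>S\<in>K. {v. v \<noteq> 0 \<and> point v \<in> S})"
    by auto
  ultimately show "open (\<Union>K)"
    unfolding open_rp2_def by auto
qed

end

text \<open>A line of the projective plane is a nonzero linear form up to scaling, so the dual
  projective plane is the same type, linear forms being identified with vectors by means
  of the inner product.\<close>

type_synonym dual_rp2 = rp2

definition line_points :: "dual_rp2 \<Rightarrow> rp2 set" where
  "line_points l = {point v | v. v \<noteq> 0 \<and> (\<exists>w. w \<noteq> 0 \<and> l = point w \<and> w \<bullet> v = 0)}"

definition projective_transformation :: "(rp2 \<Rightarrow> rp2) \<Rightarrow> bool" where
  "projective_transformation T \<longleftrightarrow>
     (\<exists>M::real^3^3. invertible M \<and> (\<forall>v. v \<noteq> 0 \<longrightarrow> T (point v) = point (M *v v)))"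

text \<open>The three standard affine charts (more precisely, their inverses); the third one is
  the inclusion of the affine plane.\<close>

definition affine_chart :: "3 \<Rightarrow> real^2 \<Rightarrow> rp2" where
  "affine_chart k u = point
     (if k = 1 then vector [1, u$1, u$2]
      else if k = 2 then vector [u$1, 1, u$2]
      else vector [u$1, u$2, 1])"

abbreviation affine_point :: "real^2 \<Rightarrow> rp2" where
  "affine_point \<equiv> affine_chart 3"


subsection \<open>Polygons\<close>

text \<open>A polygon is a tuple indexed by a numeral type \<open>'n\<close>, whose arithmetic is modulo
  \<open>CARD('n)\<close>.  In a pentagon the index \<open>j :: 5\<close> stands for the label \<open>2 * j\<close> modulo 10.\<close>

type_synonym pentagon = "rp2^5"

definition strictly_convex_polygon :: "real^2^'n::{finite,comm_ring_1} \<Rightarrow> bool" where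
  "strictly_convex_polygon v \<longleftrightarrow>
     inj (\<lambda>j. v $ j) \<and>
     (\<forall>j. v $ j extreme_point_of convex hull (range (\<lambda>i. v $ i))) \<and>
     (\<forall>j. closed_segment (v $ j) (v $ (j + 1)) edge_of convex hull (range (\<lambda>i. v $ i)))"

definition convex_pentagon :: "pentagon \<Rightarrow> bool" where
  "convex_pentagon A \<longleftrightarrow>
     (\<exists>T v. projective_transformation T \<and> strictly_convex_polygon v \<and>
        (\<forall>j. T (A $ j) = affine_point (v $ j)))"

text \<open>Vertices equally spaced on a circle, in either sense of rotation; on a numeral type
  every index is of the form \<open>of_nat k\<close>.\<close>

definition regular_polygon :: "real^2^'n::{finite,comm_ring_1} \<Rightarrow> bool" where
  "regular_polygon v \<longleftrightarrow>
     (\<exists>c r t s. r > 0 \<and> (s = 1 \<or> s = - 1) \<and>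
        (\<forall>k::nat. v $ of_nat k =
           c + r *\<^sub>R vector [cos (t + s * (2 * pi * real k / real CARD('n))),
                          sin (t + s * (2 * pi * real k / real CARD('n)))]))"

definition projectively_regular :: "rp2^'n::{finite,comm_ring_1} \<Rightarrow> bool" where
  "projectively_regular A \<longleftrightarrow>
     (\<exists>T v. projective_transformation T \<and> regular_polygon v \<and>
        (\<forall>j. A $ j = T (affine_point (v $ j))))"


subsection \<open>The heat map\<close>

text \<open>Elements of \<open>PGL(3)\<close> are represented by the maps they induce, and a projective
  transformation is determined by its values on four points in general position.\<close>

definition heat_point :: "real \<Rightarrow> rp2 \<Rightarrow> rp2 \<Rightarrow> rp2 \<Rightarrow> rp2 \<Rightarrow> rp2" where
  "heat_point lam a b c d =
     inv (THE T. projective_transformation T \<and>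
            T a = affine_point (vector [- 1, 1]) \<and>
            T b = affine_point (vector [1, 1]) \<and>
            T c = affine_point (vector [1, - 1]) \<and>
            T d = affine_point (vector [- 1, - 1]))
       (affine_point (vector [lam, 0]))"

definition heat_map :: "real \<Rightarrow> pentagon \<Rightarrow> pentagon" where
  "heat_map lam A =
     (\<chi> j. heat_point lam (A $ (j + 1)) (A $ (j + 2)) (A $ (j + 3)) (A $ (j + 4)))"

definition collapses_to_point :: "real \<Rightarrow> pentagon \<Rightarrow> rp2 \<Rightarrow> bool" where
  "collapses_to_point lam P p \<longleftrightarrow>
     (\<forall>j. (\<lambda>k. (heat_map lam ^^ k) P $ j) \<longlonglongrightarrow> p)"

definition collapses_to_line ::
    "(rp2 \<Rightarrow> rp2 \<Rightarrow> real) \<Rightarrow> real \<Rightarrow> pentagon \<Rightarrow> dual_rp2 \<Rightarrow> bool" where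
  "collapses_to_line d lam P l \<longleftrightarrow>
     (\<forall>j. (\<lambda>k. INF q\<in>line_points l. d ((heat_map lam ^^ k) P $ j) q) \<longlonglongrightarrow> 0)"


subsection \<open>Real-analytic maps\<close>

text \<open>Local expansion into a convergent power series in several variables; the
  multi-indices are the functions from the basis to the natural numbers.\<close>

definition real_analytic_at ::
    "('a::euclidean_space \<Rightarrow> 'b::euclidean_space) \<Rightarrow> 'a \<Rightarrow> bool" where
  "real_analytic_at f x \<longleftrightarrow>
     (\<exists>(a :: ('a \<Rightarrow> nat) \<Rightarrow> 'b) r. r > 0 \<and>
        (\<forall>h. norm h < r \<longrightarrow>
           ((\<lambda>m. (\<Prod>b\<in>Basis. (h \<bullet> b) ^ m b) *\<^sub>R a m) has_sum f (x + h))
             (Basis \<rightarrow>\<^sub>E UNIV)))"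

definition pentagon_chart :: "3^5 \<Rightarrow> real^2^5 \<Rightarrow> pentagon" where
  "pentagon_chart i w = (\<chi> j. affine_chart (i $ j) (w $ j))"

definition rp2_analytic_on :: "(pentagon \<Rightarrow> rp2) \<Rightarrow> pentagon set \<Rightarrow> bool" where
  "rp2_analytic_on F S \<longleftrightarrow>
     (\<forall>i w. pentagon_chart i w \<in> S \<longrightarrow>
        (\<exists>k G. real_analytic_at G w \<and>
           (\<forall>\<^sub>F w' in nhds w. F (pentagon_chart i w') = affine_chart k (G w'))))"

end

theory Submission
  imports Defs
begin

text \<open>The projective class of a convex pentagon is given by five positive numbers that form a frieze of
  width two. On friezes the heat map contracts the largest entry to the golden ratio, so that every
  class tends geometrically to the regular one. Suitably normalized homogeneous coordinates of the
  vertices satisfy a linear recursion whose coefficients are rational in the frieze. In the limit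
  it has a positive eigenvalue on constant tuples and a negative one on the shapes of affinely
  regular pentagons. The sum of the two has the sign of \<open>2 cos (pi / 5) - lam\<close>, which decides
  whether the common value dominates (collapse to a point), the shape dominates (collapse to the line it
  spans), or the two balance and the shape only changes its sign. All estimates are made in a norm
  that may be either the absolute value at one pentagon or the weighted coefficient norm of
  power series near it, and the latter choice gives analytic limits.\<close>

section \<open>Power series with a weighted absolute norm\<close>

text \<open>In homogeneous coordinates the heat map is a linear recursion driven by an autonomous
  map of the projective classes. Convergence without renormalization needs more than convergence of
  the classes: their deviations from the regular class must be summable, since an eigenvalue of
  modulus 1 never damps an error. Hence the insistence on a geometric rate.

  Two contraction arguments are combined. The bound on the largest entry works from any starting
  class, but a maximum says nothing about coefficients of power series. Close to the regular class
  the derivative is a scalar of modulus less than 1, and that argument uses only sums, products and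
  reciprocals, so it holds in either norm. The first brings the orbit near the regular class at one
  pentagon; the second takes over from there on a neighbourhood.

  Existence of limits does not exclude degenerate ones. This is settled by duality: late lifts pair
  with suitable covectors almost like tuples of an exactly regular pentagon, and all later changes
  together are too small to destroy this, so the limit vectors are nonzero or independent as
  required.\<close>

abbreviation multi_indices :: "('a::euclidean_space \<Rightarrow> nat) set" where
  "multi_indices \<equiv> Basis \<rightarrow>\<^sub>E UNIV"

definition monomial :: "('a::euclidean_space \<Rightarrow> nat) \<Rightarrow> 'a \<Rightarrow> real" where
  "monomial m h = (\<Prod>b\<in>Basis. (h \<bullet> b) ^ m b)"

definition weight :: "real \<Rightarrow> ('a::euclidean_space \<Rightarrow> nat) \<Rightarrow> real" where
  "weight r m = (\<Prod>b\<in>Basis. r ^ m b)"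

definition cube :: "'a::euclidean_space \<Rightarrow> real \<Rightarrow> 'a set" where
  "cube w r = {x. \<forall>b\<in>Basis. \<bar>(x - w) \<bullet> b\<bar> \<le> r}"

text \<open>The l^1 norm of the coefficients, scaled to the cube of radius r about w; functions of
  finite norm form a Banach algebra. A bound \<open>C\<close> takes the place of a norm because
  \<open>f\<close> is a total function of which only the values on the cube matter.\<close>

definition majorized :: "'a::euclidean_space \<Rightarrow> real \<Rightarrow> ('a \<Rightarrow> real) \<Rightarrow> real \<Rightarrow> bool" where
  "majorized w r f C \<longleftrightarrow>
     (\<exists>a. (\<lambda>m. \<bar>a m\<bar> * weight r m) summable_on multi_indices \<and>
          infsum (\<lambda>m. \<bar>a m\<bar> * weight r m) multi_indices \<le> C \<and>
          (\<forall>x\<in>cube w r. ((\<lambda>m. a m * monomial m (x - w)) has_sum f x) multi_indices))"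

lemma weight_pos: "r > 0 \<Longrightarrow> weight r m > 0"
  by (simp add: weight_def prod_pos)

lemma abs_monomial_le: "x \<in> cube w r \<Longrightarrow> \<bar>monomial m (x - w)\<bar> \<le> weight r m"
  unfolding monomial_def weight_def cube_def
  by (auto simp: abs_prod power_abs intro!: prod_mono power_mono)

lemma monomial_add:
  "monomial (restrict (\<lambda>b. m b + k b) Basis) h = monomial m h * monomial k h"
  by (simp add: monomial_def power_add prod.distrib)

lemma weight_add:
  "weight r (restrict (\<lambda>b. m b + k b) Basis) = weight r m * weight r k"
  by (simp add: weight_def power_add prod.distrib)

lemma has_sum_fibres:
  fixes g :: "'i \<Rightarrow> real"
  assumes "(g has_sum s) I" and p: "p ` I \<subseteq> M"
  shows "((\<lambda>m. infsum g {i \<in> I. p i = m}) has_sum s) M"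
proof -
  have g: "g summable_on I" using assms(1) by (rule has_sum_imp_summable)
  have bij: "bij_betw snd (Sigma M (\<lambda>m. {i \<in> I. p i = m})) I"
    by (rule bij_betwI[where g = "\<lambda>i. (p i, i)"]) (use p in auto)
  have "((\<lambda>x. g (snd x)) has_sum s) (Sigma M (\<lambda>m. {i \<in> I. p i = m}))"
    using has_sum_reindex_bij_betw[OF bij, of g s] assms(1) by simp
  moreover have "((\<lambda>y. g (snd (m, y))) has_sum infsum g {i \<in> I. p i = m}) {i \<in> I. p i = m}" for m
    using summable_on_subset_banach[OF g, of "{i \<in> I. p i = m}"] by (auto intro: has_sum_infsum)
  ultimately show ?thesis
    by (rule has_sum_Sigma'[where B = "\<lambda>m. {i \<in> I. p i = m}"])
qed

text \<open>Collecting equal monomials can only lower the weighted norm, by the triangle inequality.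
  A product is a family indexed by pairs of multi-indices and a series one indexed by a number and a
  multi-index, so closure under both operations reduces to this lemma.\<close>

lemma majorized_family:
  fixes c :: "'i \<Rightarrow> real"
  assumes r: "r > 0" and p: "p ` I \<subseteq> multi_indices"
    and S: "(\<lambda>i. \<bar>c i\<bar> * weight r (p i)) summable_on I"
      "infsum (\<lambda>i. \<bar>c i\<bar> * weight r (p i)) I \<le> C"
    and f: "\<And>x. x \<in> cube w r \<Longrightarrow> f x = infsum (\<lambda>i. c i * monomial (p i) (x - w)) I"
  shows "majorized w r f C"
proof -
  let ?F = "\<lambda>m. {i \<in> I. p i = m}"
  define a where "a m = infsum c (?F m)" for m
  have sF: "(\<lambda>i. norm (c i)) summable_on ?F m" for m
  proof -
    have "(\<lambda>i. \<bar>c i\<bar> * weight r (p i)) summable_on ?F m"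
      by (rule summable_on_subset_banach[OF S(1)]) auto
    then have "(\<lambda>i. \<bar>c i\<bar> * weight r m) summable_on ?F m"
      by (subst (asm) summable_on_cong) auto
    then have "(\<lambda>i. \<bar>c i\<bar> * weight r m * (1 / weight r m)) summable_on ?F m"
      by (rule summable_on_cmult_left)
    then show ?thesis using weight_pos[OF r, of m] by simp
  qed
  have T: "((\<lambda>m. infsum (\<lambda>i. \<bar>c i\<bar> * weight r (p i)) (?F m)) has_sum
      infsum (\<lambda>i. \<bar>c i\<bar> * weight r (p i)) I) multi_indices"
    using S(1) p by (intro has_sum_fibres has_sum_infsum)
  have le: "\<bar>a m\<bar> * weight r m \<le> infsum (\<lambda>i. \<bar>c i\<bar> * weight r (p i)) (?F m)" for m
  proof -
    have "\<bar>a m\<bar> \<le> infsum (\<lambda>i. \<bar>c i\<bar>) (?F m)"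
      unfolding a_def using norm_infsum_bound[OF sF[of m]] by simp
    then have "\<bar>a m\<bar> * weight r m \<le> infsum (\<lambda>i. \<bar>c i\<bar>) (?F m) * weight r m"
      using weight_pos[OF r, of m] by (simp add: mult_right_mono)
    also have "\<dots> = infsum (\<lambda>i. \<bar>c i\<bar> * weight r m) (?F m)"
      by (rule infsum_cmult_left'[symmetric])
    also have "\<dots> = infsum (\<lambda>i. \<bar>c i\<bar> * weight r (p i)) (?F m)"
      by (rule infsum_cong) auto
    finally show ?thesis .
  qed
  have nn: "0 \<le> \<bar>a m\<bar> * weight r m" for m
    using weight_pos[OF r, of m] by simp
  have s: "(\<lambda>m. \<bar>a m\<bar> * weight r m) summable_on multi_indices"
    by (rule summable_on_comparison_test[OF has_sum_imp_summable[OF T]]) (use le nn in auto)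
  moreover have "infsum (\<lambda>m. \<bar>a m\<bar> * weight r m) multi_indices \<le> C"
    using has_sum_mono[OF has_sum_infsum[OF s] T] le S(2) by force
  moreover have "((\<lambda>m. a m * monomial m (x - w)) has_sum f x) multi_indices"
    if x: "x \<in> cube w r" for x
  proof -
    let ?g = "\<lambda>i. c i * monomial (p i) (x - w)"
    have "(\<lambda>i. norm (?g i)) summable_on I"
      by (rule summable_on_comparison_test[OF S(1)])
        (auto simp: abs_mult intro!: mult_left_mono abs_monomial_le[OF x])
    then have "?g summable_on I" by (rule abs_summable_summable)
    then have "(?g has_sum f x) I" using f[OF x] by (simp add: has_sum_infsum)
    then have "((\<lambda>m. infsum ?g (?F m)) has_sum f x) multi_indices"
      using p by (rule has_sum_fibres)
    moreover have "infsum ?g (?F m) = a m * monomial m (x - w)" for m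
    proof -
      have "infsum ?g (?F m) = infsum (\<lambda>i. c i * monomial m (x - w)) (?F m)"
        by (rule infsum_cong) auto
      then show ?thesis by (simp add: infsum_cmult_left' a_def)
    qed
    ultimately show ?thesis by simp
  qed
  ultimately show ?thesis unfolding majorized_def by blast
qed

lemma majorizedE:
  assumes "majorized w r f C"
  obtains a where "(\<lambda>m. \<bar>a m\<bar> * weight r m) summable_on multi_indices"
    "infsum (\<lambda>m. \<bar>a m\<bar> * weight r m) multi_indices \<le> C"
    "\<And>x. x \<in> cube w r \<Longrightarrow> ((\<lambda>m. a m * monomial m (x - w)) has_sum f x) multi_indices"
  using assms unfolding majorized_def by blast

lemma majorized_eval:
  assumes "majorized w r f C" "x \<in> cube w r"
  shows "\<bar>f x\<bar> \<le> C"
proof -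
  obtain a where a: "(\<lambda>m. \<bar>a m\<bar> * weight r m) summable_on multi_indices"
    "infsum (\<lambda>m. \<bar>a m\<bar> * weight r m) multi_indices \<le> C"
    "\<And>x. x \<in> cube w r \<Longrightarrow> ((\<lambda>m. a m * monomial m (x - w)) has_sum f x) multi_indices"
    by (rule majorizedE[OF assms(1)]) blast
  have le: "norm (a m * monomial m (x - w)) \<le> \<bar>a m\<bar> * weight r m" for m
    by (auto simp: abs_mult intro!: mult_left_mono abs_monomial_le assms(2))
  have "norm (f x) \<le> infsum (\<lambda>m. \<bar>a m\<bar> * weight r m) multi_indices"
    using norm_infsum_le[OF a(3)[OF assms(2)] has_sum_infsum[OF a(1)]] le by blast
  then show ?thesis using a(2) by simp
qed

lemma majorized_cong:
  assumes "majorized w r f C" "C \<le> D" "\<And>x. x \<in> cube w r \<Longrightarrow> f x = g x"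
  shows "majorized w r g D"
proof -
  obtain a where a: "(\<lambda>m. \<bar>a m\<bar> * weight r m) summable_on multi_indices"
    "infsum (\<lambda>m. \<bar>a m\<bar> * weight r m) multi_indices \<le> C"
    "\<And>x. x \<in> cube w r \<Longrightarrow> ((\<lambda>m. a m * monomial m (x - w)) has_sum f x) multi_indices"
    by (rule majorizedE[OF assms(1)]) blast
  show ?thesis
    unfolding majorized_def by (intro exI[of _ a]) (use a assms(2,3) in auto)
qed

lemma majorized_monomial:
  assumes r: "r > 0" and m: "m \<in> multi_indices"
  shows "majorized w r (\<lambda>x. c * monomial m (x - w)) (\<bar>c\<bar> * weight r m)"
  by (rule majorized_family[where I = "{()}" and c = "\<lambda>_. c" and p = "\<lambda>_. m"])
    (use assms in auto)

lemma majorized_const: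
  assumes "r > 0"
  shows "majorized w r (\<lambda>x. c) \<bar>c\<bar>"
  using majorized_monomial[OF assms, of "restrict (\<lambda>_. 0) Basis" w c]
  by (simp add: monomial_def weight_def)

lemma majorized_coordinate:
  fixes w :: "'a::euclidean_space"
  assumes "r > 0" "b \<in> Basis"
  shows "majorized w r (\<lambda>x. (x - w) \<bullet> b) r"
proof -
  have "(\<Prod>c\<in>Basis. t c ^ (if c = b then 1 else 0)) = t b" for t :: "'a \<Rightarrow> real"
    using assms(2) by (subst prod.remove[of _ b]) auto
  then show ?thesis
    using majorized_monomial[OF assms(1), of "restrict (\<lambda>c. if c = b then 1 else 0) Basis" w 1] assms
    by (simp add: monomial_def weight_def)
qed

lemma has_sum_mult_Times:
  fixes f :: "'i \<Rightarrow> real" and g :: "'j \<Rightarrow> real"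
  assumes f: "(f has_sum s) A" and g: "(g has_sum t) B"
    and fa: "(\<lambda>i. \<bar>f i\<bar>) summable_on A" and ga: "(\<lambda>j. \<bar>g j\<bar>) summable_on B"
  shows "((\<lambda>(i, j). f i * g j) has_sum s * t) (A \<times> B)"
proof -
  have "(\<lambda>(i, j). \<bar>f i\<bar> * \<bar>g j\<bar>) summable_on A \<times> B"
  proof (rule summable_on_SigmaI)
    show "((\<lambda>j. case (i, j) of (i, j) \<Rightarrow> \<bar>f i\<bar> * \<bar>g j\<bar>) has_sum \<bar>f i\<bar> * infsum (\<lambda>j. \<bar>g j\<bar>) B) B" for i
      unfolding prod.case by (rule has_sum_cmult_right[OF has_sum_infsum[OF ga]])
    show "(\<lambda>i. \<bar>f i\<bar> * infsum (\<lambda>j. \<bar>g j\<bar>) B) summable_on A"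
      by (rule summable_on_cmult_left[OF fa])
  qed simp
  then have "(\<lambda>x. norm (case x of (i, j) \<Rightarrow> f i * g j)) summable_on A \<times> B"
    by (rule summable_on_cong[THEN iffD1, rotated]) (auto simp: abs_mult)
  then have "(\<lambda>(i, j). f i * g j) summable_on A \<times> B"
    by (rule abs_summable_summable)
  then show ?thesis
  proof (rule has_sum_SigmaI[rotated 2])
    show "((\<lambda>j. case (i, j) of (i, j) \<Rightarrow> f i * g j) has_sum f i * t) B" for i
      unfolding prod.case by (rule has_sum_cmult_right[OF g])
    show "((\<lambda>i. f i * t) has_sum s * t) A"
      by (rule has_sum_cmult_left[OF f])
  qed
qed

lemma majorized_mult:
  assumes r: "r > 0" and "majorized w r f C" "majorized w r g D"
  shows "majorized w r (\<lambda>x. f x * g x) (C * D)"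
proof -
  obtain a where a: "(\<lambda>m. \<bar>a m\<bar> * weight r m) summable_on multi_indices"
    "infsum (\<lambda>m. \<bar>a m\<bar> * weight r m) multi_indices \<le> C"
    "\<And>x. x \<in> cube w r \<Longrightarrow> ((\<lambda>m. a m * monomial m (x - w)) has_sum f x) multi_indices"
    by (rule majorizedE[OF assms(2)]) blast
  obtain b where b: "(\<lambda>m. \<bar>b m\<bar> * weight r m) summable_on multi_indices"
    "infsum (\<lambda>m. \<bar>b m\<bar> * weight r m) multi_indices \<le> D"
    "\<And>x. x \<in> cube w r \<Longrightarrow> ((\<lambda>m. b m * monomial m (x - w)) has_sum g x) multi_indices"
    by (rule majorizedE[OF assms(3)]) blast
  let ?p = "\<lambda>(m, k). restrict (\<lambda>c. m c + k c) Basis"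
  let ?A = "\<lambda>m. \<bar>a m\<bar> * weight r m" and ?B = "\<lambda>m. \<bar>b m\<bar> * weight r m"
  have nn: "0 \<le> ?A m" "0 \<le> ?B m" for m
    using weight_pos[OF r, of m] by auto
  have h: "((\<lambda>(m, k). ?A m * ?B k) has_sum infsum ?A multi_indices * infsum ?B multi_indices)
      (multi_indices \<times> multi_indices)"
    using a(1) b(1) nn by (intro has_sum_mult_Times has_sum_infsum) simp_all
  then have i: "infsum (\<lambda>(m, k). ?A m * ?B k) (multi_indices \<times> multi_indices)
      = infsum ?A multi_indices * infsum ?B multi_indices"
    by (rule infsumI)
  show ?thesis
  proof (rule majorized_family[where I = "multi_indices \<times> multi_indices"
        and c = "\<lambda>(m, k). a m * b k" and p = ?p, OF r])
    show "?p ` (multi_indices \<times> multi_indices) \<subseteq> multi_indices" by auto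
    have eq: "\<bar>case i of (m, k) \<Rightarrow> a m * b k\<bar> * weight r (?p i) = (case i of (m, k) \<Rightarrow> ?A m * ?B k)" for i
      by (cases i) (simp add: weight_add abs_mult)
    show "(\<lambda>i. \<bar>case i of (m, k) \<Rightarrow> a m * b k\<bar> * weight r (?p i)) summable_on multi_indices \<times> multi_indices"
      unfolding eq by (rule has_sum_imp_summable[OF h])
    have "0 \<le> infsum ?A multi_indices" "0 \<le> infsum ?B multi_indices"
      using nn by (auto intro!: infsum_nonneg)
    then show "infsum (\<lambda>i. \<bar>case i of (m, k) \<Rightarrow> a m * b k\<bar> * weight r (?p i)) (multi_indices \<times> multi_indices) \<le> C * D"
      unfolding eq i using a(2) b(2) by (intro mult_mono) auto
    fix x assume x: "x \<in> cube w r"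
    let ?u = "\<lambda>m. a m * monomial m (x - w)" and ?v = "\<lambda>m. b m * monomial m (x - w)"
    have "(\<lambda>m. \<bar>?u m\<bar>) summable_on multi_indices" "(\<lambda>m. \<bar>?v m\<bar>) summable_on multi_indices"
      by (rule summable_on_comparison_test[OF a(1)] summable_on_comparison_test[OF b(1)];
          simp add: abs_mult mult_left_mono abs_monomial_le[OF x])+
    then have "((\<lambda>(m, k). ?u m * ?v k) has_sum f x * g x) (multi_indices \<times> multi_indices)"
      by (intro has_sum_mult_Times a(3)[OF x] b(3)[OF x])
    moreover have "(\<lambda>(m, k). ?u m * ?v k) = (\<lambda>i. (case i of (m, k) \<Rightarrow> a m * b k) * monomial (?p i) (x - w))"
      by (auto simp: monomial_add)
    ultimately have "((\<lambda>i. (case i of (m, k) \<Rightarrow> a m * b k) * monomial (?p i) (x - w)) has_sum f x * g x)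
        (multi_indices \<times> multi_indices)" by (simp only:)
    then show "f x * g x = infsum (\<lambda>i. (case i of (m, k) \<Rightarrow> a m * b k) * monomial (?p i) (x - w))
        (multi_indices \<times> multi_indices)"
      by (rule infsumI[symmetric])
  qed
qed

text \<open>This plays the part of completeness. All coefficients are summed as one absolutely
  summable double family, so that no limit of power series has to be identified afterwards.\<close>

lemma majorized_suminf:
  assumes r: "r > 0" and f: "\<And>n. majorized w r (f n) (C n)" and C: "summable C"
  shows "majorized w r (\<lambda>x. \<Sum>n. f n x) (\<Sum>n. C n)"
proof -
  let ?P = "\<lambda>n a. (\<lambda>m. \<bar>a m\<bar> * weight r m) summable_on multi_indices \<and>
      infsum (\<lambda>m. \<bar>a m\<bar> * weight r m) multi_indices \<le> C n \<and>
      (\<forall>x\<in>cube w r. ((\<lambda>m. a m * monomial m (x - w)) has_sum f n x) multi_indices)"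
  have "\<forall>n. \<exists>a. ?P n a" using f by (simp add: majorized_def)
  then have "\<exists>a. \<forall>n. ?P n (a n)" by (rule choice)
  then obtain a where P: "\<forall>n. ?P n (a n)" ..
  have a: "(\<lambda>m. \<bar>a n m\<bar> * weight r m) summable_on multi_indices"
    "infsum (\<lambda>m. \<bar>a n m\<bar> * weight r m) multi_indices \<le> C n"
    "x \<in> cube w r \<Longrightarrow> ((\<lambda>m. a n m * monomial m (x - w)) has_sum f n x) multi_indices" for n x
    using spec[OF P, of n] by simp_all
  let ?A = "\<lambda>n m. \<bar>a n m\<bar> * weight r m"
  have nn: "0 \<le> ?A n m" for n m
    using weight_pos[OF r, of m] by auto
  have C0: "0 \<le> C n" for n
    using infsum_nonneg[of multi_indices "?A n"] nn a(2)[of n] by (meson order_trans)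
  have hC: "(C has_sum (\<Sum>n. C n)) UNIV"
    using C C0 by (intro norm_summable_imp_has_sum summable_sums) auto
  have gs: "(\<lambda>n. infsum (?A n) multi_indices) summable_on UNIV"
    by (rule summable_on_comparison_test[OF has_sum_imp_summable[OF hC]])
      (use a(2) nn in \<open>auto intro!: infsum_nonneg\<close>)
  have s: "(\<lambda>(n, m). ?A n m) summable_on UNIV \<times> multi_indices"
  proof (rule summable_on_SigmaI)
    show "((\<lambda>m. case (n, m) of (n, m) \<Rightarrow> ?A n m) has_sum infsum (?A n) multi_indices) multi_indices" for n
      unfolding prod.case by (rule has_sum_infsum[OF a(1)])
  qed (use gs nn in auto)
  have hs: "((\<lambda>(n, m). ?A n m) has_sum infsum (\<lambda>n. infsum (?A n) multi_indices) UNIV) (UNIV \<times> multi_indices)"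
  proof (rule has_sum_SigmaI)
    show "((\<lambda>m. case (n, m) of (n, m) \<Rightarrow> ?A n m) has_sum infsum (?A n) multi_indices) multi_indices" for n
      unfolding prod.case by (rule has_sum_infsum[OF a(1)])
  qed (use gs s has_sum_infsum in auto)
  show ?thesis
  proof (rule majorized_family[where I = "UNIV \<times> multi_indices"
        and c = "\<lambda>(n, m). a n m" and p = snd, OF r])
    show "snd ` (UNIV \<times> multi_indices) \<subseteq> multi_indices" by auto
    have eq: "\<bar>case i of (n, m) \<Rightarrow> a n m\<bar> * weight r (snd i) = (case i of (n, m) \<Rightarrow> ?A n m)" for i
      by (cases i) auto
    show "(\<lambda>i. \<bar>case i of (n, m) \<Rightarrow> a n m\<bar> * weight r (snd i)) summable_on UNIV \<times> multi_indices"
      unfolding eq by (rule s)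
    show "infsum (\<lambda>i. \<bar>case i of (n, m) \<Rightarrow> a n m\<bar> * weight r (snd i)) (UNIV \<times> multi_indices) \<le> (\<Sum>n. C n)"
      unfolding eq infsumI[OF hs] using has_sum_mono[OF has_sum_infsum[OF gs] hC] a(2) by blast
    fix x assume x: "x \<in> cube w r"
    let ?u = "\<lambda>n m. a n m * monomial m (x - w)"
    have "(\<lambda>i. norm (case i of (n, m) \<Rightarrow> ?u n m)) summable_on UNIV \<times> multi_indices"
      by (rule summable_on_comparison_test[OF s])
        (auto simp: abs_mult mult_left_mono abs_monomial_le[OF x])
    then have su: "(\<lambda>(n, m). ?u n m) summable_on UNIV \<times> multi_indices"
      by (rule abs_summable_summable)
    have "norm (f n x) \<le> C n" for n
      using majorized_eval[OF f x, of n] by simp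
    then have "(\<lambda>n. norm (f n x)) summable_on UNIV"
      by (intro summable_on_comparison_test[OF has_sum_imp_summable[OF hC]]) simp_all
    then have fs: "((\<lambda>n. f n x) has_sum infsum (\<lambda>n. f n x) UNIV) UNIV"
      by (rule has_sum_infsum[OF abs_summable_summable])
    then have "infsum (\<lambda>n. f n x) UNIV = (\<Sum>n. f n x)"
      by (intro sums_unique has_sum_imp_sums)
    with fs have fs': "((\<lambda>n. f n x) has_sum (\<Sum>n. f n x)) UNIV" by simp
    have "((\<lambda>(n, m). ?u n m) has_sum (\<Sum>n. f n x)) (UNIV \<times> multi_indices)"
    proof (rule has_sum_SigmaI[OF _ fs' su])
      show "((\<lambda>m. case (n, m) of (n, m) \<Rightarrow> ?u n m) has_sum f n x) multi_indices" for n
        unfolding prod.case by (rule a(3)[OF x])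
    qed
    moreover have "(\<lambda>(n, m). ?u n m) = (\<lambda>i. (case i of (n, m) \<Rightarrow> a n m) * monomial (snd i) (x - w))"
      by auto
    ultimately have "((\<lambda>i. (case i of (n, m) \<Rightarrow> a n m) * monomial (snd i) (x - w)) has_sum (\<Sum>n. f n x))
        (UNIV \<times> multi_indices)" by (simp only:)
    then show "(\<Sum>n. f n x) = infsum (\<lambda>i. (case i of (n, m) \<Rightarrow> a n m) * monomial (snd i) (x - w))
        (UNIV \<times> multi_indices)"
      by (rule infsumI[symmetric])
  qed
qed

lemma majorized_add:
  assumes r: "r > 0" and "majorized w r f C" "majorized w r g D"
  shows "majorized w r (\<lambda>x. f x + g x) (C + D)"
proof -
  \<comment> \<open>A sum of two functions is treated as a series with all further terms
    zero.\<close>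
  let ?f = "\<lambda>n::nat. if n = 0 then f else if n = 1 then g else (\<lambda>x. 0)"
  let ?C = "\<lambda>n::nat. if n = 0 then C else if n = 1 then D else 0"
  have "?C sums (\<Sum>n<2. ?C n)" "(\<lambda>n. ?f n x) sums (\<Sum>n<2. ?f n x)" for x
    by (rule sums_finite; simp)+
  then have hC: "?C sums (C + D)" and f': "(\<lambda>n. ?f n x) sums (f x + g x)" for x
    by (simp_all add: numeral_2_eq_2)
  have C: "summable ?C" "suminf ?C = C + D"
    by (rule sums_summable[OF hC], rule sums_unique[OF hC, symmetric])
  have f: "(\<Sum>n. ?f n x) = f x + g x" for x
    using sums_unique[OF f'[of x]] by (rule sym)
  have "majorized w r (?f n) (?C n)" for n
    using assms majorized_const[OF r, of w 0] by simp
  from majorized_suminf[OF r this C(1)] show ?thesis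
    unfolding C(2) f .
qed

text \<open>An estimate of Schwarz type: without the constant coefficient every monomial has
  positive degree, so passing from radius r to t gains at least one factor t / r. Closeness at the
  centre thereby becomes closeness in norm on a small cube.\<close>

lemma majorized_shrink:
  fixes w :: "'a::euclidean_space"
  assumes f: "majorized w r f C" and r: "0 < t" "t \<le> r"
  shows "majorized w t (\<lambda>x. f x - f w) (t / r * C)"
proof -
  have r0: "r > 0" using r by simp
  obtain a where a: "(\<lambda>m. \<bar>a m\<bar> * weight r m) summable_on multi_indices"
    "infsum (\<lambda>m. \<bar>a m\<bar> * weight r m) multi_indices \<le> C"
    "\<And>x. x \<in> cube w r \<Longrightarrow> ((\<lambda>m. a m * monomial m (x - w)) has_sum f x) multi_indices"
    by (rule majorizedE[OF f]) blast
  define o' where "o' = restrict (\<lambda>_::'a. 0::nat) Basis"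
  define a' where "a' m = (if m = o' then 0 else a m)" for m
  have o': "o' \<in> multi_indices" by (simp add: o'_def)
  have nonconst: "\<exists>b\<in>Basis. m b \<noteq> 0" if "m \<in> multi_indices" "m \<noteq> o'" for m
    using PiE_ext[OF that(1) o'] that(2) by (auto simp: o'_def)
  have le: "\<bar>a' m\<bar> * weight t m \<le> \<bar>a m\<bar> * weight r m * (t / r)" if m: "m \<in> multi_indices" for m
  proof (cases "m = o'")
    case True
    then show ?thesis using r weight_pos[OF r0, of m] by (simp add: a'_def)
  next
    case False
    then obtain b where b: "b \<in> Basis" "m b \<noteq> 0"
      using nonconst[OF m] by blast
    have tr: "0 \<le> t / r" "t / r \<le> 1" using r r0 by auto
    have "weight t m = (\<Prod>c\<in>Basis. (t / r) ^ m c) * weight r m"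
      unfolding weight_def prod.distrib[symmetric] using r0 by (simp add: power_divide)
    moreover have "(\<Prod>c\<in>Basis. (t / r) ^ m c) \<le> t / r"
    proof -
      have "(\<Prod>c\<in>Basis. (t / r) ^ m c) = (t / r) ^ m b * (\<Prod>c\<in>Basis - {b}. (t / r) ^ m c)"
        using b by (subst prod.remove[of _ b]) auto
      also have "\<dots> \<le> (t / r) ^ 1 * 1"
        using tr b(2) by (intro mult_mono power_decreasing prod_le_1) (auto intro!: power_le_one prod_nonneg)
      finally show ?thesis by simp
    qed
    ultimately show ?thesis
      using False mult_left_mono[of "\<Prod>c\<in>Basis. (t / r) ^ m c" "t / r" "\<bar>a m\<bar> * weight r m"]
        weight_pos[OF r0, of m]
      by (simp add: a'_def mult_ac)
  qed
  have nn: "0 \<le> \<bar>a' m\<bar> * weight t m" for m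
    using weight_pos[OF r(1), of m] by simp
  have s: "(\<lambda>m. \<bar>a' m\<bar> * weight t m) summable_on multi_indices"
    by (rule summable_on_comparison_test[OF summable_on_cmult_left[OF a(1), of "t / r"]]) (use le nn in auto)
  have "infsum (\<lambda>m. \<bar>a' m\<bar> * weight t m) multi_indices
      \<le> infsum (\<lambda>m. \<bar>a m\<bar> * weight r m * (t / r)) multi_indices"
    using le by (intro infsum_mono s summable_on_cmult_left a(1))
  also have "\<dots> = infsum (\<lambda>m. \<bar>a m\<bar> * weight r m) multi_indices * (t / r)"
    by (rule infsum_cmult_left')
  also have "\<dots> \<le> C * (t / r)"
    using a(2) r r0 by (intro mult_right_mono) auto
  also have "\<dots> = t / r * C" by simp
  finally have i: "infsum (\<lambda>m. \<bar>a' m\<bar> * weight t m) multi_indices \<le> t / r * C" .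
  have m0: "monomial m 0 = (if m = o' then 1 else 0)" if m: "m \<in> multi_indices" for m :: "'a \<Rightarrow> nat"
  proof (cases "m = o'")
    case False
    then obtain b where "b \<in> Basis" "m b \<noteq> 0"
      using nonconst[OF m] by blast
    then have "\<exists>b\<in>Basis. (0 \<bullet> b) ^ m b = (0::real)" by (auto simp: power_0_left)
    then show ?thesis using False by (simp add: monomial_def prod_zero)
  qed (simp add: monomial_def o'_def)
  have delta: "((\<lambda>m. if m = o' then c else 0) has_sum c) multi_indices" for c :: real
    by (rule has_sum_finite_neutralI[where B = "{o'}"]) (use o' in auto)
  have "((\<lambda>m. a m * monomial m (w - w)) has_sum f w) multi_indices"
    using a(3)[of w] r0 by (simp add: cube_def)
  then have "((\<lambda>m. if m = o' then a o' else 0) has_sum f w) multi_indices"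
    by (rule has_sum_cong[THEN iffD1, rotated]) (simp add: m0)
  then have fw: "f w = a o'"
    using delta[of "a o'"] by (rule has_sum_unique)
  have "((\<lambda>m. a' m * monomial m (x - w)) has_sum (f x - f w)) multi_indices" if x: "x \<in> cube w t" for x
  proof -
    have "x \<in> cube w r" using x r unfolding cube_def by force
    from has_sum_add[OF a(3)[OF this] delta[of "- a o'"]]
    have "((\<lambda>m. a m * monomial m (x - w) + (if m = o' then - a o' else 0)) has_sum (f x - f w)) multi_indices"
      by (simp add: fw)
    moreover have "a m * monomial m (x - w) + (if m = o' then - a o' else 0) = a' m * monomial m (x - w)" for m
      by (simp add: a'_def o'_def monomial_def)
    ultimately show ?thesis by simp
  qed
  then show ?thesis
    unfolding majorized_def by (intro exI[of _ a'] conjI ballI s i)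
qed

section \<open>Abstract majorants\<close>

type_synonym coords = "real^2^5"

text \<open>Local estimates are proved once for every notion of norm with the properties below: for
  weighted norms of power series they give analyticity, for the absolute value at a single point
  they give convergence.\<close>

locale majorant =
  fixes U :: "coords set" and maj :: "(coords \<Rightarrow> real) \<Rightarrow> real \<Rightarrow> bool"
  assumes nonempty: "U \<noteq> {}"
    and maj_const: "maj (\<lambda>x. c) \<bar>c\<bar>"
    and maj_add: "maj f C \<Longrightarrow> maj g D \<Longrightarrow> maj (\<lambda>x. f x + g x) (C + D)"
    and maj_mult: "maj f C \<Longrightarrow> maj g D \<Longrightarrow> maj (\<lambda>x. f x * g x) (C * D)"
    and maj_suminf: "(\<And>n. maj (F n) (K n)) \<Longrightarrow> summable K \<Longrightarrow> maj (\<lambda>x. \<Sum>n. F n x) (\<Sum>n. K n)"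
    and maj_eval: "maj f C \<Longrightarrow> x \<in> U \<Longrightarrow> \<bar>f x\<bar> \<le> C"
    and maj_cong: "maj f C \<Longrightarrow> C \<le> D \<Longrightarrow> (\<And>x. x \<in> U \<Longrightarrow> f x = g x) \<Longrightarrow> maj g D"
begin

lemma maj_le: "maj f C \<Longrightarrow> C \<le> D \<Longrightarrow> maj f D"
  by (erule maj_cong) auto

lemma maj_nonneg: "maj f C \<Longrightarrow> 0 \<le> C"
  using nonempty maj_eval[of f C] abs_ge_zero order_trans by blast

lemma maj_cmult: "maj f C \<Longrightarrow> maj (\<lambda>x. c * f x) (\<bar>c\<bar> * C)"
  by (rule maj_mult[OF maj_const])

lemma maj_diff: "maj f C \<Longrightarrow> maj g D \<Longrightarrow> maj (\<lambda>x. f x - g x) (C + D)"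
  using maj_add[of f C "\<lambda>x. - 1 * g x" D] maj_cmult[of g D "- 1"] by simp

lemma maj_power: "maj f C \<Longrightarrow> maj (\<lambda>x. f x ^ n) (C ^ n)"
proof (induction n)
  case 0
  then show ?case using maj_const[of 1] by simp
next
  case (Suc n)
  then show ?case using maj_mult[of f C "\<lambda>x. f x ^ n" "C ^ n"] by simp
qed

text \<open>The reciprocal is the geometric series in (c - f) / c, whose ratio has bound D / |c| <
  1. Closure under products and series is all that is used.\<close>

lemma maj_inverse:
  assumes f: "maj (\<lambda>x. f x - c) D" and c: "D < \<bar>c\<bar>"
  shows "maj (\<lambda>x. 1 / f x) (1 / (\<bar>c\<bar> - D))"
proof -
  have D: "0 \<le> D" using maj_nonneg[OF f] .
  have c0: "c \<noteq> 0" using c D by auto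
  let ?F = "\<lambda>n x. 1 / c * ((- 1 / c) * (f x - c)) ^ n"
  let ?K = "\<lambda>n. 1 / \<bar>c\<bar> * (D / \<bar>c\<bar>) ^ n"
  have "maj (\<lambda>x. (- 1 / c) * (f x - c)) (D / \<bar>c\<bar>)"
    using maj_cmult[OF f, of "- 1 / c"] by (simp add: abs_divide)
  from maj_cmult[OF maj_power[OF this], of "1 / c"]
  have F: "maj (?F n) (?K n)" for n by (simp add: abs_divide)
  have "norm (D / \<bar>c\<bar>) < 1" using c D by simp
  then have "(\<lambda>n. (D / \<bar>c\<bar>) ^ n) sums (1 / (1 - D / \<bar>c\<bar>))" by (rule geometric_sums)
  from sums_mult[OF this, of "1 / \<bar>c\<bar>"] have K: "?K sums (1 / (\<bar>c\<bar> - D))"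
    using c0 c by (simp add: field_simps)
  show ?thesis
  proof (rule maj_cong[OF maj_suminf[OF F sums_summable[OF K]]])
    show "suminf ?K \<le> 1 / (\<bar>c\<bar> - D)" using sums_unique[OF K] by simp
    fix x assume x: "x \<in> U"
    have fx: "\<bar>f x - c\<bar> < \<bar>c\<bar>" using maj_eval[OF f x] c by simp
    then have "f x \<noteq> 0" by auto
    have "norm ((- 1 / c) * (f x - c)) < 1" using fx c0 by (simp add: abs_mult abs_divide)
    then have "(\<lambda>n. ((- 1 / c) * (f x - c)) ^ n) sums (1 / (1 - (- 1 / c) * (f x - c)))"
      by (rule geometric_sums)
    from sums_mult[OF this, of "1 / c"] have "(\<lambda>n. ?F n x) sums (1 / f x)"
      using c0 \<open>f x \<noteq> 0\<close> by (simp add: field_simps)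
    then show "(\<Sum>n. ?F n x) = 1 / f x" by (rule sums_unique[symmetric])
  qed
qed

text \<open>The increments telescope and their bounds are summable, so the pointwise limit is itself
  the sum of a majorized series. In the power series norm this is what makes limits
  analytic.\<close>

lemma maj_limit:
  assumes f0: "maj (f 0) C" and f: "\<And>n. maj (\<lambda>x. f (Suc n) x - f n x) (K n)" and K: "summable K"
  obtains g where "maj (\<lambda>x. g x - f 0 x) (suminf K)" "maj g (C + suminf K)"
    "\<And>x. x \<in> U \<Longrightarrow> (\<lambda>n. f n x) \<longlonglongrightarrow> g x"
proof -
  let ?s = "\<lambda>x. \<Sum>n. f (Suc n) x - f n x"
  have s: "maj ?s (suminf K)" by (rule maj_suminf[OF f K])
  have lim: "(\<lambda>n. f n x) \<longlonglongrightarrow> f 0 x + ?s x" if x: "x \<in> U" for x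
  proof -
    have "summable (\<lambda>n. f (Suc n) x - f n x)"
      using maj_eval[OF f x] by (intro summable_comparison_test'[OF K, of 0]) simp
    then have "(\<lambda>n. \<Sum>i<n. f (Suc i) x - f i x) \<longlonglongrightarrow> ?s x"
      by (rule summable_LIMSEQ)
    then have "(\<lambda>n. f n x - f 0 x) \<longlonglongrightarrow> ?s x"
      unfolding sum_lessThan_telescope[of "\<lambda>n. f n x"] .
    from tendsto_add[OF tendsto_const[of "f 0 x"] this] show ?thesis by simp
  qed
  show thesis
  proof (rule that[of "\<lambda>x. f 0 x + ?s x"])
    show "maj (\<lambda>x. f 0 x + ?s x - f 0 x) (suminf K)" using s by simp
    show "maj (\<lambda>x. f 0 x + ?s x) (C + suminf K)" by (rule maj_add[OF f0 s])
  qed (rule lim)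
qed

end

lemma majorant_majorized:
  assumes "r > 0"
  shows "majorant (cube w r) (majorized w r)"
proof
  have "w \<in> cube w r" using assms by (simp add: cube_def)
  then show "cube w r \<noteq> {}" by blast
qed (fact majorized_const[OF assms] majorized_add[OF assms] majorized_mult[OF assms]
    majorized_suminf[OF assms] majorized_eval majorized_cong)+

lemma majorant_point: "majorant {w} (\<lambda>f C. \<bar>f w\<bar> \<le> C)"
proof
  fix F :: "nat \<Rightarrow> coords \<Rightarrow> real" and K :: "nat \<Rightarrow> real"
  assume F: "\<And>n. \<bar>F n w\<bar> \<le> K n" and K: "summable K"
  have s: "summable (\<lambda>n. \<bar>F n w\<bar>)"
    using F by (intro summable_comparison_test'[OF K, of 0]) simp
  have "\<bar>\<Sum>n. F n w\<bar> \<le> (\<Sum>n. \<bar>F n w\<bar>)" by (rule summable_rabs[OF s])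
  also have "\<dots> \<le> suminf K" by (rule suminf_le[OF F s K])
  finally show "\<bar>\<Sum>n. F n w\<bar> \<le> suminf K" .
next
  fix f g :: "coords \<Rightarrow> real" and C D :: real
  assume "\<bar>f w\<bar> \<le> C" "\<bar>g w\<bar> \<le> D"
  then show "\<bar>f w * g w\<bar> \<le> C * D"
    unfolding abs_mult by (intro mult_mono) auto
qed auto

text \<open>Order of vanishing at the origin, uniformly over all majorants.\<close>

definition vanishing_bound :: "nat \<Rightarrow> ((5 \<Rightarrow> real) \<Rightarrow> real) \<Rightarrow> real \<Rightarrow> real \<Rightarrow> bool" where
  "vanishing_bound n p C \<delta> \<longleftrightarrow> 0 \<le> C \<and> 0 < \<delta> \<and>
     (\<forall>U maj u \<epsilon>. majorant U maj \<longrightarrow> 0 \<le> \<epsilon> \<longrightarrow> \<epsilon> \<le> \<delta> \<longrightarrow> (\<forall>j. maj (u j) \<epsilon>) \<longrightarrow>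
        maj (\<lambda>x. p (\<lambda>j. u j x)) (C * \<epsilon> ^ n))"

definition vanishing :: "nat \<Rightarrow> ((5 \<Rightarrow> real) \<Rightarrow> real) \<Rightarrow> bool" where
  "vanishing n p \<longleftrightarrow> (\<exists>C \<delta>. vanishing_bound n p C \<delta>)"

lemma vanishing_boundD:
  assumes "vanishing_bound n p C \<delta>"
  shows "0 \<le> C" "0 < \<delta>"
    "majorant U maj \<Longrightarrow> 0 \<le> \<epsilon> \<Longrightarrow> \<epsilon> \<le> \<delta> \<Longrightarrow> (\<And>j. maj (u j) \<epsilon>) \<Longrightarrow>
        maj (\<lambda>x. p (\<lambda>j. u j x)) (C * \<epsilon> ^ n)"
proof -
  note * = assms[unfolded vanishing_bound_def]
  show "0 \<le> C" "0 < \<delta>" using * by blast+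
  assume "majorant U maj" "0 \<le> \<epsilon>" "\<epsilon> \<le> \<delta>" "\<And>j. maj (u j) \<epsilon>"
  then show "maj (\<lambda>x. p (\<lambda>j. u j x)) (C * \<epsilon> ^ n)"
    using *[THEN conjunct2, THEN conjunct2, rule_format, of U maj \<epsilon> u] by simp
qed

lemma vanishingI:
  assumes "0 \<le> C" "0 < \<delta>"
    "\<And>U maj u \<epsilon>. majorant U maj \<Longrightarrow> 0 \<le> \<epsilon> \<Longrightarrow> \<epsilon> \<le> \<delta> \<Longrightarrow> (\<And>j. maj (u j) \<epsilon>) \<Longrightarrow>
        maj (\<lambda>x. p (\<lambda>j. u j x)) (C * \<epsilon> ^ n)"
  shows "vanishing n p"
proof -
  have "vanishing_bound n p C \<delta>"
    unfolding vanishing_bound_def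
  proof (intro conjI allI impI assms(1,2))
    fix U maj and u :: "5 \<Rightarrow> coords \<Rightarrow> real" and \<epsilon> :: real
    assume "majorant U maj" "0 \<le> \<epsilon>" "\<epsilon> \<le> \<delta>" "\<forall>j. maj (u j) \<epsilon>"
    then show "maj (\<lambda>x. p (\<lambda>j. u j x)) (C * \<epsilon> ^ n)"
      using assms(3)[of U maj \<epsilon> u] by simp
  qed
  then show ?thesis unfolding vanishing_def by blast
qed

lemma vanishing_const: "vanishing 0 (\<lambda>u. c)"
  by (rule vanishingI[of "\<bar>c\<bar>" 1]) (simp_all add: majorant.maj_const)

lemma vanishing_coordinate: "vanishing 1 (\<lambda>u. u j)"
  by (rule vanishingI[of 1 1]) simp_all

lemma vanishing_add:
  assumes "vanishing n p" "vanishing n q"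
  shows "vanishing n (\<lambda>u. p u + q u)"
proof -
  obtain C \<delta> where p': "vanishing_bound n p C \<delta>"
    using assms(1) unfolding vanishing_def by blast
  note p = vanishing_boundD[OF p']
  obtain D \<gamma> where q': "vanishing_bound n q D \<gamma>"
    using assms(2) unfolding vanishing_def by blast
  note q = vanishing_boundD[OF q']
  show ?thesis
  proof (rule vanishingI[of "C + D" "min \<delta> \<gamma>"])
    fix U maj and u :: "5 \<Rightarrow> coords \<Rightarrow> real" and \<epsilon> :: real
    assume *: "majorant U maj" "0 \<le> \<epsilon>" "\<epsilon> \<le> min \<delta> \<gamma>" "\<And>j. maj (u j) \<epsilon>"
    show "maj (\<lambda>x. p (\<lambda>j. u j x) + q (\<lambda>j. u j x)) ((C + D) * \<epsilon> ^ n)"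
      unfolding distrib_right
      by (rule majorant.maj_add[OF *(1) p(3)[OF *(1,2) _ *(4)] q(3)[OF *(1,2) _ *(4)]]) (use *(3) in simp_all)
  qed (use p(1,2) q(1,2) in auto)
qed

lemma vanishing_mult:
  assumes "vanishing m p" "vanishing n q"
  shows "vanishing (m + n) (\<lambda>u. p u * q u)"
proof -
  obtain C \<delta> where p': "vanishing_bound m p C \<delta>"
    using assms(1) unfolding vanishing_def by blast
  note p = vanishing_boundD[OF p']
  obtain D \<gamma> where q': "vanishing_bound n q D \<gamma>"
    using assms(2) unfolding vanishing_def by blast
  note q = vanishing_boundD[OF q']
  show ?thesis
  proof (rule vanishingI[of "C * D" "min \<delta> \<gamma>"])
    fix U maj and u :: "5 \<Rightarrow> coords \<Rightarrow> real" and \<epsilon> :: real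
    assume *: "majorant U maj" "0 \<le> \<epsilon>" "\<epsilon> \<le> min \<delta> \<gamma>" "\<And>j. maj (u j) \<epsilon>"
    have eq: "C * D * \<epsilon> ^ (m + n) = (C * \<epsilon> ^ m) * (D * \<epsilon> ^ n)" by (simp add: power_add)
    show "maj (\<lambda>x. p (\<lambda>j. u j x) * q (\<lambda>j. u j x)) (C * D * \<epsilon> ^ (m + n))"
      unfolding eq
      by (rule majorant.maj_mult[OF *(1) p(3)[OF *(1,2) _ *(4)] q(3)[OF *(1,2) _ *(4)]]) (use *(3) in simp_all)
  qed (use p(1,2) q(1,2) in auto)
qed

lemma vanishing_le:
  assumes "vanishing n p" "m \<le> n"
  shows "vanishing m p"
proof -
  obtain C \<delta> where p': "vanishing_bound n p C \<delta>"
    using assms(1) unfolding vanishing_def by blast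
  note p = vanishing_boundD[OF p']
  show ?thesis
  proof (rule vanishingI[of C "min \<delta> 1"])
    fix U maj and u :: "5 \<Rightarrow> coords \<Rightarrow> real" and \<epsilon> :: real
    assume *: "majorant U maj" "0 \<le> \<epsilon>" "\<epsilon> \<le> min \<delta> 1" "\<And>j. maj (u j) \<epsilon>"
    have "C * \<epsilon> ^ n \<le> C * \<epsilon> ^ m"
      using * p(1) assms(2) by (intro mult_left_mono power_decreasing) auto
    then show "maj (\<lambda>x. p (\<lambda>j. u j x)) (C * \<epsilon> ^ m)"
      by (rule majorant.maj_le[OF *(1) p(3)[OF *(1,2) _ *(4)], rotated 1]) (use *(3) in simp)
  qed (use p(1,2) in auto)
qed

lemma vanishing_cmult: "vanishing n p \<Longrightarrow> vanishing n (\<lambda>u. c * p u)"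
  using vanishing_mult[OF vanishing_const, of n p c] by simp

lemma vanishing_diff: "vanishing n p \<Longrightarrow> vanishing n q \<Longrightarrow> vanishing n (\<lambda>u. p u - q u)"
  using vanishing_add[of n p "\<lambda>u. - 1 * q u"] vanishing_cmult[of n q "- 1"] by simp

lemma vanishing_mult_left: "vanishing 0 p \<Longrightarrow> vanishing n q \<Longrightarrow> vanishing n (\<lambda>u. p u * q u)"
  using vanishing_mult[of 0 p n q] by simp

lemma vanishing_1_1: "vanishing 1 p \<Longrightarrow> vanishing 1 q \<Longrightarrow> vanishing 2 (\<lambda>u. p u * q u)"
  using vanishing_mult[of 1 p 1 q] by (simp add: numeral_2_eq_2)

lemma vanishing_inverse:
  assumes "vanishing 1 (\<lambda>u. p u - c)" "c \<noteq> 0"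
  shows "vanishing 0 (\<lambda>u. 1 / p u)"
proof -
  obtain C \<delta> where p': "vanishing_bound 1 (\<lambda>u. p u - c) C \<delta>"
    using assms(1) unfolding vanishing_def by blast
  note p = vanishing_boundD[OF p']
  \<comment> \<open>Chosen so that C * \<epsilon> is at most |c| / 2; the summand 1 keeps the
    denominator positive when C = 0.\<close>
  define \<gamma> where "\<gamma> = min \<delta> (\<bar>c\<bar> / (2 * (C + 1)))"
  show ?thesis
  proof (rule vanishingI[of "2 / \<bar>c\<bar>" \<gamma>])
    show "0 < \<gamma>" using p(1,2) assms(2) by (simp add: \<gamma>_def)
    fix U maj and u :: "5 \<Rightarrow> coords \<Rightarrow> real" and \<epsilon> :: real
    assume *: "majorant U maj" "0 \<le> \<epsilon>" "\<epsilon> \<le> \<gamma>" "\<And>j. maj (u j) \<epsilon>"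
    have "C * \<epsilon> \<le> (C + 1) * \<epsilon>" using * by (simp add: mult_right_mono)
    also have "\<dots> \<le> (C + 1) * (\<bar>c\<bar> / (2 * (C + 1)))"
      using * p(1) by (intro mult_left_mono) (auto simp: \<gamma>_def)
    also have "\<dots> = \<bar>c\<bar> / 2" using p(1) by (simp add: field_simps)
    finally have "C * \<epsilon> ^ 1 \<le> \<bar>c\<bar> / 2" by simp
    from majorant.maj_le[OF *(1) p(3)[OF *(1,2) _ *(4)] this]
    have m: "maj (\<lambda>x. p (\<lambda>j. u j x) - c) (\<bar>c\<bar> / 2)" using *(3) by (simp add: \<gamma>_def)
    have "maj (\<lambda>x. 1 / p (\<lambda>j. u j x)) (1 / (\<bar>c\<bar> - \<bar>c\<bar> / 2))"
      by (rule majorant.maj_inverse[OF *(1) m]) (use assms(2) in simp)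
    then show "maj (\<lambda>x. 1 / p (\<lambda>j. u j x)) (2 / \<bar>c\<bar> * \<epsilon> ^ 0)"
      by simp
  qed simp
qed

lemmas vanishing_intros =
  vanishing_const vanishing_coordinate vanishing_add vanishing_diff vanishing_cmult

section \<open>The action on projective invariants\<close>

lemma five_wrap:
  "(i::5) + 5 = i" "(i::5) + 6 = i + 1" "(i::5) + 7 = i + 2" "(i::5) + 8 = i + 3" "(i::5) + 9 = i + 4"
  by simp_all

definition golden :: real where
  "golden = (1 + sqrt 5) / 2"

lemma golden_square: "golden^2 = golden + 1"
  by (simp add: golden_def power2_eq_square field_simps)

lemma golden_bounds: "1.6 < golden" "golden < 1.7"
proof -
  have "2.2 < sqrt 5" by (rule real_less_rsqrt) (simp add: power2_eq_square)
  moreover have "sqrt 5 < 2.4" by (rule real_less_lsqrt) (simp_all add: power2_eq_square)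
  ultimately show "1.6 < golden" "golden < 1.7" by (simp_all add: golden_def)
qed

text \<open>From 3 * (pi / 5) = pi - 2 * (pi / 5) the triple and double angle formulas give a cubic
  for the cosine c with the factor c + 1. The remaining quadratic 4 * c^2 - 2 * c - 1 has golden / 2
  as its only positive root.\<close>

lemma golden_eq: "2 * cos (pi / 5) = golden"
proof -
  let ?c = "cos (pi / 5)"
  define h where "h = golden / 2"
  have c0: "?c > 0" by (intro cos_gt_zero) auto
  have "cos (3 * (pi / 5)) = cos (pi - 2 * (pi / 5))" by (simp add: field_simps)
  also have "\<dots> = - cos (2 * (pi / 5))" unfolding cos_diff by simp
  finally have "4 * ?c^3 - 3 * ?c = - (2 * ?c^2 - 1)"
    by (simp only: cos_treble_cos cos_double_cos)
  then have "(?c + 1) * (4 * ?c^2 - 2 * ?c - 1) = 0" by algebra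
  then have "4 * ?c^2 - 2 * ?c - 1 = 0" using c0 by simp
  moreover have "4 * h^2 - 2 * h - 1 = 0"
    using golden_square by (simp add: h_def power_divide field_simps)
  ultimately have "(?c - h) * (4 * (?c + h) - 2) = 0" by algebra
  moreover have "4 * (?c + h) - 2 > 0" using c0 golden_bounds by (simp add: h_def)
  ultimately show ?thesis by (simp add: h_def)
qed

text \<open>The invariants of a pentagon form a frieze of width two, that is, a point of the cluster variety of
  type \<open>A\<^sub>2\<close>.\<close>

definition frieze :: "(5 \<Rightarrow> real) \<Rightarrow> bool" where
  "frieze z \<longleftrightarrow> (\<forall>i. z i * z (i + 1) = 1 + z (i + 3))"

text \<open>The formulas of \<open>edge\<close> and \<open>diagonal\<close> are the determinants of
  three image vertices, divided by the common determinant of consecutive vertices of a normalized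
  lift; they are computed in \<open>heat_vector_dets\<close>. Accordingly \<open>heat_frieze\<close>
  below is the same cross-ratio of the image that \<open>invariants\<close> forms.\<close>

definition edge :: "real \<Rightarrow> (5 \<Rightarrow> real) \<Rightarrow> 5 \<Rightarrow> real" where
  "edge l z i = 1 + l + 4 * l^2 + (1 + l + l^2 + l^3) * z (i + 3) + (2 * l + l^2) * (z i + z (i + 1))"

definition diagonal :: "real \<Rightarrow> (5 \<Rightarrow> real) \<Rightarrow> 5 \<Rightarrow> real" where
  "diagonal l z i = 1 + 3 * l + (1 + 2 * l + 2 * l^2) * (z (i + 1) + z (i + 4))
     + (2 * l + 3 * l^2 + l^3) * (z (i + 1) * z (i + 4))"

definition heat_frieze :: "real \<Rightarrow> (5 \<Rightarrow> real) \<Rightarrow> 5 \<Rightarrow> real" where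
  "heat_frieze l z i = diagonal l z i * edge l z (i + 2) / (edge l z (i + 1) * edge l z (i + 3))"

lemma edge_pos: "l > 0 \<Longrightarrow> (\<And>i. z i > 0) \<Longrightarrow> edge l z i > 0"
  unfolding edge_def by (intro add_pos_pos mult_pos_pos) (simp_all add: add_pos_pos)

lemma diagonal_pos: "l > 0 \<Longrightarrow> (\<And>i. z i > 0) \<Longrightarrow> diagonal l z i > 0"
  unfolding diagonal_def by (intro add_pos_pos mult_pos_pos) (simp_all add: add_pos_pos)

lemma heat_frieze_pos: "l > 0 \<Longrightarrow> (\<And>i. z i > 0) \<Longrightarrow> heat_frieze l z i > 0"
  unfolding heat_frieze_def by (intro divide_pos_pos mult_pos_pos edge_pos diagonal_pos)

text \<open>With \<open>N = z i\<close> and the neighbours \<open>a, b\<close>, a frieze is a solution of \<open>N a b = 1 + a + b\<close>; the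
  products below then depend on \<open>N\<close> and \<open>a + b\<close> only.\<close>

lemma frieze_products:
  fixes l :: real and z :: "5 \<Rightarrow> real" and i :: 5
  assumes z: "frieze z"
  defines "N \<equiv> z i" and "a \<equiv> z (i + 1)" and "b \<equiv> z (i + 4)"
  defines "c \<equiv> 1 - l + 3 * l^2" and "\<beta> \<equiv> 2 * l + l^2" and "x \<equiv> 1 + l + l^2 + l^3 + (2 * l + l^2) * N"
  shows "N * a * b = 1 + a + b"
    and "N * (edge l z (i + 1) * edge l z (i + 3)) =
      N * c^2 + N * c * (x + \<beta>) * (a + b) + (x - \<beta>)^2 * (1 + (a + b)) + x * \<beta> * N * (a + b)^2"
    and "N * diagonal l z i = N * (1 + 3 * l) + N * (1 + 2 * l + 2 * l^2) * (a + b)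
      + (2 * l + 3 * l^2 + l^3) * (1 + (a + b))"
    and "edge l z (i + 2) = 1 + l + 4 * l^2 + (1 + l + l^2 + l^3) * N + \<beta> * (N * (a + b) - 2)"
proof -
  have r: "N * a = 1 + z (i + 3)" "b * N = 1 + z (i + 2)" "a * z (i + 2) = 1 + b"
    using z[unfolded frieze_def, rule_format, of i] z[unfolded frieze_def, rule_format, of "i + 4"]
      z[unfolded frieze_def, rule_format, of "i + 1"]
    unfolding N_def a_def b_def by (simp_all add: add.assoc five_wrap)
  have u: "z (i + 2) = N * b - 1" and v: "z (i + 3) = N * a - 1"
    using r by (simp_all add: mult.commute)
  show nab: "N * a * b = 1 + a + b" using r(3) u by (simp add: algebra_simps)
  have e1: "edge l z (i + 1) = c + x * b + \<beta> * a" and e3: "edge l z (i + 3) = c + x * a + \<beta> * b"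
    unfolding edge_def c_def x_def \<beta>_def using u v
    by (simp_all add: add.assoc five_wrap a_def[symmetric] b_def[symmetric] N_def[symmetric])
       (simp_all add: algebra_simps power2_eq_square)
  show "N * (edge l z (i + 1) * edge l z (i + 3)) =
      N * c^2 + N * c * (x + \<beta>) * (a + b) + (x - \<beta>)^2 * (1 + (a + b)) + x * \<beta> * N * (a + b)^2"
    unfolding e1 e3 using nab by algebra
  show "N * diagonal l z i = N * (1 + 3 * l) + N * (1 + 2 * l + 2 * l^2) * (a + b)
      + (2 * l + 3 * l^2 + l^3) * (1 + (a + b))"
    unfolding diagonal_def a_def[symmetric] b_def[symmetric] using nab by algebra
  show "edge l z (i + 2) = 1 + l + 4 * l^2 + (1 + l + l^2 + l^3) * N + \<beta> * (N * (a + b) - 2)"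
  proof -
    have "edge l z (i + 2) = 1 + l + 4 * l^2 + (1 + l + l^2 + l^3) * N + \<beta> * (z (i + 2) + z (i + 3))"
      by (simp add: edge_def \<beta>_def N_def add.assoc five_wrap)
    then show ?thesis unfolding u v by algebra
  qed
qed

section \<open>Polynomial inequalities for the contraction of the largest entry\<close>

lemmas golden_nonneg_simps = add_nonneg_nonneg mult_nonneg_nonneg zero_le_power

text \<open>Here \<open>N\<close> stands for an entry and \<open>S\<close> for the sum of its two
  neighbours. The difference is expanded in powers of l, with n = N - golden and t = N * S - 2 *
  golden^2 as nonnegative variables. Everything containing n has nonnegative coefficients. The part
  in t alone has coefficients of both signs; for n = 0 and l = golden the inequality is an equality
  for every t, and this part must be recognized as a combination of squares vanishing at l =
  golden.\<close>

lemma large_coordinate_bound: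
  fixes l N S :: real
  assumes l: "l > 0" and N: "N \<ge> golden" and T: "N * S \<ge> 2 * golden^2"
  defines "c \<equiv> 1 - l + 3 * l^2" and "\<beta> \<equiv> 2 * l + l^2" and "x \<equiv> 1 + l + l^2 + l^3 + (2 * l + l^2) * N"
  shows "l * (N - golden) * N^2 \<le> N * (N * (N * c^2 + N * c * (x + \<beta>) * S + (x - \<beta>)^2 * (1 + S) + x * \<beta> * N * S^2))
      - N * (N * (1 + 3 * l) + N * (1 + 2 * l + 2 * l^2) * S + (2 * l + 3 * l^2 + l^3) * (1 + S))
        * (1 + l + 4 * l^2 + (1 + l + l^2 + l^3) * N + \<beta> * (N * S - 2))" (is "_ \<le> ?D")
proof -
  define T where "T = N * S"
  define n where "n = N - golden"
  define t where "t = T - 2 * golden^2"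
  have nt: "n \<ge> 0" "t \<ge> 0" using N T by (simp_all add: n_def t_def T_def)
  have Ne: "N = golden + n" and Te: "T = 2 * golden^2 + t" by (simp_all add: n_def t_def)
  note g = golden_square golden_bounds
  \<comment> \<open>\<open>R1\<close> to \<open>R5\<close> are the cofactors of n in the
    coefficients of l to l^5, where for \<open>R1\<close> the term n * N^2 of the claim has been set
    aside. Reduced by golden^2 = golden + 1 they have nonnegative coefficients.\<close>
  define R1 where "R1 = (23 * golden + 13) + (8 * golden + 3) * t + (18 * golden + 10) * n + (6 * golden + 1) * n * t + (4 * golden + 1) * n^2 + 2 * n^2 * t"
  have R1: "R1 \<ge> 0"
    unfolding R1_def by (intro golden_nonneg_simps nt) (use golden_bounds in simp_all)
  have A1: "(- 2) * T + (- 2) * N + (- 3) * N * T + (- 4) * N^2 + 1 * N^2 * T + (- 2) * N^3 + 2 * N^3 * T = (2 * golden + 1) * t + n * N^2 + n * R1"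
    unfolding Ne Te R1_def using golden_square by algebra
  define R2 where "R2 = (123 * golden + 78) + (41 * golden + 27) * t + (8 * golden - 2) * t^2 + (87 * golden + 53) * n + (25 * golden + 4) * n * t + 4 * n * t^2 + (22 * golden + 7) * n^2 + 3 * n^2 * t + 4 * n^3"
  have R2: "R2 \<ge> 0"
    unfolding R2_def by (intro golden_nonneg_simps nt) (use golden_bounds in simp_all)
  have A2: "3 * T + (- 4) * T^2 + 3 * N + (- 6) * N * T + (- 2) * N * T^2 + 3 * N^2 + (- 12) * N^2 * T + 4 * N^2 * T^2 + 1 * N^3 + 3 * N^3 * T + 4 * N^4 = (4 * golden + 2) * t + (2 * golden) * t^2 + n * R2"
    unfolding Ne Te R2_def using golden_square by algebra
  define R3 where "R3 = (226 * golden + 136) + (75 * golden + 37) * t + (8 * golden - 3) * t^2 + (140 * golden + 96) * n + (43 * golden + 14) * n * t + 4 * n * t^2 + (34 * golden + 6) * n^2 + 9 * n^2 * t + 4 * n^3"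
  have R3: "R3 \<ge> 0"
    unfolding R3_def by (intro golden_nonneg_simps nt) (use golden_bounds in simp_all)
  have A3: "4 * T + (- 8) * T^2 + 4 * N + (- 10) * N * T + (- 3) * N * T^2 + (- 10) * N^2 + (- 2) * N^2 * T + 4 * N^2 * T^2 + (- 12) * N^3 + 9 * N^3 * T + 4 * N^4 = (-1 - 2 * golden) * t + (golden - 4) * t^2 + n * R3"
    unfolding Ne Te R3_def using golden_square by algebra
  define R4 where "R4 = (152 * golden + 97) + (42 * golden + 7) * t + (2 * golden + 1) * t^2 + (106 * golden + 40) * n + (16 * golden + 9) * n * t + 1 * n * t^2 + (12 * golden + 18) * n^2 + 4 * n^2 * t + 1 * n^3"
  have R4: "R4 \<ge> 0"
    unfolding R4_def by (intro golden_nonneg_simps nt) (use golden_bounds in simp_all)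
  have A4: "(- 3) * T + (- 5) * T^2 + (- 3) * N + (- 17) * N * T + 1 * N * T^2 + (- 8) * N^2 + 5 * N^2 * T + 1 * N^2 * T^2 + 10 * N^3 + 4 * N^3 * T + 1 * N^4 = (-2 - 4 * golden) * t + (2 * golden - 4) * t^2 + n * R4"
    unfolding Ne Te R4_def using golden_square by algebra
  define R5 where "R5 = (24 * golden + 14) + (10 * golden - 1) * t + 1 * t^2 + (12 * golden + 2) * n + 3 * n * t + 2 * n^2"
  have R5: "R5 \<ge> 0"
    unfolding R5_def by (intro golden_nonneg_simps nt) (use golden_bounds in simp_all)
  have A5: "(- 2) * T + (- 1) * T^2 + (- 2) * N + (- 5) * N * T + 1 * N * T^2 + (- 4) * N^2 + 3 * N^2 * T + 2 * N^3 = (2 * golden + 1) * t + (golden - 1) * t^2 + n * R5"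
    unfolding Ne Te R5_def using golden_square by algebra
  have "?D = l * ((- 2) * T + (- 2) * N + (- 3) * N * T + (- 4) * N^2 + 1 * N^2 * T + (- 2) * N^3 + 2 * N^3 * T) + l^2 * (3 * T + (- 4) * T^2 + 3 * N + (- 6) * N * T + (- 2) * N * T^2 + 3 * N^2 + (- 12) * N^2 * T + 4 * N^2 * T^2 + 1 * N^3 + 3 * N^3 * T + 4 * N^4) + l^3 * (4 * T + (- 8) * T^2 + 4 * N + (- 10) * N * T + (- 3) * N * T^2 + (- 10) * N^2 + (- 2) * N^2 * T + 4 * N^2 * T^2 + (- 12) * N^3 + 9 * N^3 * T + 4 * N^4) + l^4 * ((- 3) * T + (- 5) * T^2 + (- 3) * N + (- 17) * N * T + 1 * N * T^2 + (- 8) * N^2 + 5 * N^2 * T + 1 * N^2 * T^2 + 10 * N^3 + 4 * N^3 * T + 1 * N^4) + l^5 * ((- 2) * T + (- 1) * T^2 + (- 2) * N + (- 5) * N * T + 1 * N * T^2 + (- 4) * N^2 + 3 * N^2 * T + 2 * N^3)"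
    unfolding c_def \<beta>_def x_def T_def by algebra
  also have "\<dots> = l * n * N^2 + l * (n * R1) + l^2 * (n * R2) + l^3 * (n * R3) + l^4 * (n * R4) + l^5 * (n * R5)
      + l * ((2 * golden + 1) * t) * (1 + l - l^2)^2 + l^2 * t^2 * (golden - 1) * (l - golden)^2 * (l + 2)"
    unfolding A1 A2 A3 A4 A5 using golden_square by algebra
  also have "\<dots> \<ge> l * n * N^2"
  proof -
    have "0 \<le> l * (n * R1) + l^2 * (n * R2) + l^3 * (n * R3) + l^4 * (n * R4) + l^5 * (n * R5)
      + l * ((2 * golden + 1) * t) * (1 + l - l^2)^2 + l^2 * t^2 * (golden - 1) * (l - golden)^2 * (l + 2)"
      by (intro golden_nonneg_simps nt R1 R2 R3 R4 R5 zero_le_power2)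
        (use golden_bounds l in simp_all)
    then show ?thesis by simp
  qed
  finally show ?thesis by (simp add: n_def)
qed

text \<open>For an entry N below golden the comparison value is the mean P of its neighbours. In the
  expansion in powers of l the constant term is exactly the left side, and each of the six remaining
  coefficients is nonnegative by itself.\<close>

lemma small_coordinate_bound:
  fixes l N P :: real
  assumes l: "l > 0" and N: "N > 0" "N \<le> golden" and P: "P \<ge> golden" and NP: "N * P^2 \<ge> 1 + 2 * P"
  defines "c \<equiv> 1 - l + 3 * l^2" and "\<beta> \<equiv> 2 * l + l^2" and "x \<equiv> 1 + l + l^2 + l^3 + (2 * l + l^2) * N"
  shows "(1 + 2 * P) * (N + 1) * (P - N) \<le> P * (N * c^2 + N * c * (x + \<beta>) * (2 * P) + (x - \<beta>)^2 * (1 + 2 * P) + x * \<beta> * N * (2 * P)^2)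
      - (N * (1 + 3 * l) + N * (1 + 2 * l + 2 * l^2) * (2 * P) + (2 * l + 3 * l^2 + l^3) * (1 + 2 * P))
        * (1 + l + 4 * l^2 + (1 + l + l^2 + l^3) * N + \<beta> * (N * (2 * P) - 2))" (is "_ \<le> ?D")
proof -
  define p where "p = P - golden"
  have p: "p \<ge> 0" using P by (simp add: p_def)
  have Pe: "P = golden + p" by (simp add: p_def)
  have P0: "P > 0" using P golden_bounds by simp
  \<comment> \<open>\<open>m\<close> and \<open>g\<close> are the slacks of the lower and the upper
    bound on N. For \<open>B1\<close>, \<open>B3\<close>, \<open>B4\<close> and \<open>B5\<close>
    the coefficient is multiplied by P^2 or P^4, which clears the denominators that N = (m + 1 + 2 *
    P) / P^2 brings in; the result has nonnegative coefficients in p and the slacks.\<close>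
  define m where "m = N * P^2 - (1 + 2 * P)"
  have m: "m \<ge> 0" using NP by (simp add: m_def)
  define g where "g = golden - N"
  have g: "g \<ge> 0" using N by (simp add: g_def)
  have B1: "0 \<le> (- 2) + (- 6) * P + (- 4) * P^2 + (- 2) * N + 12 * N * P^2 + 8 * N * P^3 + (- 4) * N^2 + (- 10) * N^2 * P + (- 4) * N^2 * P^2" (is "0 \<le> ?B")
  proof -
    define br where "br = (6 * golden + 4) + (30 * golden + 16) * p + (20 * golden + 12) * p^2 + 8 * p^3"
    define val where "val = (80 * golden + 50) * p + (102 * golden + 58) * p^2 + (40 * golden + 26) * p^3 + 12 * p^4"
    define k where "k = (14 * golden + 8) + (8 * golden + 10) * p + 4 * p^2"
    have nn: "br \<ge> 0" "val \<ge> 0" "k \<ge> 0"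
      unfolding br_def val_def k_def by (intro golden_nonneg_simps p; use golden_bounds in simp)+
    have "P^2 * ?B = P^2 * N * k * g + br * m + val"
      unfolding br_def val_def k_def g_def m_def Pe using golden_square by algebra
    also have "\<dots> \<ge> 0" by (intro golden_nonneg_simps nn m g) (use N P0 in simp_all)
    finally show ?thesis using P0 by (simp add: zero_le_mult_iff)
  qed
  have B2: "0 \<le> 3 + 7 * P + 2 * P^2 + 2 * N + (- 9) * N * P + (- 16) * N * P^2 + 12 * N * P^3 + (- 4) * N^2 + (- 20) * N^2 * P + (- 14) * N^2 * P^2 + 16 * N^2 * P^3" (is "0 \<le> ?B")
  proof -
    define R where "R = (4 * golden + 7) + (4 * golden + 27) * N + (20 * golden + 28) * N^2 + 2 * p + (36 * golden - 16) * p * N + (48 * golden - 14) * p * N^2 + 12 * p^2 * N + 16 * p^2 * N^2"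
    have R: "R \<ge> 0"
      unfolding R_def by (intro golden_nonneg_simps p) (use golden_bounds N in simp_all)
    have "?B = g * ((2 * golden + 2) * N + (5 * golden + 4)) + p * R"
      unfolding R_def g_def Pe using golden_square by algebra
    also have "\<dots> \<ge> 0" by (intro golden_nonneg_simps p g R) (use golden_bounds N in simp_all)
    finally show ?thesis .
  qed
  have B3: "0 \<le> 4 + 10 * P + 4 * P^2 + (- 12) * N + (- 32) * N * P + (- 20) * N * P^2 + 12 * N * P^3 + (- 4) * N^2 + (- 12) * N^2 * P + (- 6) * N^2 * P^2 + 16 * N^2 * P^3" (is "0 \<le> ?B")
  proof -
    define val where "val = (710 * golden + 440) * p + (1604 * golden + 978) * p^2 + (1420 * golden + 908) * p^3 + (650 * golden + 380) * p^4 + (168 * golden + 46) * p^5 + 28 * p^6"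
    define k1 where "k1 = (32 * golden + 20) + (316 * golden + 184) * p + (432 * golden + 312) * p^2 + (296 * golden + 96) * p^3 + (60 * golden + 44) * p^4 + 12 * p^5"
    define k2 where "k2 = (14 * golden + 6) + (36 * golden + 36) * p + (48 * golden - 6) * p^2 + 16 * p^3"
    have nn: "val \<ge> 0" "k1 \<ge> 0" "k2 \<ge> 0"
      unfolding val_def k1_def k2_def by (intro golden_nonneg_simps p; use golden_bounds in simp)+
    have "P^4 * ?B = val + k1 * m + k2 * m^2"
      unfolding val_def k1_def k2_def m_def Pe using golden_square by algebra
    also have "\<dots> \<ge> 0" by (intro golden_nonneg_simps nn m)
    finally show ?thesis using P0 by (simp add: zero_le_mult_iff)
  qed
  have B4: "0 \<le> (- 3) + (- 8) * P + (- 4) * P^2 + (- 6) * N + (- 17) * N * P + (- 2) * N * P^2 + 12 * N * P^3 + (- 3) * N^2 + (- 7) * N^2 * P + 4 * N^2 * P^3" (is "0 \<le> ?B")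
  proof -
    define val where "val = (405 * golden + 250) * p + (923 * golden + 576) * p^2 + (868 * golden + 507) * p^3 + (380 * golden + 277) * p^4 + (120 * golden + 16) * p^5 + 20 * p^6"
    define k1 where "k1 = (24 * golden + 15) + (197 * golden + 123) * p + (297 * golden + 170) * p^2 + (176 * golden + 111) * p^3 + (60 * golden + 14) * p^4 + 12 * p^5"
    define k2 where "k2 = (golden + 1) + (12 * golden + 5) * p + (12 * golden) * p^2 + 4 * p^3"
    have nn: "val \<ge> 0" "k1 \<ge> 0" "k2 \<ge> 0"
      unfolding val_def k1_def k2_def by (intro golden_nonneg_simps p; use golden_bounds in simp)+
    have "P^4 * ?B = val + k1 * m + k2 * m^2"
      unfolding val_def k1_def k2_def m_def Pe using golden_square by algebra
    also have "\<dots> \<ge> 0" by (intro golden_nonneg_simps nn m)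
    finally show ?thesis using P0 by (simp add: zero_le_mult_iff)
  qed
  have B5: "0 \<le> (- 2) + (- 4) * P + (- 4) * N + (- 8) * N * P + 6 * N * P^2 + 4 * N * P^3 + (- 4) * N^2 * P" (is "0 \<le> ?B")
  proof -
    define br where "br = (2 * golden + 2) + (20 * golden + 4) * p + (12 * golden + 6) * p^2 + 4 * p^3"
    define val where "val = (56 * golden + 36) * p + (76 * golden + 36) * p^2 + (32 * golden + 12) * p^3 + 8 * p^4"
    define k where "k = (4 * golden) + 4 * p"
    have nn: "br \<ge> 0" "val \<ge> 0" "k \<ge> 0"
      unfolding br_def val_def k_def by (intro golden_nonneg_simps p; use golden_bounds in simp)+
    have "P^2 * ?B = P^2 * N * k * g + br * m + val"
      unfolding br_def val_def k_def g_def m_def Pe using golden_square by algebra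
    also have "\<dots> \<ge> 0" by (intro golden_nonneg_simps nn m g) (use N P0 in simp_all)
    finally show ?thesis using P0 by (simp add: zero_le_mult_iff)
  qed
  have B6: "0 \<le> 1 * P + 2 * P^2 + (- 1) * N + (- 2) * N * P" (is "0 \<le> ?B")
  proof -
    have "?B = (1 + 2 * P) * (g + p)" unfolding g_def Pe by algebra
    also have "\<dots> \<ge> 0" by (intro golden_nonneg_simps p g) (use P0 in simp_all)
    finally show ?thesis .
  qed
  have "?D = (1 * P + 2 * P^2 + (- 1) * N + (- 1) * N * P + 2 * N * P^2 + (- 1) * N^2 + (- 2) * N^2 * P) + l^1 * ((- 2) + (- 6) * P + (- 4) * P^2 + (- 2) * N + 12 * N * P^2 + 8 * N * P^3 + (- 4) * N^2 + (- 10) * N^2 * P + (- 4) * N^2 * P^2) + l^2 * (3 + 7 * P + 2 * P^2 + 2 * N + (- 9) * N * P + (- 16) * N * P^2 + 12 * N * P^3 + (- 4) * N^2 + (- 20) * N^2 * P + (- 14) * N^2 * P^2 + 16 * N^2 * P^3) + l^3 * (4 + 10 * P + 4 * P^2 + (- 12) * N + (- 32) * N * P + (- 20) * N * P^2 + 12 * N * P^3 + (- 4) * N^2 + (- 12) * N^2 * P + (- 6) * N^2 * P^2 + 16 * N^2 * P^3) + l^4 * ((- 3) + (- 8) * P + (- 4) * P^2 + (- 6) * N + (- 17) * N * P + (- 2) * N * P^2 + 12 * N * P^3 + (- 3) * N^2 + (- 7) * N^2 * P + 4 * N^2 * P^3) + l^5 * ((- 2) + (- 4) * P + (- 4) * N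 + (- 8) * N * P + 6 * N * P^2 + 4 * N * P^3 + (- 4) * N^2 * P) + l^6 * (1 * P + 2 * P^2 + (- 1) * N + (- 2) * N * P)"
    unfolding c_def \<beta>_def x_def by algebra
  also have "\<dots> \<ge> 1 * P + 2 * P^2 + (- 1) * N + (- 1) * N * P + 2 * N * P^2 + (- 1) * N^2 + (- 2) * N^2 * P"
    using B1 B2 B3 B4 B5 B6 l by simp
  also have "1 * P + 2 * P^2 + (- 1) * N + (- 1) * N * P + 2 * N * P^2 + (- 1) * N^2 + (- 2) * N^2 * P = (1 + 2 * P) * (N + 1) * (P - N)" by algebra
  finally show ?thesis .
qed

lemma heat_frieze_le_large:
  assumes l: "l > 0" and pos: "\<And>j. z j > 0" and z: "frieze z" and N: "z i \<ge> golden"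
  shows "z i * (edge l z (i + 1) * edge l z (i + 3)) - diagonal l z i * edge l z (i + 2)
    \<ge> l * (z i - golden)"
proof -
  define N a b where "N = z i" and "a = z (i + 1)" and "b = z (i + 4)"
  note p = frieze_products(1)[OF z, of i, folded N_def a_def b_def]
    frieze_products(2,3,4)[OF z, where l = l and i = i, folded N_def a_def b_def]
  have N0: "N > 0" "a > 0" "b > 0" using pos by (simp_all add: N_def a_def b_def)
  let ?T = "N * (a + b)"
  \<comment> \<open>The frieze relation reads (N * a - 1) * (N * b - 1) = 1 + N, so the inequality
    of arithmetic and geometric means bounds N * (a + b) from below.\<close>
  have "golden^2 * 2 \<le> ?T"
  proof -
    have "(N * a - 1) * (N * b - 1) = 1 + N" using p(1) by algebra
    moreover have "(N * a - 1 + (N * b - 1))^2 \<ge> 4 * ((N * a - 1) * (N * b - 1))"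
      using zero_le_power2[of "N * a - N * b"] by (simp add: power2_eq_square algebra_simps)
    ultimately have "4 * (1 + N) \<le> (?T - 2)^2" by (simp add: algebra_simps)
    then have "(2 * golden)^2 \<le> (?T - 2)^2"
      using N golden_square unfolding N_def[symmetric] by (simp add: power_mult_distrib)
    moreover have "?T - 2 \<ge> 0"
    proof -
      have "N * a - 1 = z (i + 3)" "N * b - 1 = z (i + 2)"
        using z[unfolded frieze_def, rule_format, of i] z[unfolded frieze_def, rule_format, of "i + 4"]
        by (simp_all add: N_def a_def b_def add.assoc five_wrap mult.commute)
      then show ?thesis using pos[of "i + 3"] pos[of "i + 2"] by (simp add: algebra_simps)
    qed
    ultimately have "2 * golden \<le> ?T - 2" by (rule power2_le_imp_le)
    then show ?thesis using golden_square by simp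
  qed
  then have T: "?T \<ge> 2 * golden^2" by simp
  have "l * (N - golden) * N^2 \<le> N * (N * (N * (edge l z (i + 1) * edge l z (i + 3))))
      - N * (N * diagonal l z i) * edge l z (i + 2)"
    unfolding p(2,3,4)
    by (rule large_coordinate_bound[OF l _ T]) (use N in \<open>simp add: N_def\<close>)
  also have "\<dots> = N^2 * (N * (edge l z (i + 1) * edge l z (i + 3)) - diagonal l z i * edge l z (i + 2))"
    by (simp add: power2_eq_square algebra_simps)
  finally show ?thesis using N0 unfolding N_def[symmetric]
    by (simp add: mult.commute[of _ "N^2"])
qed

text \<open>The inequality a * b \<le> P^2 turns N * a * b = 1 + a + b into N * P^2 \<ge> 1 + 2 * P.
  Together with N \<le> golden this forces P \<ge> golden, so P is a legitimate comparison value,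
  being also at most the largest entry.\<close>

lemma heat_frieze_le_small:
  assumes l: "l > 0" and pos: "\<And>j. z j > 0" and z: "frieze z" and N: "z i \<le> golden"
  defines "P \<equiv> (z (i + 1) + z (i + 4)) / 2"
  shows "P \<ge> golden"
    "P * (edge l z (i + 1) * edge l z (i + 3)) - diagonal l z i * edge l z (i + 2) \<ge> P - golden"
proof -
  define N a b where "N = z i" and "a = z (i + 1)" and "b = z (i + 4)"
  note p = frieze_products(1)[OF z, of i, folded N_def a_def b_def]
    frieze_products(2,3,4)[OF z, where l = l and i = i, folded N_def a_def b_def]
  have N0: "N > 0" "a > 0" "b > 0" using pos by (simp_all add: N_def a_def b_def)
  have S: "a + b = 2 * P" by (simp add: P_def a_def b_def)
  have P0: "P > 0" using N0 S by simp
  have "P^2 \<ge> a * b"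
    using zero_le_power2[of "a - b"] S by (simp add: P_def a_def[symmetric] b_def[symmetric] power2_eq_square field_simps)
  then have "N * P^2 \<ge> N * (a * b)" using N0 by (intro mult_left_mono) auto
  then have NP: "N * P^2 \<ge> 1 + 2 * P" using p(1) S by (simp add: mult.assoc add.assoc)
  show P: "P \<ge> golden"
  proof -
    have "golden * P^2 \<ge> N * P^2" using N by (intro mult_right_mono) (auto simp: N_def)
    then have "golden * P^2 - 1 - 2 * P \<ge> 0" using NP by simp
    moreover have "golden * P^2 - 1 - 2 * P = (P - golden) * (golden * P + (golden - 1))"
      using golden_square by algebra
    moreover have "golden * P + (golden - 1) > 0"
      using golden_bounds P0 by (simp add: add_pos_pos)
    ultimately show ?thesis by (simp add: zero_le_mult_iff)
  qed
  have "(1 + 2 * P) * (N + 1) * (P - N) \<le> P * (N * (edge l z (i + 1) * edge l z (i + 3)))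
      - (N * diagonal l z i) * edge l z (i + 2)"
    unfolding p(2,3,4) S
    by (rule small_coordinate_bound[OF l N0(1) _ P NP]) (use N in \<open>simp add: N_def\<close>)
  also have "\<dots> = N * (P * (edge l z (i + 1) * edge l z (i + 3)) - diagonal l z i * edge l z (i + 2))"
    by (simp add: algebra_simps)
  finally have *: "(1 + 2 * P) * (N + 1) * (P - N)
      \<le> N * (P * (edge l z (i + 1) * edge l z (i + 3)) - diagonal l z i * edge l z (i + 2))" .
  have "N * (P - golden) \<le> N * (P - N)" using N N0 by (intro mult_left_mono) (auto simp: N_def)
  also have "\<dots> \<le> (1 + 2 * P) * (N + 1) * (P - N)"
  proof (intro mult_right_mono)
    show "N \<le> (1 + 2 * P) * (N + 1)" using N0 P0 by (simp add: algebra_simps add_nonneg_nonneg)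
    show "0 \<le> P - N" using N P by (simp add: N_def)
  qed
  finally have "N * (P - golden) \<le> (1 + 2 * P) * (N + 1) * (P - N)" .
  from order_trans[OF this *] show
    "P * (edge l z (i + 1) * edge l z (i + 3)) - diagonal l z i * edge l z (i + 2) \<ge> P - golden"
    using N0 by simp
qed

lemma edge_le:
  assumes "l > 0" "\<And>j. z j \<le> M"
  shows "edge l z i \<le> edge l (\<lambda>_. M) 0"
  unfolding edge_def using assms by (intro add_mono mult_left_mono order_refl) auto

text \<open>The new entry is compared with a value x between golden and M: the old entry if it is at
  least golden, else the mean of its neighbours. The gap is at least a multiple of x - golden
  divided by the denominator of \<open>heat_frieze\<close>. That denominator is bounded through K,
  which stays fixed along an orbit while M decreases, so the rate does not change from step to
  step.\<close>

lemma heat_frieze_contracts: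
  assumes l: "l > 0" and pos: "\<And>j. z j > 0" and z: "frieze z"
    and M: "\<And>j. z j \<le> M" "golden \<le> M" "M \<le> K"
  defines "E \<equiv> edge l (\<lambda>_. K) 0"
  shows "heat_frieze l z i - golden \<le> (1 - min 1 l / E^2) * (M - golden)"
proof -
  define e where "e = edge l z (i + 1) * edge l z (i + 3)"
  define y where "y = heat_frieze l z i"
  have K: "K > 0" using M golden_bounds by simp
  have E: "E > 0" unfolding E_def using l K by (intro edge_pos)
  have e0: "e > 0" unfolding e_def using l pos by (intro mult_pos_pos edge_pos)
  have zK: "z j \<le> K" for j using M(1)[of j] M(3) by simp
  have eE: "e \<le> E^2"
    unfolding e_def E_def power2_eq_square
    using edge_le[OF l zK] edge_pos[OF l pos] edge_pos[OF l, of "\<lambda>_. K"] K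
    by (intro mult_mono) (auto intro: less_imp_le)
  have ye: "y * e = diagonal l z i * edge l z (i + 2)"
    using e0 by (simp add: y_def heat_frieze_def e_def[symmetric])
  define c where "c = min 1 l"
  have c: "0 < c" "c \<le> 1" "c \<le> l" using l by (auto simp: c_def)
  have main: "\<exists>x. golden \<le> x \<and> x \<le> M \<and> x * e - y * e \<ge> c * (x - golden)"
  proof (cases "golden \<le> z i")
    case True
    have "c * (z i - golden) \<le> l * (z i - golden)" using True c by (intro mult_right_mono) auto
    also have "\<dots> \<le> z i * e - y * e"
      using heat_frieze_le_large[OF l pos z True] unfolding ye unfolding e_def .
    finally show ?thesis using True M(1) by blast
  next
    case False
    then have i: "z i \<le> golden" by simp
    define P where "P = (z (i + 1) + z (i + 4)) / 2"
    note P = heat_frieze_le_small[OF l pos z i, folded P_def]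
    have "c * (P - golden) \<le> 1 * (P - golden)" using P(1) c by (intro mult_right_mono) auto
    also have "\<dots> \<le> P * e - y * e" using P(2) unfolding ye unfolding e_def by simp
    finally have "c * (P - golden) \<le> P * e - y * e" .
    moreover have "P \<le> M" using M(1)[of "i + 1"] M(1)[of "i + 4"] by (simp add: P_def)
    ultimately show ?thesis using P(1) by blast
  qed
  then obtain x where x: "golden \<le> x" "x \<le> M" "c * (x - golden) \<le> x * e - y * e" by blast
  have "c * (x - golden) / E^2 \<le> c * (x - golden) / e"
    using x c e0 eE E by (intro divide_left_mono) auto
  also have "\<dots> \<le> (x * e - y * e) / e" using x(3) e0 by (intro divide_right_mono) auto
  also have "\<dots> = x - y" using e0 by (simp add: field_simps)
  finally have "y - golden \<le> (1 - c / E^2) * (x - golden)" by (simp add: algebra_simps)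
  also have "\<dots> \<le> (1 - c / E^2) * (M - golden)"
  proof (intro mult_left_mono)
    have "E \<ge> 1"
    proof -
      have "E = 1 + (l + 4 * l^2 + (1 + l + l^2 + l^3) * K + (2 * l + l^2) * (K + K))"
        by (simp add: E_def edge_def)
      moreover have "l + 4 * l^2 + (1 + l + l^2 + l^3) * K + (2 * l + l^2) * (K + K) \<ge> 0"
        using l K by (intro golden_nonneg_simps) auto
      ultimately show ?thesis by simp
    qed
    then have "1 \<le> E^2" by simp
    then have "c \<le> E^2" using c by simp
    then show "0 \<le> 1 - c / E^2" using E by simp
  qed (use x in auto)
  finally show ?thesis by (simp add: y_def c_def)
qed

text \<open>The smallest entry z j satisfies 1 + z j \<le> 1 + z (j + 3) = z j * z (j + 1) \<le> z j
  * M. As M tends to golden the bound tends to golden too, so control of the maximum controls all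
  entries.\<close>

lemma frieze_lower_bound:
  assumes pos: "\<And>j. z j > 0" and z: "frieze z" and M: "\<And>j. z j \<le> M" "M > 1"
  shows "z i \<ge> 1 / (M - 1)"
proof -
  have "Min (range z) \<in> range z" by (intro Min_in) auto
  then obtain j where "Min (range z) = z j" by (rule imageE)
  then have j: "z j \<le> z k" for k using Min_le[of "range z" "z k"] by simp
  have "1 + z j \<le> 1 + z (j + 3)" using j by simp
  also have "\<dots> = z j * z (j + 1)" using z by (simp add: frieze_def)
  also have "\<dots> \<le> z j * M" using pos M by (intro mult_left_mono) (auto intro: less_imp_le)
  finally have "1 \<le> z j * (M - 1)" by (simp add: algebra_simps)
  then have "1 / (M - 1) \<le> z j" using M(2) by (simp add: field_simps)
  then show ?thesis using j[of i] by simp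
qed

text \<open>The lower bound 1 / (M - 1) may not exceed M, which means M^2 - M - 1 \<ge> 0.\<close>

lemma frieze_golden_le:
  assumes pos: "\<And>j. z j > 0" and z: "frieze z" and M: "\<And>j. z j \<le> M"
  shows "golden \<le> M"
proof (rule ccontr)
  assume "\<not> golden \<le> M"
  then have M1: "M < golden" by simp
  have M0: "M > 0" using pos[of 0] M[of 0] by simp
  have "1 < M^2"
  proof -
    have "1 < z 0 * z 1" using z[unfolded frieze_def, rule_format, of 0] pos[of 3] by simp
    also have "\<dots> \<le> M * M" using M pos M0 by (intro mult_mono) (auto intro: less_imp_le)
    finally show ?thesis by (simp add: power2_eq_square)
  qed
  then have M2: "M > 1" using M0 power_le_one[of M 2] by linarith
  have "1 / (M - 1) \<le> M" using frieze_lower_bound[OF pos z M M2, of 0] M[of 0] by simp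
  then have "0 \<le> M^2 - M - 1" using M2 by (simp add: field_simps power2_eq_square)
  also have "M^2 - M - 1 = (M - golden) * (M + golden - 1)"
    using golden_square by algebra
  finally have "0 \<le> (M - golden) * (M + golden - 1)" .
  moreover have "M + golden - 1 > 0" using M0 golden_bounds by simp
  ultimately show False using M1 by (simp add: zero_le_mult_iff)
qed

section \<open>Linearization at the regular pentagon\<close>

lemma exhaust_5: "(j::5) = 0 \<or> j = 1 \<or> j = 2 \<or> j = 3 \<or> j = 4"
proof -
  obtain z where z: "j = of_int z" "0 \<le> z" "z < int CARD(5)" by (rule bit1_cases)
  then have "z = 0 \<or> z = 1 \<or> z = 2 \<or> z = 3 \<or> z = 4" by auto
  then show ?thesis using z(1) by auto
qed

text \<open>The value of \<open>edge\<close> on the constant frieze golden. There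
  \<open>diagonal\<close> equals golden times this value, which makes golden a fixed point of
  \<open>heat_frieze\<close>.\<close>

definition regular_edge :: "real \<Rightarrow> real" where
  "regular_edge l = golden^2 + l * (1 + 5 * golden) + l^2 * (4 + 3 * golden) + l^3 * golden"

lemma regular_edge_pos: "l > 0 \<Longrightarrow> regular_edge l > 0"
  unfolding regular_edge_def using golden_bounds by (intro add_pos_pos mult_pos_pos) auto

definition edge_increment :: "real \<Rightarrow> (5 \<Rightarrow> real) \<Rightarrow> 5 \<Rightarrow> real" where
  "edge_increment l u i = (1 + l + l^2 + l^3) * u (i + 3) + (2 * l + l^2) * (u i + u (i + 1))"

definition diagonal_increment :: "real \<Rightarrow> (5 \<Rightarrow> real) \<Rightarrow> 5 \<Rightarrow> real" where
  "diagonal_increment l u i = (1 + 2 * l + 2 * l^2) * (u (i + 1) + u (i + 4))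
     + (2 * l + 3 * l^2 + l^3) * (golden * (u (i + 1) + u (i + 4)) + u (i + 1) * u (i + 4))"

lemma edge_expand: "edge l (\<lambda>j. golden + u j) i = regular_edge l + edge_increment l u i"
  unfolding edge_def regular_edge_def edge_increment_def using golden_square by algebra

lemma diagonal_expand:
  "diagonal l (\<lambda>j. golden + u j) i = golden * regular_edge l + diagonal_increment l u i"
  unfolding diagonal_def regular_edge_def diagonal_increment_def using golden_square by algebra

lemma vanishing_edge_increment: "vanishing 1 (\<lambda>u. edge_increment l u i)"
  unfolding edge_increment_def by (intro vanishing_intros)

lemma vanishing_diagonal_increment: "vanishing 1 (\<lambda>u. diagonal_increment l u i)"
  unfolding diagonal_increment_def
  by (intro vanishing_intros vanishing_le[OF vanishing_1_1[OF vanishing_coordinate vanishing_coordinate]]) simp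

text \<open>The derivative of the heat map at the regular class is a multiple of the identity; this is
  the multiplier.\<close>

definition multiplier :: "real \<Rightarrow> real" where
  "multiplier l = (golden^2 + l - (2 * golden + 1) * l^2 + golden * l^3) / regular_edge l"

text \<open>The numerator of the exact remainder. The first block carries the quadratic error of the
  tangent relation and the product term of the diagonal; the last one subtracts the multiplier times
  the variation of the denominator, since the linear term is stated without denominator.\<close>

definition quadratic_part :: "real \<Rightarrow> (5 \<Rightarrow> real) \<Rightarrow> 5 \<Rightarrow> real" where
  "quadratic_part l u i =
     regular_edge l * ((1 + 2 * l + 2 * l^2 + (2 * l + 3 * l^2 + l^3) * golden
         - golden * (1 + l + l^2 + l^3) - golden * (2 * l + l^2))
       * ((- ((golden - 1)^2)) * (u (i + 2) * u (i + 3)) - (golden - 1) * (u i * (u (i + 1) + u (i + 4))))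
       + (2 * l + 3 * l^2 + l^3) * (u (i + 1) * u (i + 4)))
     + diagonal_increment l u i * edge_increment l u (i + 2)
     - golden * (edge_increment l u (i + 1) * edge_increment l u (i + 3))
     - multiplier l * (u i * (regular_edge l * (edge_increment l u (i + 1) + edge_increment l u (i + 3))
         + edge_increment l u (i + 1) * edge_increment l u (i + 3)))"

lemma vanishing_quadratic_part: "vanishing 2 (\<lambda>u. quadratic_part l u i)"
proof -
  have ee: "vanishing 1 (\<lambda>u. edge_increment l u (i + 1) * edge_increment l u (i + 3))"
    by (rule vanishing_le[OF vanishing_1_1[OF vanishing_edge_increment vanishing_edge_increment]]) simp
  show ?thesis
    unfolding quadratic_part_def
    by (intro vanishing_add vanishing_diff vanishing_cmult ee vanishing_1_1 vanishing_edge_increment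
        vanishing_diagonal_increment vanishing_coordinate)
qed

text \<open>To first order a frieze near golden satisfies u (i + 1) + u (i + 4) = - golden * u i;
  \<open>lin\<close> is this with its exact quadratic error. The solutions form an irreducible
  two-dimensional representation of the dihedral group of the pentagon, with which the map commutes,
  and so the derivative is a scalar there.\<close>

lemma heat_frieze_expand:
  assumes l: "l > 0" and pos: "\<And>j. golden + u j > 0" and z: "frieze (\<lambda>j. golden + u j)"
  shows "heat_frieze l (\<lambda>j. golden + u j) i - golden = multiplier l * u i
    + 1 / (edge l (\<lambda>j. golden + u j) (i + 1) * edge l (\<lambda>j. golden + u j) (i + 3)) * quadratic_part l u i"
proof -
  let ?E = "regular_edge l"
  have divide_eq: "X / D - golden = m + 1 / D * q" if "X - golden * D = m * D + q" "D > 0" for X D m q :: real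
    using that by (simp add: field_simps)
  define e1 e2 e3 \<delta> where "e1 = edge_increment l u (i + 1)" and "e2 = edge_increment l u (i + 2)"
    and "e3 = edge_increment l u (i + 3)" and "\<delta> = diagonal_increment l u i"
  define u0 u1 u2 u3 u4 where "u0 = u i" and "u1 = u (i + 1)" and "u2 = u (i + 2)"
    and "u3 = u (i + 3)" and "u4 = u (i + 4)"
  note ud = u0_def[symmetric] u1_def[symmetric] u2_def[symmetric] u3_def[symmetric] u4_def[symmetric]
  have r: "(golden + u0) * (golden + u1) = 1 + (golden + u3)" "(golden + u4) * (golden + u0) = 1 + (golden + u2)"
    "(golden + u2) * (golden + u3) = 1 + (golden + u0)"
    using z[unfolded frieze_def, rule_format, of i] z[unfolded frieze_def, rule_format, of "i + 4"]
      z[unfolded frieze_def, rule_format, of "i + 2"]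
    by (simp_all add: u0_def u1_def u2_def u3_def u4_def add.assoc five_wrap)
  have lin: "u1 + u4 + golden * u0 = - ((golden - 1)^2) * (u2 * u3) - (golden - 1) * (u0 * (u1 + u4))"
    using r golden_square by algebra
  have E0: "?E > 0" using regular_edge_pos[OF l] .
  have e: "?E + e1 > 0" "?E + e3 > 0"
    using edge_pos[OF l, of "\<lambda>j. golden + u j" "i + 1", OF pos]
      edge_pos[OF l, of "\<lambda>j. golden + u j" "i + 3", OF pos]
    unfolding edge_expand e1_def e3_def .
  have mult: "multiplier l * ?E = golden^2 + l - (2 * golden + 1) * l^2 + golden * l^3"
    using E0 by (simp add: multiplier_def)
  have ee: "e1 = (1 + l + l^2 + l^3) * u4 + (2 * l + l^2) * (u1 + u2)"
    "e2 = (1 + l + l^2 + l^3) * u0 + (2 * l + l^2) * (u2 + u3)"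
    "e3 = (1 + l + l^2 + l^3) * u1 + (2 * l + l^2) * (u3 + u4)"
    "\<delta> = (1 + 2 * l + 2 * l^2) * (u1 + u4) + (2 * l + 3 * l^2 + l^3) * (golden * (u1 + u4) + u1 * u4)"
    unfolding e1_def e2_def e3_def \<delta>_def edge_increment_def diagonal_increment_def
      u0_def u1_def u2_def u3_def u4_def by (simp_all add: add.assoc five_wrap)
  define lp where "lp = - ((golden - 1)^2) * (u2 * u3) - (golden - 1) * (u0 * (u1 + u4))"
  have "\<delta> + golden * e2 - golden * e1 - golden * e3
      = (1 + 2 * l + 2 * l^2 + (2 * l + 3 * l^2 + l^3) * golden
         - golden * (1 + l + l^2 + l^3) - golden * (2 * l + l^2)) * lp
       + (2 * l + 3 * l^2 + l^3) * (u1 * u4) + multiplier l * ?E * u0"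
    unfolding ee mult lin[folded lp_def, symmetric] using golden_square by algebra
  then have "(golden * ?E + \<delta>) * (?E + e2) - golden * ((?E + e1) * (?E + e3))
      = multiplier l * u0 * ((?E + e1) * (?E + e3)) + quadratic_part l u i"
    unfolding quadratic_part_def ud e1_def[symmetric] e2_def[symmetric] e3_def[symmetric] \<delta>_def[symmetric]
      lp_def by algebra
  then have "((golden * ?E + \<delta>) * (?E + e2)) / ((?E + e1) * (?E + e3)) - golden
      = multiplier l * u0 + 1 / ((?E + e1) * (?E + e3)) * quadratic_part l u i"
    using mult_pos_pos[OF e] by (rule divide_eq)
  then show ?thesis
    unfolding heat_frieze_def edge_expand diagonal_expand e1_def e2_def e3_def \<delta>_def u0_def .
qed

lemma abs_multiplier_less: "l > 0 \<Longrightarrow> \<bar>multiplier l\<bar> < 1"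
proof -
  assume l: "l > 0"
  let ?k = "golden^2 + l - (2 * golden + 1) * l^2 + golden * l^3"
  have "regular_edge l - ?k = 5 * golden * l + (5 + 5 * golden) * l^2"
    unfolding regular_edge_def by algebra
  also have "\<dots> > 0" using l golden_bounds by (intro add_pos_pos mult_pos_pos) auto
  finally have 1: "?k < regular_edge l" by simp
  have "regular_edge l + ?k = 2 * golden^2 + (2 + 5 * golden) * l + (3 + golden) * l^2 + 2 * golden * l^3"
    unfolding regular_edge_def by algebra
  also have "\<dots> > 0" using l golden_bounds by (intro add_pos_pos mult_pos_pos) auto
  finally have 2: "- regular_edge l < ?k" by simp
  show ?thesis
    unfolding multiplier_def using regular_edge_pos[OF l] 1 2 by (simp add: abs_less_iff field_simps)
qed

text \<open>Half of the gap between |multiplier l| and 1 is given to the quadratic remainder, which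
  fits into it once \<epsilon> is small. The constants precede the quantification over majorants:
  the same radius and rate serve single pentagons and power series.\<close>

lemma local_contraction:
  assumes l: "l > 0"
  obtains \<theta> \<delta> where "0 < \<theta>" "\<theta> < 1" "0 < \<delta>"
    "\<And>U maj z \<epsilon> i. majorant U maj \<Longrightarrow> 0 \<le> \<epsilon> \<Longrightarrow> \<epsilon> \<le> \<delta> \<Longrightarrow> (\<And>j. maj (\<lambda>x. z j x - golden) \<epsilon>) \<Longrightarrow>
       (\<And>x. x \<in> U \<Longrightarrow> frieze (\<lambda>j. z j x)) \<Longrightarrow>
       maj (\<lambda>x. heat_frieze l (\<lambda>j. z j x) i - golden) (\<theta> * \<epsilon>)"
proof -
  let ?R = "\<lambda>i u. 1 / (edge l (\<lambda>j. golden + u j) (i + 1) * edge l (\<lambda>j. golden + u j) (i + 3)) * quadratic_part l u i"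
  let ?E = "regular_edge l"
  have E: "?E > 0" using regular_edge_pos[OF l] .
  have "vanishing 2 (?R i)" for i
  proof -
    have eq: "edge l (\<lambda>j. golden + u j) (i + 1) * edge l (\<lambda>j. golden + u j) (i + 3) - ?E^2
      = ?E * (edge_increment l u (i + 1) + edge_increment l u (i + 3))
        + edge_increment l u (i + 1) * edge_increment l u (i + 3)" for u
      unfolding edge_expand by algebra
    have "vanishing 1 (\<lambda>u. edge l (\<lambda>j. golden + u j) (i + 1) * edge l (\<lambda>j. golden + u j) (i + 3) - ?E^2)"
      unfolding eq
      by (intro vanishing_intros vanishing_edge_increment
          vanishing_le[OF vanishing_1_1[OF vanishing_edge_increment vanishing_edge_increment], of 1]) simp
    then have "vanishing 0 (\<lambda>u. 1 / (edge l (\<lambda>j. golden + u j) (i + 1) * edge l (\<lambda>j. golden + u j) (i + 3)))"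
      by (rule vanishing_inverse) (use E in simp)
    then show ?thesis by (intro vanishing_mult_left vanishing_quadratic_part)
  qed
  then have "\<exists>C \<delta>. vanishing_bound 2 (?R i) C \<delta>" for i unfolding vanishing_def .
  then have "\<forall>i. \<exists>p. vanishing_bound 2 (?R i) (fst p) (snd p)" by force
  from choice[OF this] obtain p where p: "\<And>i. vanishing_bound 2 (?R i) (fst (p i)) (snd (p i))" by blast
  define C where "C = (\<Sum>i\<in>UNIV. fst (p i)) + 1"
  define \<delta>1 where "\<delta>1 = Min (range (\<lambda>i. snd (p i)))"
  have C0: "fst (p i) \<le> C" for i
  proof -
    have "fst (p i) \<le> (\<Sum>i\<in>UNIV. fst (p i))"
      using vanishing_boundD(1)[OF p] by (intro member_le_sum) auto
    then show ?thesis by (simp add: C_def)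
  qed
  have C: "C > 0" using vanishing_boundD(1)[OF p] by (simp add: C_def add_nonneg_pos sum_nonneg)
  have \<delta>1: "\<delta>1 > 0" "\<delta>1 \<le> snd (p i)" for i
    using vanishing_boundD(2)[OF p] by (auto simp: \<delta>1_def)
  define s where "s = \<bar>multiplier l\<bar>"
  have s: "0 \<le> s" "s < 1" using abs_multiplier_less[OF l] by (auto simp: s_def)
  define \<theta> where "\<theta> = (1 + s) / 2"
  define \<delta> where "\<delta> = Min {\<delta>1, (1 - s) / (2 * C), 1}"
  show thesis
  proof (rule that[of \<theta> \<delta>])
    show "0 < \<theta>" "\<theta> < 1" using s by (auto simp: \<theta>_def)
    show "0 < \<delta>" using \<delta>1 s C by (auto simp: \<delta>_def)
    fix U maj and z :: "5 \<Rightarrow> coords \<Rightarrow> real" and \<epsilon> :: real and i :: 5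
    assume M: "majorant U maj" and \<epsilon>: "0 \<le> \<epsilon>" "\<epsilon> \<le> \<delta>"
      and u: "\<And>j. maj (\<lambda>x. z j x - golden) \<epsilon>" and fr: "\<And>x. x \<in> U \<Longrightarrow> frieze (\<lambda>j. z j x)"
    interpret majorant U maj by (rule M)
    have \<epsilon>': "\<epsilon> \<le> snd (p i)" "C * \<epsilon> \<le> (1 - s) / 2" "\<epsilon> \<le> 1"
      using \<epsilon> \<delta>1(2)[of i] C by (auto simp: \<delta>_def field_simps)
    have "maj (\<lambda>x. ?R i (\<lambda>j. z j x - golden)) (fst (p i) * \<epsilon>^2)"
      by (rule vanishing_boundD(3)[OF p M \<epsilon>(1) \<epsilon>'(1) u])
    from maj_add[OF maj_cmult[OF u[of i], of "multiplier l"] this]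
    show "maj (\<lambda>x. heat_frieze l (\<lambda>j. z j x) i - golden) (\<theta> * \<epsilon>)"
    proof (rule maj_cong)
      have "fst (p i) * \<epsilon>^2 \<le> C * \<epsilon> * \<epsilon>"
        using C0[of i] \<epsilon>(1) by (simp add: power2_eq_square mult_right_mono mult.assoc)
      also have "\<dots> \<le> (1 - s) / 2 * \<epsilon>" using \<epsilon>' \<epsilon>(1) by (intro mult_right_mono)
      finally show "\<bar>multiplier l\<bar> * \<epsilon> + fst (p i) * \<epsilon>^2 \<le> \<theta> * \<epsilon>"
        by (simp add: \<theta>_def s_def field_simps)
      fix x assume x: "x \<in> U"
      have "golden + (z j x - golden) > 0" for j
        using maj_eval[OF u x, of j] \<epsilon>'(3) golden_bounds(1) by simp
      from heat_frieze_expand[OF l this] fr[OF x]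
      show "multiplier l * (z i x - golden) + ?R i (\<lambda>j. z j x - golden) = heat_frieze l (\<lambda>j. z j x) i - golden"
        by simp
    qed
  qed
qed

section \<open>The linear recursion of the lifts\<close>

definition mean5 :: "(5 \<Rightarrow> real) \<Rightarrow> real" where
  "mean5 x = (x 0 + x 1 + x 2 + x 3 + x 4) / 5"

lemma five_numerals: "(5::5) = 0" "(6::5) = 1" "(7::5) = 2" "(8::5) = 3"
  by simp_all

lemma mean5_shift: "mean5 x = (x j + x (j + 1) + x (j + 2) + x (j + 3) + x (j + 4)) / 5"
  using exhaust_5[of j] by (auto simp: mean5_def five_numerals)

text \<open>One coordinate of the linear dependence between four consecutive vertices, for lifts
  scaled so that the outer coefficients are 1 and -1. With this scaling the middle coefficients are
  frieze entries.\<close>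

definition lift_relation :: "(5 \<Rightarrow> real) \<Rightarrow> (5 \<Rightarrow> real) \<Rightarrow> bool" where
  "lift_relation z x \<longleftrightarrow>
     (\<forall>j. x (j + 1) - z (j + 1) * x (j + 2) + z (j + 4) * x (j + 3) - x (j + 4) = 0)"

text \<open>If a - b + c - d = 0 lifts four points to the corners of a square, then a + c + l * (b -
  a) lifts their heat point. Here c has been eliminated, with the lifts of
  \<open>lift_relation\<close> in the roles of a, b, d.\<close>

definition heat_combination :: "real \<Rightarrow> (5 \<Rightarrow> real) \<Rightarrow> (5 \<Rightarrow> real) \<Rightarrow> 5 \<Rightarrow> real" where
  "heat_combination l z x j = (1 + l) * z (j + 1) * x (j + 2) + x (j + 4) - l * x (j + 1)"

text \<open>The factor by which an image vector must be multiplied for the images to satisfy the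
  lift relation of the new frieze.\<close>

definition gauge :: "real \<Rightarrow> (5 \<Rightarrow> real) \<Rightarrow> 5 \<Rightarrow> real" where
  "gauge l z j = edge l z j * edge l z (j + 2) * edge l z (j + 4)"

text \<open>The scale \<open>\<kappa>\<close> is one of the two eigenvalues of the limiting recursion.\<close>

definition heat_lift :: "real \<Rightarrow> real \<Rightarrow> (5 \<Rightarrow> real) \<Rightarrow> (5 \<Rightarrow> real) \<Rightarrow> 5 \<Rightarrow> real" where
  "heat_lift l \<kappa> z x j = gauge l z j * heat_combination l z x j / (regular_edge l ^ 3 * \<kappa>)"

text \<open>At the regular class \<open>heat_combination\<close> multiplies constant tuples by (1 +
  l) * golden + 1 - l, which is this value. Tuples with y (j + 1) + y (j + 4) = (golden - 1) * y j,
  the frequency of a regular pentagon, are multiplied by \<open>shape_eigenvalue\<close>.\<close>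

definition mean_eigenvalue :: "real \<Rightarrow> real" where
  "mean_eigenvalue l = golden^2 + l * (golden - 1)"

definition shape_eigenvalue :: "real \<Rightarrow> real" where
  "shape_eigenvalue l = - (1 + golden * l)"

definition gauge_increment :: "real \<Rightarrow> (5 \<Rightarrow> real) \<Rightarrow> 5 \<Rightarrow> real" where
  "gauge_increment l u j = regular_edge l ^ 2 * (edge_increment l u j + edge_increment l u (j + 2) + edge_increment l u (j + 4))
     + regular_edge l * (edge_increment l u j * edge_increment l u (j + 2)
       + edge_increment l u j * edge_increment l u (j + 4) + edge_increment l u (j + 2) * edge_increment l u (j + 4))
     + edge_increment l u j * edge_increment l u (j + 2) * edge_increment l u (j + 4)"

lemma gauge_expand: "gauge l (\<lambda>j. golden + u j) j = regular_edge l ^ 3 + gauge_increment l u j"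
  unfolding gauge_def gauge_increment_def edge_expand by algebra

lemma vanishing_gauge_increment: "vanishing 1 (\<lambda>u. gauge_increment l u j)"
proof -
  have ee: "vanishing 1 (\<lambda>u. edge_increment l u i * edge_increment l u k)" for i k
    by (rule vanishing_le[OF vanishing_1_1[OF vanishing_edge_increment vanishing_edge_increment]]) simp
  have eee: "vanishing 1 (\<lambda>u. edge_increment l u i * edge_increment l u k * edge_increment l u m)" for i k m
    by (rule vanishing_le[OF vanishing_1_1[OF ee vanishing_edge_increment]]) simp
  show ?thesis
    unfolding gauge_increment_def
    by (intro vanishing_add vanishing_cmult ee eee vanishing_edge_increment)
qed

text \<open>The coefficients arise by two symmetrizations: half of 1 + l times the lift relation at
  j is added to the heat combination, and in the limiting form x j is replaced by the half sum of
  the values that the relations at j + 1 and j + 4 give for it. There x j has coefficient 2 *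
  \<tau>. The parts free of u then cancel; the rest comes from the gauge factor.\<close>

definition error_coefficient :: "real \<Rightarrow> real \<Rightarrow> 5 \<Rightarrow> 5 \<Rightarrow> (5 \<Rightarrow> real) \<Rightarrow> real" where
  "error_coefficient l \<kappa> j m u =
     (let \<tau> = (mean_eigenvalue l + 4 * shape_eigenvalue l) / 10;
          r = 1 / (regular_edge l ^ 3 * \<kappa>)
      in if m = 1 then - \<tau> / \<kappa> * u j + (- l * r) * gauge_increment l u j
         else if m = 2 then (1 + l) / (2 * \<kappa>) * u (j + 1) + \<tau> / \<kappa> * u (j + 3)
           + ((1 + l) * golden * r) * gauge_increment l u j + ((1 + l) * r) * (u (j + 1) * gauge_increment l u j)
         else if m = 3 then (1 + l) / (2 * \<kappa>) * u (j + 4) + \<tau> / \<kappa> * u (j + 2)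
         else if m = 4 then - \<tau> / \<kappa> * u j + r * gauge_increment l u j
         else 0 * u j)"

lemma vanishing_error_coefficient:
  assumes "m \<noteq> 0"
  shows "vanishing 1 (\<lambda>u. error_coefficient l \<kappa> j m u)"
proof -
  have ug: "vanishing 1 (\<lambda>u. u i * gauge_increment l u j)" for i
    by (rule vanishing_le[OF vanishing_1_1[OF vanishing_coordinate vanishing_gauge_increment]]) simp
  have neq: "((2::5) = 1) = False" "((3::5) = 1) = False" "((3::5) = 2) = False"
    "((4::5) = 1) = False" "((4::5) = 2) = False" "((4::5) = 3) = False"
    by simp_all
  consider "m = 1" | "m = 2" | "m = 3" | "m = 4" using assms exhaust_5[of m] by blast
  then show ?thesis
    by cases (simp only: error_coefficient_def Let_def neq refl if_True if_False,
      intro vanishing_add vanishing_cmult ug vanishing_gauge_increment vanishing_coordinate)+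
qed

lemma heat_lift_expand:
  assumes l: "l > 0" and \<kappa>: "\<kappa> \<noteq> 0" and rel: "lift_relation (\<lambda>j. golden + u j) x"
  shows "heat_lift l \<kappa> (\<lambda>j. golden + u j) x j
      - (mean_eigenvalue l / \<kappa> * mean5 x + shape_eigenvalue l / \<kappa> * (x j - mean5 x))
    = error_coefficient l \<kappa> j 1 u * x (j + 1) + error_coefficient l \<kappa> j 2 u * x (j + 2)
      + error_coefficient l \<kappa> j 3 u * x (j + 3) + error_coefficient l \<kappa> j 4 u * x (j + 4)"
proof -
  define x0 x1 x2 x3 x4 where "x0 = x j" and "x1 = x (j + 1)" and "x2 = x (j + 2)"
    and "x3 = x (j + 3)" and "x4 = x (j + 4)"
  define u0 u1 u2 u3 u4 where "u0 = u j" and "u1 = u (j + 1)" and "u2 = u (j + 2)"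
    and "u3 = u (j + 3)" and "u4 = u (j + 4)"
  note xd = x0_def[symmetric] x1_def[symmetric] x2_def[symmetric] x3_def[symmetric] x4_def[symmetric]
    u0_def[symmetric] u1_def[symmetric] u2_def[symmetric] u3_def[symmetric] u4_def[symmetric]
  have R: "x1 - (golden + u1) * x2 + (golden + u4) * x3 - x4 = 0"
    "x2 - (golden + u2) * x3 + (golden + u0) * x4 - x0 = 0"
    "x0 - (golden + u0) * x1 + (golden + u3) * x2 - x3 = 0"
    using rel[unfolded lift_relation_def, rule_format, of j] rel[unfolded lift_relation_def, rule_format, of "j + 1"]
      rel[unfolded lift_relation_def, rule_format, of "j + 4"]
    by (simp_all add: add.assoc five_wrap xd)
  define G where "G = gauge_increment l u j"
  define E where "E = regular_edge l ^ 3"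
  have E: "E \<noteq> 0" using regular_edge_pos[OF l] by (simp add: E_def)
  define \<tau> where "\<tau> = (mean_eigenvalue l + 4 * shape_eigenvalue l) / 10"
  define a where "a = (x0 + x1 + x2 + x3 + x4) / 5"
  have ma: "mean5 x = a" unfolding mean5_shift[of x j] a_def xd ..
  define W where "W = (1 + l) * (golden + u1) * x2 + x4 - l * x1"
  have W: "W = mean_eigenvalue l * a + shape_eigenvalue l * (x0 - a)
      + (- \<tau> * u0 * x1 + ((1 + l) / 2 * u1 + \<tau> * u3) * x2 + ((1 + l) / 2 * u4 + \<tau> * u2) * x3 - \<tau> * u0 * x4)"
  proof -
    define s where "s = x0 + x1 + x2 + x3 + x4"
    have a: "5 * a = s" by (simp add: a_def s_def)
    have t: "10 * \<tau> = mean_eigenvalue l + 4 * shape_eigenvalue l" by (simp add: \<tau>_def)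
    have "10 * W = 10 * (mean_eigenvalue l * a + shape_eigenvalue l * (x0 - a))
      + (- (10 * \<tau>) * u0 * x1 + (5 * (1 + l) * u1 + (10 * \<tau>) * u3) * x2
         + (5 * (1 + l) * u4 + (10 * \<tau>) * u2) * x3 - (10 * \<tau>) * u0 * x4)"
      using a R golden_square unfolding t s_def W_def mean_eigenvalue_def shape_eigenvalue_def by algebra
    then show ?thesis by (simp add: field_simps)
  qed
  have "heat_lift l \<kappa> (\<lambda>j. golden + u j) x j = (E + G) * W / (E * \<kappa>)"
    unfolding heat_lift_def gauge_expand heat_combination_def G_def E_def W_def xd ..
  also have "\<dots> = W / \<kappa> + 1 / (E * \<kappa>) * G * W"
    using E \<kappa> by (simp add: field_simps)
  also have "W / \<kappa> = mean_eigenvalue l / \<kappa> * a + shape_eigenvalue l / \<kappa> * (x0 - a)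
      + (- \<tau> / \<kappa> * u0 * x1 + ((1 + l) / (2 * \<kappa>) * u1 + \<tau> / \<kappa> * u3) * x2
        + ((1 + l) / (2 * \<kappa>) * u4 + \<tau> / \<kappa> * u2) * x3 - \<tau> / \<kappa> * u0 * x4)"
    unfolding W using \<kappa> by (simp add: field_simps)
  finally have "heat_lift l \<kappa> (\<lambda>j. golden + u j) x j
      - (mean_eigenvalue l / \<kappa> * a + shape_eigenvalue l / \<kappa> * (x0 - a))
    = (- \<tau> / \<kappa> * u0 * x1 + ((1 + l) / (2 * \<kappa>) * u1 + \<tau> / \<kappa> * u3) * x2
        + ((1 + l) / (2 * \<kappa>) * u4 + \<tau> / \<kappa> * u2) * x3 - \<tau> / \<kappa> * u0 * x4) + 1 / (E * \<kappa>) * G * W"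
    by simp
  also have "\<dots> = error_coefficient l \<kappa> j 1 u * x1 + error_coefficient l \<kappa> j 2 u * x2
      + error_coefficient l \<kappa> j 3 u * x3 + error_coefficient l \<kappa> j 4 u * x4"
  proof -
    have c: "error_coefficient l \<kappa> j 1 u = - \<tau> / \<kappa> * u0 + (- l * (1 / (E * \<kappa>))) * G"
      "error_coefficient l \<kappa> j 2 u = (1 + l) / (2 * \<kappa>) * u1 + \<tau> / \<kappa> * u3
         + ((1 + l) * golden * (1 / (E * \<kappa>))) * G + ((1 + l) * (1 / (E * \<kappa>))) * (u1 * G)"
      "error_coefficient l \<kappa> j 3 u = (1 + l) / (2 * \<kappa>) * u4 + \<tau> / \<kappa> * u2"
      "error_coefficient l \<kappa> j 4 u = - \<tau> / \<kappa> * u0 + (1 / (E * \<kappa>)) * G"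
      unfolding error_coefficient_def Let_def E_def[symmetric] G_def[symmetric] \<tau>_def[symmetric] xd by simp_all
    show ?thesis unfolding c W_def by algebra
  qed
  finally show ?thesis unfolding ma xd .
qed

lemma heat_lift_estimate:
  assumes l: "l > 0" and \<kappa>: "\<kappa> \<noteq> 0"
  obtains C \<delta> where "0 < C" "0 < \<delta>"
    "\<And>U maj z x \<epsilon> B j. majorant U maj \<Longrightarrow> 0 \<le> \<epsilon> \<Longrightarrow> \<epsilon> \<le> \<delta> \<Longrightarrow> (\<And>j. maj (\<lambda>p. z j p - golden) \<epsilon>) \<Longrightarrow>
       (\<And>p. p \<in> U \<Longrightarrow> lift_relation (\<lambda>j. z j p) (\<lambda>j. x j p)) \<Longrightarrow> (\<And>j. maj (x j) B) \<Longrightarrow>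
       maj (\<lambda>p. heat_lift l \<kappa> (\<lambda>j. z j p) (\<lambda>j. x j p) j
          - (mean_eigenvalue l / \<kappa> * mean5 (\<lambda>j. x j p)
             + shape_eigenvalue l / \<kappa> * (x j p - mean5 (\<lambda>j. x j p)))) (C * \<epsilon> * B)"
proof -
  let ?q = "\<lambda>(j, m) u. if m = 0 then 0 else error_coefficient l \<kappa> j m u"
  have "vanishing 1 (?q i)" for i
  proof (cases i)
    case (Pair j m)
    then show ?thesis
      using vanishing_error_coefficient[of m l \<kappa> j] vanishing_cmult[OF vanishing_coordinate[of 0], of 0]
      by (cases "m = 0") simp_all
  qed
  then have "\<exists>C \<delta>. vanishing_bound 1 (?q i) C \<delta>" for i unfolding vanishing_def .
  then have "\<forall>i. \<exists>p. vanishing_bound 1 (?q i) (fst p) (snd p)" by force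
  from choice[OF this] obtain p where p: "\<And>i. vanishing_bound 1 (?q i) (fst (p i)) (snd (p i))" by blast
  define K where "K = (\<Sum>i\<in>UNIV. fst (p i)) + 1"
  define \<delta> where "\<delta> = Min (range (\<lambda>i. snd (p i)))"
  have K: "fst (p i) \<le> K" for i
  proof -
    have "fst (p i) \<le> (\<Sum>i\<in>UNIV. fst (p i))"
      using vanishing_boundD(1)[OF p] by (intro member_le_sum) auto
    then show ?thesis by (simp add: K_def)
  qed
  have K0: "K > 0" using vanishing_boundD(1)[OF p] by (simp add: K_def add_nonneg_pos sum_nonneg)
  have \<delta>: "\<delta> > 0" "\<delta> \<le> snd (p i)" for i
    using vanishing_boundD(2)[OF p] by (auto simp: \<delta>_def)
  show thesis
  proof (rule that[of "4 * K" "min \<delta> 1"])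
    show "0 < 4 * K" "0 < min \<delta> 1" using K0 \<delta> by auto
    fix U maj and z x :: "5 \<Rightarrow> coords \<Rightarrow> real" and \<epsilon> B :: real and j :: 5
    assume M: "majorant U maj" and \<epsilon>: "0 \<le> \<epsilon>" "\<epsilon> \<le> min \<delta> 1"
      and u: "\<And>j. maj (\<lambda>p. z j p - golden) \<epsilon>"
      and rel: "\<And>p. p \<in> U \<Longrightarrow> lift_relation (\<lambda>j. z j p) (\<lambda>j. x j p)" and x: "\<And>j. maj (x j) B"
    interpret majorant U maj by (rule M)
    have B: "B \<ge> 0" using maj_nonneg[OF x] .
    have q: "maj (\<lambda>y. error_coefficient l \<kappa> j m (\<lambda>j. z j y - golden)) (K * \<epsilon>)" if "m \<noteq> 0" for m
    proof -
      have le: "\<epsilon> \<le> snd (p (j, m))" using \<epsilon>(2) \<delta>(2)[of "(j, m)"] by simp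
      have "maj (\<lambda>y. ?q (j, m) (\<lambda>j. z j y - golden)) (fst (p (j, m)) * \<epsilon> ^ 1)"
        by (rule vanishing_boundD(3)[OF p M \<epsilon>(1) le u])
      then show ?thesis
        by (rule maj_cong) (use that K[of "(j, m)"] \<epsilon>(1) in \<open>simp_all add: mult_right_mono\<close>)
    qed
    have "maj (\<lambda>y. error_coefficient l \<kappa> j 1 (\<lambda>j. z j y - golden) * x (j + 1) y
        + error_coefficient l \<kappa> j 2 (\<lambda>j. z j y - golden) * x (j + 2) y
        + error_coefficient l \<kappa> j 3 (\<lambda>j. z j y - golden) * x (j + 3) y
        + error_coefficient l \<kappa> j 4 (\<lambda>j. z j y - golden) * x (j + 4) y)
        (K * \<epsilon> * B + K * \<epsilon> * B + K * \<epsilon> * B + K * \<epsilon> * B)"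
      by (intro maj_add maj_mult q x) simp_all
    then show "maj (\<lambda>p. heat_lift l \<kappa> (\<lambda>j. z j p) (\<lambda>j. x j p) j
          - (mean_eigenvalue l / \<kappa> * mean5 (\<lambda>j. x j p)
             + shape_eigenvalue l / \<kappa> * (x j p - mean5 (\<lambda>j. x j p)))) (4 * K * \<epsilon> * B)"
    proof (rule maj_cong)
      fix y assume y: "y \<in> U"
      have "lift_relation (\<lambda>j. golden + (z j y - golden)) (\<lambda>j. x j y)" using rel[OF y] by simp
      from heat_lift_expand[OF l \<kappa> this, of j]
      show "error_coefficient l \<kappa> j 1 (\<lambda>j. z j y - golden) * x (j + 1) y
        + error_coefficient l \<kappa> j 2 (\<lambda>j. z j y - golden) * x (j + 2) y
        + error_coefficient l \<kappa> j 3 (\<lambda>j. z j y - golden) * x (j + 3) y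
        + error_coefficient l \<kappa> j 4 (\<lambda>j. z j y - golden) * x (j + 4) y
        = heat_lift l \<kappa> (\<lambda>j. z j y) (\<lambda>j. x j y) j
          - (mean_eigenvalue l / \<kappa> * mean5 (\<lambda>j. x j y)
             + shape_eigenvalue l / \<kappa> * (x j y - mean5 (\<lambda>j. x j y)))"
        by simp
    qed simp
  qed
qed

text \<open>As |\<alpha>| and |\<beta>| are at most 1, step k enlarges the bound by a factor of at
  most 1 + 4 * C * \<epsilon> * \<theta>^k. Under \<open>small\<close> the product of all these
  factors stays below exp (1 / 2) \<le> 2. So the tuples remain bounded, and then the errors are
  geometrically small.\<close>

lemma (in majorant) perturbed_recursion:
  fixes x :: "nat \<Rightarrow> 5 \<Rightarrow> coords \<Rightarrow> real"
  defines "a \<equiv> \<lambda>k p. mean5 (\<lambda>j. x k j p)"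
  defines "y \<equiv> \<lambda>k j p. x k j p - a k p"
  assumes \<alpha>: "\<bar>\<alpha>\<bar> \<le> 1" and \<beta>: "\<bar>\<beta>\<bar> \<le> 1" and C: "C > 0" and \<theta>: "0 < \<theta>" "\<theta> < 1" and \<epsilon>0: "\<epsilon> \<ge> 0"
    and small: "8 * C * \<epsilon> \<le> 1 - \<theta>"
    and step: "\<And>k j B. (\<And>j. maj (x k j) B) \<Longrightarrow>
       maj (\<lambda>p. x (Suc k) j p - (\<alpha> * a k p + \<beta> * y k j p)) (C * (\<epsilon> * \<theta>^k) * B)"
    and B: "maj (a 0) B" "\<And>j. maj (y 0 j) B"
  shows "maj (a k) (2 * B)" "maj (y k j) (2 * B)"
    "maj (\<lambda>p. a (Suc k) p - \<alpha> * a k p) (16 * C * \<epsilon> * B * \<theta>^k)"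
    "maj (\<lambda>p. y (Suc k) j p - \<beta> * y k j p) (16 * C * \<epsilon> * B * \<theta>^k)"
proof -
  have B0: "B \<ge> 0" using maj_nonneg[OF B(1)] .
  have stepD: "maj (\<lambda>p. a (Suc k) p - \<alpha> * a k p) (4 * C * (\<epsilon> * \<theta>^k) * D)
      \<and> (\<forall>j. maj (\<lambda>p. y (Suc k) j p - \<beta> * y k j p) (4 * C * (\<epsilon> * \<theta>^k) * D))"
    if D: "maj (a k) D" "\<And>j. maj (y k j) D" for k D
  proof -
    define \<eta> where "\<eta> = C * (\<epsilon> * \<theta>^k) * (D + D)"
    have \<eta>: "\<eta> \<ge> 0"
      using maj_nonneg[OF D(1)] C \<epsilon>0 \<theta> by (simp add: \<eta>_def)
    have "maj (\<lambda>p. a k p + y k j p) (D + D)" for j by (intro maj_add D)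
    then have "maj (x k j) (D + D)" for j by (simp add: y_def)
    from step[OF this] have e: "maj (\<lambda>p. x (Suc k) j p - (\<alpha> * a k p + \<beta> * y k j p)) \<eta>" for j
      by (simp add: \<eta>_def)
    let ?e = "\<lambda>j p. x (Suc k) j p - (\<alpha> * a k p + \<beta> * y k j p)"
    \<comment> \<open>The deviations sum to zero, so averaging the five errors isolates the error of
      the mean.\<close>
    have y5: "y k 0 p + y k 1 p + y k 2 p + y k 3 p + y k 4 p = 0" for p
    proof -
      have "5 * a k p = x k 0 p + x k 1 p + x k 2 p + x k 3 p + x k 4 p" by (simp add: a_def mean5_def)
      then show ?thesis unfolding y_def by linarith
    qed
    have m1: "maj (\<lambda>p. 1/5 * (?e 0 p + ?e 1 p + ?e 2 p + ?e 3 p + ?e 4 p)) (\<bar>1/5\<bar> * (\<eta> + \<eta> + \<eta> + \<eta> + \<eta>))"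
      by (intro maj_cmult maj_add e)
    have m2: "1/5 * (?e 0 p + ?e 1 p + ?e 2 p + ?e 3 p + ?e 4 p) = a (Suc k) p - \<alpha> * a k p" for p
    proof -
      have a5: "x (Suc k) 0 p + x (Suc k) 1 p + x (Suc k) 2 p + x (Suc k) 3 p + x (Suc k) 4 p = 5 * a (Suc k) p"
        by (simp add: a_def mean5_def)
      have "?e 0 p + ?e 1 p + ?e 2 p + ?e 3 p + ?e 4 p
          = 5 * a (Suc k) p - 5 * (\<alpha> * a k p) - \<beta> * (y k 0 p + y k 1 p + y k 2 p + y k 3 p + y k 4 p)"
        unfolding a5[symmetric] by (simp add: algebra_simps)
      then show ?thesis unfolding y5 by simp
    qed
    have am: "maj (\<lambda>p. a (Suc k) p - \<alpha> * a k p) \<eta>"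
      by (rule maj_cong[OF m1 _ m2]) simp
    have m3: "maj (\<lambda>p. ?e j p - (a (Suc k) p - \<alpha> * a k p)) (\<eta> + \<eta>)" for j
      by (rule maj_diff[OF e am])
    have m4: "?e j p - (a (Suc k) p - \<alpha> * a k p) = y (Suc k) j p - \<beta> * y k j p" for j p
      by (simp add: y_def algebra_simps)
    have ym: "maj (\<lambda>p. y (Suc k) j p - \<beta> * y k j p) (\<eta> + \<eta>)" for j
      by (rule maj_cong[OF m3 _ m4]) simp
    have 4: "4 * C * (\<epsilon> * \<theta>^k) * D = \<eta> + \<eta>" by (simp add: \<eta>_def)
    show ?thesis unfolding 4 using maj_le[OF am, of "\<eta> + \<eta>"] ym \<eta> by auto
  qed
  define P where "P k = (\<Prod>i<k. 1 + 4 * C * (\<epsilon> * \<theta>^i))" for k :: nat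
  have all: "maj (a k) (B * P k) \<and> (\<forall>j. maj (y k j) (B * P k))" for k
  proof (induction k)
    case 0
    then show ?case using B by (simp add: P_def)
  next
    case (Suc k)
    let ?D = "B * P k"
    have D: "maj (a k) ?D" "\<And>j. maj (y k j) ?D" using Suc by auto
    note s = stepD[OF D]
    have D0: "?D \<ge> 0" using maj_nonneg[OF D(1)] .
    have eq: "B * P (Suc k) = 1 * ?D + 4 * C * (\<epsilon> * \<theta>^k) * ?D"
      by (simp add: P_def algebra_simps)
    have "maj (\<lambda>p. \<alpha> * a k p + (a (Suc k) p - \<alpha> * a k p)) (\<bar>\<alpha>\<bar> * ?D + 4 * C * (\<epsilon> * \<theta>^k) * ?D)"
      using s by (intro maj_add maj_cmult D) simp
    from maj_le[OF this, of "B * P (Suc k)"] mult_right_mono[OF \<alpha> D0]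
    have 1: "maj (a (Suc k)) (B * P (Suc k))" unfolding eq by simp
    have "maj (\<lambda>p. \<beta> * y k j p + (y (Suc k) j p - \<beta> * y k j p)) (\<bar>\<beta>\<bar> * ?D + 4 * C * (\<epsilon> * \<theta>^k) * ?D)" for j
      using s by (intro maj_add maj_cmult D) simp
    from maj_le[OF this, of "B * P (Suc k)"] mult_right_mono[OF \<beta> D0]
    have 2: "maj (y (Suc k) j) (B * P (Suc k))" for j unfolding eq by simp
    show ?case using 1 2 by simp
  qed
  have P2: "P k \<le> 2" for k
  proof -
    have "P k \<le> (\<Prod>i<k. exp (4 * C * (\<epsilon> * \<theta>^i)))"
      unfolding P_def using C \<epsilon>0 \<theta> by (intro prod_mono) (simp add: exp_ge_add_one_self)
    also have "\<dots> = exp (\<Sum>i<k. 4 * C * (\<epsilon> * \<theta>^i))" by (simp add: exp_sum)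
    also have "\<dots> \<le> exp (1 / 2)"
    proof -
      have "(\<Sum>i<k. 4 * C * (\<epsilon> * \<theta>^i)) = 4 * C * \<epsilon> * (\<Sum>i<k. \<theta>^i)"
        by (simp add: sum_distrib_left mult.assoc)
      also have "(\<Sum>i<k. \<theta>^i) = (1 - \<theta>^k) / (1 - \<theta>)" using \<theta> by (simp add: sum_gp_strict)
      also have "4 * C * \<epsilon> * ((1 - \<theta>^k) / (1 - \<theta>)) \<le> 4 * C * \<epsilon> * (1 / (1 - \<theta>))"
        using C \<epsilon>0 \<theta> by (intro mult_left_mono divide_right_mono) auto
      also have "\<dots> \<le> 1 / 2" using small \<theta> by (simp add: field_simps)
      finally show ?thesis by simp
    qed
    also have "\<dots> \<le> 2" using exp_half_le2 by simp
    finally show ?thesis .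
  qed
  have "B * P k \<le> 2 * B" for k using mult_left_mono[OF P2[of k] B0] by simp
  then show *: "maj (a k) (2 * B)" "maj (y k j) (2 * B)" for k j
    using maj_le[OF conjunct1[OF all[of k]]] maj_le[OF spec[OF conjunct2[OF all[of k]], of j]] by simp_all
  have le: "4 * C * (\<epsilon> * \<theta>^k) * (2 * B) \<le> 16 * C * \<epsilon> * B * \<theta>^k"
    using C \<epsilon>0 \<theta> B0 by (simp add: mult_ac)
  note s = stepD[OF *]
  show "maj (\<lambda>p. a (Suc k) p - \<alpha> * a k p) (16 * C * \<epsilon> * B * \<theta>^k)"
    by (rule maj_le[OF conjunct1[OF s] le])
  show "maj (\<lambda>p. y (Suc k) j p - \<beta> * y k j p) (16 * C * \<epsilon> * B * \<theta>^k)"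
    by (rule maj_le[OF spec[OF conjunct2[OF s]] le])
qed

section \<open>Lifts of pentagons to space\<close>

definition triple :: "real^3 \<Rightarrow> real^3 \<Rightarrow> real^3 \<Rightarrow> real" where
  "triple u v w = u$1 * (v$2 * w$3 - v$3 * w$2) - u$2 * (v$1 * w$3 - v$3 * w$1) + u$3 * (v$1 * w$2 - v$2 * w$1)"

lemma triple_relation:
  "triple b c d *\<^sub>R a - triple a c d *\<^sub>R b + triple a b d *\<^sub>R c - triple a b c *\<^sub>R d = 0"
  unfolding vec_eq_iff forall_3 triple_def by (simp; intro conjI; algebra)

lemma triple_rotate: "triple b c a = triple a b c"
  unfolding triple_def by algebra

lemma triple_combination:
  "triple (a1 *\<^sub>R u + b1 *\<^sub>R v + c1 *\<^sub>R w) (a2 *\<^sub>R u + b2 *\<^sub>R v + c2 *\<^sub>R w) (a3 *\<^sub>R u + b3 *\<^sub>R v + c3 *\<^sub>R w)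
   = (a1 * (b2 * c3 - c2 * b3) - b1 * (a2 * c3 - c2 * a3) + c1 * (a2 * b3 - b2 * a3)) * triple u v w"
  unfolding triple_def by simp algebra

lemma triple_scale: "triple (a *\<^sub>R u) (b *\<^sub>R v) (c *\<^sub>R w) = a * b * c * triple u v w"
  unfolding triple_def by simp algebra

text \<open>Brackets are indexed by the side or the diagonal whose end points they omit:
  \<open>edge_det V j\<close> leaves out the vertices j and j + 1, \<open>diagonal_det V j\<close>
  leaves out j + 1 and j + 4.\<close>

definition edge_det :: "(5 \<Rightarrow> real^3) \<Rightarrow> 5 \<Rightarrow> real" where
  "edge_det V j = triple (V (j + 2)) (V (j + 3)) (V (j + 4))"

definition diagonal_det :: "(5 \<Rightarrow> real^3) \<Rightarrow> 5 \<Rightarrow> real" where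
  "diagonal_det V j = triple (V j) (V (j + 2)) (V (j + 3))"

text \<open>A cross-ratio of the four lines that join vertex j to the others. Each vertex occurs
  equally often above and below, so the value does not depend on the scaling of the lifts.\<close>

definition invariants :: "(5 \<Rightarrow> real^3) \<Rightarrow> 5 \<Rightarrow> real" where
  "invariants V j = diagonal_det V j * edge_det V (j + 2) / (edge_det V (j + 1) * edge_det V (j + 3))"

text \<open>Among the vertices j + 1 to j + 4 there is the bracket relation with outer coefficients
  \<open>edge_det V j\<close> and - \<open>edge_det V (j + 4)\<close>. This scaling makes them 1 and
  -1 for all five j simultaneously and turns the inner ones into cross-ratios.\<close>

definition normalized :: "(5 \<Rightarrow> real^3) \<Rightarrow> 5 \<Rightarrow> real^3" where
  "normalized V j = (edge_det V j * edge_det V (j + 2) * edge_det V (j + 4)) *\<^sub>R V j"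

definition lift_of :: "(5 \<Rightarrow> real) \<Rightarrow> (5 \<Rightarrow> real^3) \<Rightarrow> bool" where
  "lift_of z V \<longleftrightarrow>
     (\<forall>j. V (j + 1) - z (j + 1) *\<^sub>R V (j + 2) + z (j + 4) *\<^sub>R V (j + 3) - V (j + 4) = 0)"

lemma lift_of_component:
  "lift_of z V \<longleftrightarrow> (\<forall>c. lift_relation z (\<lambda>j. V j $ c))"
  unfolding lift_of_def lift_relation_def vec_eq_iff by auto

text \<open>The three-term Pluecker relation \<open>pl\<close> between the brackets becomes the
  frieze relation on division by e1 * e4.\<close>

lemma frieze_invariants:
  assumes "\<And>j. edge_det V j \<noteq> 0"
  shows "frieze (invariants V)"
  unfolding frieze_def
proof
  fix i
  define e0 e1 e2 e3 e4 where "e0 = edge_det V i" and "e1 = edge_det V (i + 1)"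
    and "e2 = edge_det V (i + 2)" and "e3 = edge_det V (i + 3)" and "e4 = edge_det V (i + 4)"
  note e = e0_def e1_def e2_def e3_def e4_def
  have ne: "e0 \<noteq> 0" "e1 \<noteq> 0" "e2 \<noteq> 0" "e3 \<noteq> 0" "e4 \<noteq> 0" using assms by (simp_all add: e)
  define d0 d1 d3 where "d0 = diagonal_det V i" and "d1 = diagonal_det V (i + 1)" and "d3 = diagonal_det V (i + 3)"
  have pl: "d0 * d1 = e1 * e4 + d3 * e0"
    unfolding d0_def d1_def d3_def e edge_det_def diagonal_det_def add.assoc
    by (simp only: five_wrap numeral_plus_numeral one_plus_numeral add_num_simps numeral_plus_one)
       (unfold triple_def, algebra)
  have I: "invariants V i = d0 * e2 / (e1 * e3)" "invariants V (i + 1) = d1 * e3 / (e2 * e4)"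
    "invariants V (i + 3) = d3 * e0 / (e4 * e1)"
    unfolding invariants_def e d0_def d1_def d3_def by (simp_all add: add.assoc five_wrap)
  have "invariants V i * invariants V (i + 1) = d0 * d1 / (e1 * e4)"
    "1 + invariants V (i + 3) = (e1 * e4 + d3 * e0) / (e1 * e4)"
    unfolding I using ne by (simp_all add: field_simps)
  then show "invariants V i * invariants V (i + 1) = 1 + invariants V (i + 3)" using pl by simp
qed

lemma lift_of_normalized:
  assumes "\<And>j. edge_det V j \<noteq> 0"
  shows "lift_of (invariants V) (normalized V)"
  unfolding lift_of_def
proof
  fix j
  define e0 e1 e2 e3 e4 where "e0 = edge_det V j" and "e1 = edge_det V (j + 1)"
    and "e2 = edge_det V (j + 2)" and "e3 = edge_det V (j + 3)" and "e4 = edge_det V (j + 4)"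
  note e = e0_def e1_def e2_def e3_def e4_def
  have ne: "e0 \<noteq> 0" "e1 \<noteq> 0" "e2 \<noteq> 0" "e3 \<noteq> 0" "e4 \<noteq> 0" using assms by (simp_all add: e)
  define d1 d4 where "d1 = diagonal_det V (j + 1)" and "d4 = diagonal_det V (j + 4)"
  have "e0 = triple (V (j + 2)) (V (j + 3)) (V (j + 4))" "d1 = triple (V (j + 1)) (V (j + 3)) (V (j + 4))"
    "d4 = triple (V (j + 1)) (V (j + 2)) (V (j + 4))" "e4 = triple (V (j + 1)) (V (j + 2)) (V (j + 3))"
    unfolding e d1_def d4_def edge_det_def diagonal_det_def
    by (simp_all add: add.assoc five_wrap triple_rotate[of "V (j + 1)" "V (j + 2)" "V (j + 4)"])
  then have rel: "e0 *\<^sub>R V (j + 1) - d1 *\<^sub>R V (j + 2) + d4 *\<^sub>R V (j + 3) - e4 *\<^sub>R V (j + 4) = 0"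
    using triple_relation[where a = "V (j + 1)" and b = "V (j + 2)" and c = "V (j + 3)" and d = "V (j + 4)"] by simp
  have n: "normalized V (j + 1) = (e1 * e3 * e0) *\<^sub>R V (j + 1)"
    "normalized V (j + 2) = (e2 * e4 * e1) *\<^sub>R V (j + 2)"
    "normalized V (j + 3) = (e3 * e0 * e2) *\<^sub>R V (j + 3)"
    "normalized V (j + 4) = (e4 * e1 * e3) *\<^sub>R V (j + 4)"
    "invariants V (j + 1) = d1 * e3 / (e2 * e4)" "invariants V (j + 4) = d4 * e1 / (e0 * e2)"
    unfolding normalized_def invariants_def e d1_def d4_def by (simp_all add: add.assoc five_wrap)
  have "normalized V (j + 1) - invariants V (j + 1) *\<^sub>R normalized V (j + 2)
      + invariants V (j + 4) *\<^sub>R normalized V (j + 3) - normalized V (j + 4)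
    = (e1 * e3) *\<^sub>R (e0 *\<^sub>R V (j + 1) - d1 *\<^sub>R V (j + 2) + d4 *\<^sub>R V (j + 3) - e4 *\<^sub>R V (j + 4))"
    unfolding n using ne by (simp add: algebra_simps)
  then show "normalized V (j + 1) - invariants V (j + 1) *\<^sub>R normalized V (j + 2)
      + invariants V (j + 4) *\<^sub>R normalized V (j + 3) - normalized V (j + 4) = 0"
    unfolding rel by simp
qed

definition heat_vector :: "real \<Rightarrow> (5 \<Rightarrow> real) \<Rightarrow> (5 \<Rightarrow> real^3) \<Rightarrow> 5 \<Rightarrow> real^3" where
  "heat_vector l z V j = ((1 + l) * z (j + 1)) *\<^sub>R V (j + 2) + V (j + 4) - l *\<^sub>R V (j + 1)"

text \<open>Modulo the two middle vertices the relation identifies V (i + 4) with V (i + 1), and the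
  cyclic exchange needed is an even permutation.\<close>

lemma lift_of_edge_det:
  assumes V: "lift_of z V"
  shows "edge_det V j = edge_det V 0"
proof -
  have step: "edge_det V (i + 4) = edge_det V i" for i
  proof -
    have "V (i + 4) = 1 *\<^sub>R V (i + 1) + (- z (i + 1)) *\<^sub>R V (i + 2) + z (i + 4) *\<^sub>R V (i + 3)"
      using V[unfolded lift_of_def, rule_format, of i] by (simp add: algebra_simps)
    then have "edge_det V i = triple (0 *\<^sub>R V (i + 1) + 1 *\<^sub>R V (i + 2) + 0 *\<^sub>R V (i + 3))
       (0 *\<^sub>R V (i + 1) + 0 *\<^sub>R V (i + 2) + 1 *\<^sub>R V (i + 3))
       (1 *\<^sub>R V (i + 1) + (- z (i + 1)) *\<^sub>R V (i + 2) + z (i + 4) *\<^sub>R V (i + 3))"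
      by (simp add: edge_det_def)
    then show ?thesis unfolding triple_combination by (simp add: edge_det_def add.assoc five_wrap)
  qed
  show ?thesis
    using exhaust_5[of j] step[of 0] step[of 1] step[of 2] step[of 3] step[of 4]
    by (auto simp: five_numerals)
qed

text \<open>All image vectors are written in the basis of the vertices j + 1, j + 2, j + 3. Their
  determinants are then polynomials in z, which the frieze relations reduce to the stated
  form.\<close>

lemma heat_vector_dets:
  assumes V: "lift_of z V" and z: "frieze z"
  shows "edge_det (heat_vector l z V) j = edge l z j * edge_det V 0"
    and "diagonal_det (heat_vector l z V) j = diagonal l z j * edge_det V 0"
proof -
  define a b c where "a = V (j + 1)" and "b = V (j + 2)" and "c = V (j + 3)"
  define z0 z1 z2 z3 z4 where "z0 = z j" and "z1 = z (j + 1)" and "z2 = z (j + 2)"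
    and "z3 = z (j + 3)" and "z4 = z (j + 4)"
  note abc = a_def[symmetric] b_def[symmetric] c_def[symmetric]
    z0_def[symmetric] z1_def[symmetric] z2_def[symmetric] z3_def[symmetric] z4_def[symmetric]
  have fr: "z0 * z1 = 1 + z3" "z1 * z2 = 1 + z4" "z2 * z3 = 1 + z0" "z3 * z4 = 1 + z1" "z4 * z0 = 1 + z2"
    using z[unfolded frieze_def, rule_format, of j] z[unfolded frieze_def, rule_format, of "j + 1"]
      z[unfolded frieze_def, rule_format, of "j + 2"] z[unfolded frieze_def, rule_format, of "j + 3"]
      z[unfolded frieze_def, rule_format, of "j + 4"]
    by (simp_all add: add.assoc five_wrap abc)
  have r: "a - z1 *\<^sub>R b + z4 *\<^sub>R c - V (j + 4) = 0" "b - z2 *\<^sub>R c + z0 *\<^sub>R V (j + 4) - V j = 0"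
    using V[unfolded lift_of_def, rule_format, of j] V[unfolded lift_of_def, rule_format, of "j + 1"]
    by (simp_all only: add.assoc five_wrap abc numeral_plus_numeral one_plus_numeral add_num_simps numeral_plus_one
        one_add_one)
  have V4: "V (j + 4) = a - z1 *\<^sub>R b + z4 *\<^sub>R c" using r(1) by simp
  have "V j = b - z2 *\<^sub>R c + z0 *\<^sub>R V (j + 4)" using r(2) by simp
  also have "\<dots> = z0 *\<^sub>R a + (1 - z0 * z1) *\<^sub>R b + (z4 * z0 - z2) *\<^sub>R c"
    unfolding V4 by (simp add: algebra_simps)
  finally have V0: "V j = z0 *\<^sub>R a - z3 *\<^sub>R b + c" using fr by simp
  have t: "triple a b c = edge_det V 0"
    using lift_of_edge_det[OF V, of "j + 4"] by (simp add: edge_det_def add.assoc five_wrap abc)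
  let ?W = "heat_vector l z V"
  have W: "?W j = (1 - l) *\<^sub>R a + (l * z1) *\<^sub>R b + z4 *\<^sub>R c"
    "?W (j + 2) = (1 + (1 + l) * z3) *\<^sub>R a + (- (1 + l) * (z3 * z1)) *\<^sub>R b + ((1 + l) * (z3 * z4) - l) *\<^sub>R c"
    "?W (j + 3) = ((1 + l) * (z4 * z0) - l) *\<^sub>R a + (1 - (1 + l) * (z4 * z3) + l * z1) *\<^sub>R b + ((1 + l) * z4 - l * z4) *\<^sub>R c"
    "?W (j + 4) = ((1 + l) * z0 - l * z0) *\<^sub>R a + (l * z3) *\<^sub>R b + (1 - l) *\<^sub>R c"
    unfolding heat_vector_def
    by (simp_all only: add.assoc five_wrap abc V0 V4 numeral_plus_numeral one_plus_numeral add_num_simps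
        numeral_plus_one one_add_one) (simp_all add: algebra_simps)
  show "edge_det ?W j = edge l z j * edge_det V 0"
    unfolding edge_det_def W triple_combination t edge_def abc using fr by algebra
  show "diagonal_det ?W j = diagonal l z j * edge_det V 0"
    unfolding diagonal_det_def W triple_combination t diagonal_def abc using fr by algebra
qed

text \<open>The state that is iterated in place of a pentagon. One nonzero determinant is enough,
  since the lift relation makes all five equal.\<close>

definition configuration :: "(5 \<Rightarrow> real) \<Rightarrow> (5 \<Rightarrow> real^3) \<Rightarrow> bool" where
  "configuration z V \<longleftrightarrow> (\<forall>j. z j > 0) \<and> frieze z \<and> lift_of z V \<and> edge_det V 0 \<noteq> 0"

definition heat_step :: "real \<Rightarrow> real \<Rightarrow> (5 \<Rightarrow> real) \<Rightarrow> (5 \<Rightarrow> real^3) \<Rightarrow> 5 \<Rightarrow> real^3" where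
  "heat_step l \<kappa> z V j = (gauge l z j / (regular_edge l ^ 3 * \<kappa>)) *\<^sub>R heat_vector l z V j"

lemma heat_step_component: "heat_step l \<kappa> z V j $ c = heat_lift l \<kappa> z (\<lambda>j. V j $ c) j"
  by (simp add: heat_step_def heat_lift_def heat_vector_def heat_combination_def)

lemma gauge_pos: "l > 0 \<Longrightarrow> (\<And>j. z j > 0) \<Longrightarrow> gauge l z j > 0"
  unfolding gauge_def by (intro mult_pos_pos edge_pos)

lemma configuration_edge_det: "configuration z V \<Longrightarrow> edge_det V j \<noteq> 0"
  using lift_of_edge_det[of z V j] by (simp add: configuration_def)

text \<open>Up to a constant independent of j, \<open>heat_step\<close> is the normalization of the
  image vectors, and their invariants are \<open>heat_frieze l z\<close>. The lift relation is
  homogeneous, so the constant does no harm.\<close>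

lemma configuration_step:
  assumes l: "l > 0" and \<kappa>: "\<kappa> \<noteq> 0" and c: "configuration z V"
  shows "configuration (heat_frieze l z) (heat_step l \<kappa> z V)"
proof -
  have z: "\<And>j. z j > 0" "frieze z" "lift_of z V" and V0: "edge_det V 0 \<noteq> 0"
    using c by (auto simp: configuration_def)
  let ?W = "heat_vector l z V" and ?t = "edge_det V 0"
  note dets = heat_vector_dets[OF z(3,2)]
  have ep: "edge l z j > 0" for j using edge_pos[OF l, of z, OF z(1)] .
  have e: "edge_det ?W j \<noteq> 0" for j unfolding dets using V0 ep[of j] by simp
  have inv: "invariants ?W = heat_frieze l z"
    using V0 by (auto simp: fun_eq_iff invariants_def heat_frieze_def dets)
  define s where "s = 1 / (?t^3 * (regular_edge l ^ 3 * \<kappa>))"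
  have s: "s \<noteq> 0" using V0 \<kappa> regular_edge_pos[OF l] by (simp add: s_def)
  have n: "heat_step l \<kappa> z V j = s *\<^sub>R normalized ?W j" for j
    using V0 by (simp add: heat_step_def normalized_def dets gauge_def s_def power3_eq_cube)
  have "lift_of (heat_frieze l z) (normalized ?W)"
    using lift_of_normalized[of ?W, OF e] by (simp add: inv)
  then have "lift_of (heat_frieze l z) (heat_step l \<kappa> z V)"
    unfolding lift_of_def n
    by (metis (no_types, lifting) scaleR_left_commute scaleR_right_diff_distrib scaleR_right_distrib scaleR_zero_right)
  moreover have "edge_det (heat_step l \<kappa> z V) 0 \<noteq> 0"
  proof -
    have "edge_det (heat_step l \<kappa> z V) 0 = gauge l z 2 / (regular_edge l ^ 3 * \<kappa>) *
        (gauge l z 3 / (regular_edge l ^ 3 * \<kappa>)) * (gauge l z 4 / (regular_edge l ^ 3 * \<kappa>)) * edge_det ?W 0"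
      unfolding edge_det_def heat_step_def triple_scale by simp
    moreover have "gauge l z j / (regular_edge l ^ 3 * \<kappa>) \<noteq> 0" for j
      using gauge_pos[OF l, of z j] z(1) \<kappa> regular_edge_pos[OF l] by simp
    ultimately show ?thesis using e[of 0] by simp
  qed
  moreover have "frieze (heat_frieze l z)"
    using frieze_invariants[of ?W, OF e] by (simp add: inv)
  ultimately show ?thesis
    unfolding configuration_def using heat_frieze_pos[OF l, of z, OF z(1)] by simp
qed

section \<open>Projective frames\<close>

lemma point_eq_iff:
  assumes "v \<noteq> 0" "w \<noteq> 0"
  shows "point v = point w \<longleftrightarrow> (\<exists>c. c \<noteq> 0 \<and> w = c *\<^sub>R v)"
proof -
  have r: "proj_rel u u" if "u \<noteq> 0" for u
    unfolding proj_rel_def using that by (intro conjI exI[of _ 1]) auto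
  have "point v = point w \<longleftrightarrow> proj_rel v w"
    unfolding point_def using Quotient_rel[OF Quotient_rp2, of v w] r assms by auto
  then show ?thesis using assms by (auto simp: proj_rel_def)
qed

lemma point_scale: "c \<noteq> 0 \<Longrightarrow> v \<noteq> 0 \<Longrightarrow> point (c *\<^sub>R v) = point v"
  using point_eq_iff[of v "c *\<^sub>R v"] by auto

lemma point_cases:
  obtains v where "v \<noteq> 0" "p = point v"
proof -
  have "proj_rel (rep_rp2 p) (rep_rp2 p)" by (rule Quotient_rep_reflp[OF Quotient_rp2])
  then have "rep_rp2 p \<noteq> 0" by (simp add: proj_rel_def)
  moreover have "p = point (rep_rp2 p)"
    unfolding point_def by (rule Quotient_abs_rep[OF Quotient_rp2, symmetric])
  ultimately show thesis by (rule that)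
qed

lemma triple_independent:
  assumes "triple a b c \<noteq> 0" "x *\<^sub>R a + y *\<^sub>R b + w *\<^sub>R c = 0"
  shows "x = 0" "y = 0" "w = 0"
proof -
  have "x * triple a b c = triple (x *\<^sub>R a + y *\<^sub>R b + w *\<^sub>R c) b c"
    "y * triple a b c = triple a (x *\<^sub>R a + y *\<^sub>R b + w *\<^sub>R c) c"
    "w * triple a b c = triple a b (x *\<^sub>R a + y *\<^sub>R b + w *\<^sub>R c)"
    unfolding triple_def by (simp_all, algebra+)
  then have "x * triple a b c = 0" "y * triple a b c = 0" "w * triple a b c = 0"
    unfolding assms(2) by (simp_all add: triple_def)
  then show "x = 0" "y = 0" "w = 0" using assms(1) by auto
qed

lemma triple_span:
  assumes "triple a b c \<noteq> 0"
  shows "x = (triple x b c / triple a b c) *\<^sub>R a + (triple a x c / triple a b c) *\<^sub>R b + (triple a b x / triple a b c) *\<^sub>R c"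
proof -
  have "triple a b c *\<^sub>R x = triple x b c *\<^sub>R a + triple a x c *\<^sub>R b + triple a b x *\<^sub>R c"
    unfolding vec_eq_iff forall_3 triple_def by (simp; intro conjI; algebra)
  then have "(1 / triple a b c) *\<^sub>R (triple a b c *\<^sub>R x)
      = (1 / triple a b c) *\<^sub>R (triple x b c *\<^sub>R a + triple a x c *\<^sub>R b + triple a b x *\<^sub>R c)"
    by simp
  then show ?thesis using assms by (simp add: scaleR_right_distrib)
qed

text \<open>The map is given by Cramer's rule, and its inverse by the same formula with the two
  frames exchanged.\<close>

lemma frame_matrix:
  assumes t: "triple a b c \<noteq> 0" and s: "triple p q r \<noteq> 0"
  obtains M :: "real^3^3" where "invertible M" "M *v a = p" "M *v b = q" "M *v c = r"
proof -
  let ?f = "\<lambda>a b c p q r x. (triple x b c / triple a b c) *\<^sub>R p + (triple a x c / triple a b c) *\<^sub>R q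
    + (triple a b x / triple a b c) *\<^sub>R (r :: real^3)"
  have lin: "linear (?f a b c p q r)" for a b c p q r
    unfolding linear_iff triple_def by (simp add: vec_eq_iff forall_3 add_divide_distrib diff_divide_distrib algebra_simps)
  have eval: "?f a b c p q r a = p" "?f a b c p q r b = q" "?f a b c p q r c = r" if "triple a b c \<noteq> 0" for a b c p q r
  proof -
    have z: "triple b b c = 0" "triple a a c = 0" "triple a b a = 0" "triple c b c = 0" "triple a c c = 0" "triple a b b = 0"
      unfolding triple_def by algebra+
    show "?f a b c p q r a = p" "?f a b c p q r b = q" "?f a b c p q r c = r"
      using that by (simp_all add: z)
  qed
  have id: "?f p q r a b c (?f a b c p q r x) = x" if "triple a b c \<noteq> 0" "triple p q r \<noteq> 0" for a b c p q r x
  proof -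
    interpret linear "?f p q r a b c" by (rule lin)
    have "?f p q r a b c (?f a b c p q r x) = (triple x b c / triple a b c) *\<^sub>R ?f p q r a b c p
      + (triple a x c / triple a b c) *\<^sub>R ?f p q r a b c q + (triple a b x / triple a b c) *\<^sub>R ?f p q r a b c r"
      unfolding add scale ..
    also have "\<dots> = x" unfolding eval[OF that(2)] by (rule triple_span[OF that(1), symmetric])
    finally show ?thesis .
  qed
  let ?M = "matrix (?f a b c p q r)" and ?N = "matrix (?f p q r a b c)"
  have MN: "?M *v x = ?f a b c p q r x" "?N *v x = ?f p q r a b c x" for x
    by (rule fun_cong[OF matrix_vector_mul(2)[OF lin]])+
  have "?M ** ?N = mat 1" "?N ** ?M = mat 1"
    unfolding matrix_eq by (simp_all only: matrix_vector_mul_assoc[symmetric] MN matrix_vector_mul_lid id[OF t s] id[OF s t] simp_thms)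
  then have "invertible ?M" unfolding invertible_def by blast
  then show thesis by (rule that) (simp_all only: MN eval[OF t])
qed

lemma invertible_nonzero: "invertible (M::real^3^3) \<Longrightarrow> v \<noteq> 0 \<Longrightarrow> M *v v \<noteq> 0"
  by (metis invertible_def matrix_left_invertible_ker matrix_vector_mult_0_right)

lemma projective_transformation_exists:
  assumes "invertible (M::real^3^3)"
  obtains T where "projective_transformation T" "\<And>v. v \<noteq> 0 \<Longrightarrow> T (point v) = point (M *v v)"
proof -
  define T where "T p = point (M *v (SOME v. v \<noteq> 0 \<and> p = point v))" for p
  have T: "T (point v) = point (M *v v)" if v: "v \<noteq> 0" for v
  proof -
    define w where "w = (SOME w. w \<noteq> 0 \<and> point v = point w)"
    have "w \<noteq> 0 \<and> point v = point w"
      unfolding w_def by (rule someI[of _ v]) (use v in simp)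
    then obtain c where "c \<noteq> 0" "w = c *\<^sub>R v" using point_eq_iff[OF v] by auto
    then have "T (point v) = point (c *\<^sub>R (M *v v))"
      by (simp add: T_def w_def[symmetric] matrix_vector_mult_scaleR)
    then show ?thesis using point_scale[OF \<open>c \<noteq> 0\<close> invertible_nonzero[OF assms v]] by simp
  qed
  then have "projective_transformation T"
    unfolding projective_transformation_def using assms by blast
  then show thesis using T by (rule that)
qed

text \<open>The corners of the square have lifts with p - q + r - s = 0. A linear map carrying a, b,
  c to p, q, r therefore carries d to s, which gives existence. For any competitor the fourth point
  forces the scalars at a, b, c to agree, which gives uniqueness and lets the \<open>THE\<close> in
  \<open>heat_point\<close> be evaluated.\<close>

lemma heat_point_eq:
  assumes rel: "a - b + c - d = 0" and t: "triple a b c \<noteq> 0"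
  shows "heat_point l (point a) (point b) (point c) (point d) = point (a + c + l *\<^sub>R (b - a))"
proof -
  define p q r s where "p = (vector [-1, 1, 1] :: real^3)" and "q = (vector [1, 1, 1] :: real^3)"
    and "r = (vector [1, -1, 1] :: real^3)" and "s = (vector [-1, -1, 1] :: real^3)"
  note pqrs = p_def q_def r_def s_def
  have spqr: "s = p - q + r" unfolding pqrs by (simp add: vec_eq_iff forall_3)
  have d: "d = a - b + c" using rel by simp
  have tp: "triple p q r \<noteq> 0" unfolding pqrs triple_def by simp
  have nz: "p \<noteq> 0" "q \<noteq> 0" "r \<noteq> 0" "s \<noteq> 0" unfolding pqrs by (auto simp: vec_eq_iff forall_3)
  have nza: "a \<noteq> 0" "b \<noteq> 0" "c \<noteq> 0" using t by (auto simp: triple_def)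
  have d0: "d \<noteq> 0"
  proof
    assume "d = 0"
    then have "1 *\<^sub>R a + (-1) *\<^sub>R b + 1 *\<^sub>R c = 0" using d by simp
    from triple_independent(1)[OF t this] show False by simp
  qed
  have ap: "affine_point (vector [- 1, 1]) = point p" "affine_point (vector [1, 1]) = point q"
    "affine_point (vector [1, - 1]) = point r" "affine_point (vector [- 1, - 1]) = point s"
    "affine_point (vector [l, 0]) = point (vector [l, 0, 1])"
    unfolding pqrs affine_chart_def by simp_all
  let ?P = "\<lambda>T. projective_transformation T \<and> T (point a) = point p \<and> T (point b) = point q
     \<and> T (point c) = point r \<and> T (point d) = point s"
  obtain M :: "real^3^3" where M: "invertible M" "M *v a = p" "M *v b = q" "M *v c = r"
    by (rule frame_matrix[OF t tp])
  obtain T where T: "projective_transformation T" "\<And>v. v \<noteq> 0 \<Longrightarrow> T (point v) = point (M *v v)"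
    by (rule projective_transformation_exists[OF M(1)]) blast
  have Md: "M *v d = s" unfolding d spqr by (simp add: matrix_vector_right_distrib matrix_vector_mult_diff_distrib M)
  have PT: "?P T" using T nza d0 M Md by simp
  have unique: "T' = T" if "?P T'" for T'
  proof
    fix x
    have "projective_transformation T'" using that by simp
    then obtain M' :: "real^3^3" where M'0: "invertible M'" "\<forall>v. v \<noteq> 0 \<longrightarrow> T' (point v) = point (M' *v v)"
      unfolding projective_transformation_def by blast
    then have M': "invertible M'" "v \<noteq> 0 \<Longrightarrow> T' (point v) = point (M' *v v)" for v by simp_all
    have ex: "\<exists>k. k \<noteq> 0 \<and> M' *v v = k *\<^sub>R w" if "v \<noteq> 0" "w \<noteq> 0" "T' (point v) = point w" for v w
    proof -
      have "point w = point (M' *v v)" using that M' by simp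
      then show ?thesis using point_eq_iff[OF that(2) invertible_nonzero[OF M'(1) that(1)]] by blast
    qed
    have Ta: "T' (point a) = point p" and Tb: "T' (point b) = point q" and Tc: "T' (point c) = point r"
      and Td: "T' (point d) = point s" using that by simp_all
    obtain ka where ka: "ka \<noteq> 0" "M' *v a = ka *\<^sub>R p" using ex[OF nza(1) nz(1) Ta] by blast
    obtain kb where kb: "kb \<noteq> 0" "M' *v b = kb *\<^sub>R q" using ex[OF nza(2) nz(2) Tb] by blast
    obtain kc where kc: "kc \<noteq> 0" "M' *v c = kc *\<^sub>R r" using ex[OF nza(3) nz(3) Tc] by blast
    obtain kd where kd: "kd \<noteq> 0" "M' *v d = kd *\<^sub>R s" using ex[OF d0 nz(4) Td] by blast
    have "(ka - kd) *\<^sub>R p + (kd - kb) *\<^sub>R q + (kc - kd) *\<^sub>R r = 0"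
      using kd(2) unfolding d spqr
      by (simp add: matrix_vector_right_distrib matrix_vector_mult_diff_distrib ka kb kc algebra_simps)
    from triple_independent[OF tp this] have k: "kb = ka" "kc = ka" by simp_all
    have MM: "M' *v v = ka *\<^sub>R (M *v v)" for v
    proof -
      define v1 v2 v3 where "v1 = triple v b c / triple a b c" and "v2 = triple a v c / triple a b c"
        and "v3 = triple a b v / triple a b c"
      have v: "v = v1 *\<^sub>R a + v2 *\<^sub>R b + v3 *\<^sub>R c"
        unfolding v1_def v2_def v3_def by (rule triple_span[OF t])
      show ?thesis
        by (subst (1 2) v) (simp add: matrix_vector_right_distrib matrix_vector_mult_scaleR ka kb kc M k algebra_simps)
    qed
    obtain v where v: "v \<noteq> 0" "x = point v" by (rule point_cases)
    then show "T' x = T x"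
      using M'(2)[of v] T(2)[of v] MM[of v] point_scale[OF ka(1) invertible_nonzero[OF M(1) v(1)]] by simp
  qed
  have the: "(THE T. ?P T) = T" using PT unique by (rule the_equality)
  let ?h = "a + c + l *\<^sub>R (b - a)"
  have h0: "?h \<noteq> 0"
  proof
    assume "?h = 0"
    then have "(1 - l) *\<^sub>R a + l *\<^sub>R b + 1 *\<^sub>R c = 0" by (simp add: algebra_simps)
    from triple_independent(3)[OF t this] show False by simp
  qed
  have Th: "T (point ?h) = point (vector [l, 0, 1])"
  proof -
    have "M *v ?h = 2 *\<^sub>R vector [l, 0, 1]"
      by (simp add: matrix_vector_right_distrib matrix_vector_mult_diff_distrib matrix_vector_mult_scaleR M)
        (simp add: pqrs vec_eq_iff forall_3)
    moreover have "(vector [l, 0, 1] :: real^3) \<noteq> 0" by (simp add: vec_eq_iff forall_3)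
    ultimately show ?thesis using T(2)[OF h0] point_scale[of 2 "vector [l, 0, 1]"] by simp
  qed
  have "inj T"
  proof (rule injI)
    fix x y assume xy: "T x = T y"
    obtain v where v: "v \<noteq> 0" "x = point v" by (rule point_cases)
    obtain w where w: "w \<noteq> 0" "y = point w" by (rule point_cases)
    have "point (M *v v) = point (M *v w)" using xy v w T(2) by simp
    then obtain k where k: "k \<noteq> 0" "M *v w = k *\<^sub>R (M *v v)"
      using point_eq_iff[OF invertible_nonzero[OF M(1) v(1)] invertible_nonzero[OF M(1) w(1)]] by blast
    then have "M *v (w - k *\<^sub>R v) = 0" by (simp add: matrix_vector_mult_diff_distrib matrix_vector_mult_scaleR)
    then have "w = k *\<^sub>R v" using invertible_nonzero[OF M(1), of "w - k *\<^sub>R v"] by auto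
    then show "x = y" using v w point_eq_iff[OF v(1) w(1)] k(1) by auto
  qed
  then have "inv T (point (vector [l, 0, 1])) = point ?h" using Th by (rule inv_f_eq)
  then show ?thesis unfolding heat_point_def ap the .
qed

text \<open>The two middle vectors absorb their frieze coefficients without changing their points,
  so the lift relation takes the form a - b + e - d = 0 required for
  \<open>heat_point_eq\<close>.\<close>

lemma heat_map_configuration:
  assumes l: "l > 0" and \<kappa>: "\<kappa> \<noteq> 0" and c: "configuration z V"
  shows "heat_map l (\<chi> j. point (V j)) = (\<chi> j. point (heat_step l \<kappa> z V j))"
  unfolding heat_map_def vec_eq_iff
proof (intro allI, simp)
  fix j
  have z: "\<And>j. z j > 0" "lift_of z V" using c by (auto simp: configuration_def)
  define a b e d where "a = V (j + 1)" and "b = z (j + 1) *\<^sub>R V (j + 2)"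
    and "e = z (j + 4) *\<^sub>R V (j + 3)" and "d = V (j + 4)"
  have t: "triple (V (j + 1)) (V (j + 2)) (V (j + 3)) \<noteq> 0"
    using configuration_edge_det[OF c, of "j + 4"] by (simp add: edge_det_def add.assoc five_wrap)
  then have nz: "V (j + 2) \<noteq> 0" "V (j + 3) \<noteq> 0" by (auto simp: triple_def)
  have "triple a b e = 1 * z (j + 1) * z (j + 4) * triple (V (j + 1)) (V (j + 2)) (V (j + 3))"
    unfolding a_def b_def e_def triple_scale[symmetric] by simp
  then have abe: "triple a b e \<noteq> 0" using t z(1)[of "j + 1"] z(1)[of "j + 4"] by simp
  have rel: "a - b + e - d = 0"
    using z(2)[unfolded lift_of_def, rule_format, of j] by (simp add: a_def b_def e_def d_def)
  have "z (j + 1) \<noteq> 0" "z (j + 4) \<noteq> 0" using z(1)[of "j + 1"] z(1)[of "j + 4"] by auto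
  then have pt: "point b = point (V (j + 2))" "point e = point (V (j + 3))"
    using nz by (simp_all add: b_def e_def point_scale)
  have "heat_point l (point (V (j + 1))) (point (V (j + 2))) (point (V (j + 3))) (point (V (j + 4)))
      = point (a + e + l *\<^sub>R (b - a))"
    using heat_point_eq[OF rel abe, of l] unfolding pt by (simp add: a_def d_def)
  also have "a + e + l *\<^sub>R (b - a) = heat_vector l z V j"
  proof -
    have "e = b + d - a" using rel by (simp add: algebra_simps)
    then show ?thesis by (simp add: heat_vector_def a_def b_def d_def algebra_simps)
  qed
  also have "point (heat_vector l z V j) = point (heat_step l \<kappa> z V j)"
  proof -
    have s: "heat_step l \<kappa> z V i \<noteq> 0" for i
      using configuration_edge_det[OF configuration_step[OF l \<kappa> c], of "i + 1"]
      by (auto simp: edge_det_def triple_def add.assoc five_wrap)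
    then show ?thesis unfolding heat_step_def
      by (metis point_scale scaleR_eq_0_iff)
  qed
  finally show "heat_point l (point (V (j + 1))) (point (V (j + 2))) (point (V (j + 3))) (point (V (j + 4)))
      = point (heat_step l \<kappa> z V j)" .
qed

section \<open>Convex pentagons\<close>

definition orientation :: "real^2 \<Rightarrow> real^2 \<Rightarrow> real^2 \<Rightarrow> real" where
  "orientation a b c = (b$1 - a$1) * (c$2 - a$2) - (b$2 - a$2) * (c$1 - a$1)"

lemma triple_affine:
  "triple (vector [a$1, a$2, 1]) (vector [b$1, b$2, 1]) (vector [c$1, c$2, 1]) = orientation a b c"
  by (simp add: triple_def orientation_def algebra_simps)

lemma orientation_rotate: "orientation b c a = orientation a b c"
  unfolding orientation_def by algebra

text \<open>Faces of a polytope are exposed, so the edge lies on a supporting line. Its direction is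
  \<tau> times the normal turned by a right angle; the orientation of a third vertex is then \<tau>
  times its slack in the supporting inequality, and extremality of the vertices makes that slack
  positive.\<close>

lemma edge_orientation:
  fixes v :: "real^2^5"
  assumes v: "strictly_convex_polygon v"
  obtains s where "s = 1 \<or> s = (-1::real)"
    "\<And>k. k \<noteq> j \<Longrightarrow> k \<noteq> j + 1 \<Longrightarrow> s * orientation (v $ j) (v $ (j + 1)) (v $ k) > 0"
proof -
  let ?H = "convex hull (range (\<lambda>i. v $ i))"
  have inj: "inj (\<lambda>j. v $ j)" and ext: "v $ k extreme_point_of ?H"
    and edge: "closed_segment (v $ j) (v $ (j + 1)) face_of ?H" for k
    using v by (auto simp: strictly_convex_polygon_def edge_of_def)
  have "polyhedron ?H" by (intro polytope_imp_polyhedron polytope_convex_hull) simp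
  then have "closed_segment (v $ j) (v $ (j + 1)) exposed_face_of ?H"
    using exposed_face_of_polyhedron edge by blast
  then obtain a b where ab: "?H \<subseteq> {x. a \<bullet> x \<le> b}" "closed_segment (v $ j) (v $ (j + 1)) = ?H \<inter> {x. a \<bullet> x = b}"
    unfolding exposed_face_of_def by blast
  have inH: "v $ k \<in> ?H" for k by (intro hull_inc) simp
  have eq: "a \<bullet> v $ j = b" "a \<bullet> v $ (j + 1) = b"
    using ab(2) ends_in_segment by blast+
  have less: "a \<bullet> v $ k < b" if k: "k \<noteq> j" "k \<noteq> j + 1" for k
  proof -
    have "v $ k \<noteq> v $ j" "v $ k \<noteq> v $ (j + 1)" using inj k by (auto simp: inj_def)
    then have "v $ k \<notin> closed_segment (v $ j) (v $ (j + 1))"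
      using ext[of k] inH[of j] inH[of "j + 1"]
      by (auto simp: extreme_point_of_def open_segment_def)
    then have "a \<bullet> v $ k \<noteq> b" using ab(2) inH[of k] by blast
    moreover have "a \<bullet> v $ k \<le> b" using ab(1) inH[of k] by blast
    ultimately show ?thesis by simp
  qed
  have "j + 2 \<noteq> j" "j + 2 \<noteq> j + 1" by simp_all
  from less[OF this] have "a \<noteq> 0" using eq by auto
  then have aa: "(a$1)^2 + (a$2)^2 > 0"
    by (auto simp: vec_eq_iff forall_2 sum_power2_gt_zero_iff)
  define \<delta> where "\<delta> = v $ (j + 1) - v $ j"
  define \<tau> where "\<tau> = (a$1 * \<delta>$2 - a$2 * \<delta>$1) / ((a$1)^2 + (a$2)^2)"
  have perp: "a$1 * \<delta>$1 + a$2 * \<delta>$2 = 0"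
    using eq by (simp add: \<delta>_def inner_vec_def sum_2 algebra_simps)
  have \<delta>: "\<delta>$1 = - \<tau> * a$2" "\<delta>$2 = \<tau> * a$1"
  proof -
    have "\<tau> * ((a$1)^2 + (a$2)^2) = a$1 * \<delta>$2 - a$2 * \<delta>$1" using aa by (simp add: \<tau>_def)
    then have "(\<delta>$1 + \<tau> * a$2) * ((a$1)^2 + (a$2)^2) = 0" "(\<delta>$2 - \<tau> * a$1) * ((a$1)^2 + (a$2)^2) = 0"
      using perp by algebra+
    then have "\<delta>$1 + \<tau> * a$2 = 0" "\<delta>$2 - \<tau> * a$1 = 0" using aa by (metis less_irrefl mult_eq_0_iff)+
    then show "\<delta>$1 = - \<tau> * a$2" "\<delta>$2 = \<tau> * a$1" by simp_all
  qed
  have "\<delta> \<noteq> 0" using injD[OF inj, of "j + 1" j] by (auto simp: \<delta>_def)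
  then have "\<tau> \<noteq> 0" using \<delta> by (auto simp: vec_eq_iff forall_2)
  have o: "orientation (v $ j) (v $ (j + 1)) (v $ k) = \<tau> * (b - a \<bullet> v $ k)" for k
  proof -
    have "orientation (v $ j) (v $ (j + 1)) (v $ k)
      = \<delta>$1 * (v $ k $ 2 - v $ j $ 2) - \<delta>$2 * (v $ k $ 1 - v $ j $ 1)"
      by (simp add: orientation_def \<delta>_def)
    also have "\<dots> = \<tau> * (a \<bullet> v $ j - a \<bullet> v $ k)"
      unfolding \<delta> by (simp add: inner_vec_def sum_2 algebra_simps)
    finally show ?thesis using eq by simp
  qed
  show thesis
  proof (rule that[of "sgn \<tau>"])
    show "sgn \<tau> = 1 \<or> sgn \<tau> = -1" using \<open>\<tau> \<noteq> 0\<close> by (auto simp: sgn_if)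
    fix k assume "k \<noteq> j" "k \<noteq> j + 1"
    from less[OF this] \<open>\<tau> \<noteq> 0\<close> show "sgn \<tau> * orientation (v $ j) (v $ (j + 1)) (v $ k) > 0"
      unfolding o by (auto simp: sgn_if zero_less_mult_iff mult_less_0_iff)
  qed
qed

text \<open>The signs at consecutive edges agree because both edges bound the triangle of the
  vertices j, j + 1, j + 2, whose orientation is unchanged by a cyclic rotation.\<close>

lemma strictly_convex_orientation:
  fixes v :: "real^2^5"
  assumes v: "strictly_convex_polygon v"
  shows "\<exists>s. (s = 1 \<or> s = (-1::real)) \<and>
    (\<forall>j k. k \<noteq> j \<longrightarrow> k \<noteq> j + 1 \<longrightarrow> s * orientation (v $ j) (v $ (j + 1)) (v $ k) > 0)"
proof -
  have "\<forall>j. \<exists>s. (s = 1 \<or> s = (-1::real)) \<and>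
      (\<forall>k. k \<noteq> j \<longrightarrow> k \<noteq> j + 1 \<longrightarrow> s * orientation (v $ j) (v $ (j + 1)) (v $ k) > 0)"
    by (rule allI, rule edge_orientation[OF v]) blast
  from choice[OF this] obtain s where s: "\<forall>j. (s j = 1 \<or> s j = (-1::real)) \<and>
      (\<forall>k. k \<noteq> j \<longrightarrow> k \<noteq> j + 1 \<longrightarrow> s j * orientation (v $ j) (v $ (j + 1)) (v $ k) > 0)" ..
  have step: "s (j + 1) = s j" for j
  proof -
    have "s j * orientation (v $ j) (v $ (j + 1)) (v $ (j + 2)) > 0" using s[rule_format, of j] by simp
    moreover have "s (j + 1) * orientation (v $ (j + 1)) (v $ (j + 2)) (v $ j) > 0"
      using s[rule_format, of "j + 1"] by (simp add: add.assoc)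
    moreover have "s j = 1 \<or> s j = -1" "s (j + 1) = 1 \<or> s (j + 1) = -1"
      using s[rule_format, of j] s[rule_format, of "j + 1"] by simp_all
    ultimately show ?thesis
      unfolding orientation_rotate[of "v $ (j + 1)" "v $ (j + 2)" "v $ j"] by auto
  qed
  have s0: "s j = s 0" for j
    using exhaust_5[of j] step[of 0] step[of 1] step[of 2] step[of 3] by auto
  show ?thesis
  proof (intro exI[of _ "s 0"] conjI allI impI)
    show "s 0 = 1 \<or> s 0 = -1" using spec[OF s, of 0] by blast
    fix j k :: 5 assume "k \<noteq> j" "k \<noteq> j + 1"
    then show "s 0 * orientation (v $ j) (v $ (j + 1)) (v $ k) > 0"
      using spec[OF s, of j] unfolding s0[of j] by blast
  qed
qed

lemma triple_matrix: "triple (M *v u) (M *v v) (M *v w) = det M * triple u v w"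
  unfolding triple_def det_3 matrix_vector_mult_def by (simp add: sum_3) algebra

definition positive_lift :: "(5 \<Rightarrow> real^3) \<Rightarrow> bool" where
  "positive_lift V \<longleftrightarrow> (\<forall>j. edge_det V j > 0 \<and> diagonal_det V j > 0)"

text \<open>The given lift is corrected by constants only. This matters later, when \<open>U\<close>
  depends on chart coordinates: the constants found at one pentagon are kept for its
  neighbours.\<close>

lemma convex_pentagon_positive_lift:
  assumes P: "convex_pentagon P" and U: "\<And>j. U j \<noteq> 0" "\<And>j. P $ j = point (U j)"
  obtains \<sigma> where "\<And>j. \<sigma> j \<noteq> (0::real)" "positive_lift (\<lambda>j. \<sigma> j *\<^sub>R U j)"
proof -
  obtain T v where T: "projective_transformation T" "strictly_convex_polygon v"
    "\<forall>j. T (P $ j) = affine_point (v $ j)"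
    using P unfolding convex_pentagon_def by blast
  from T(1)[unfolded projective_transformation_def] obtain M :: "real^3^3"
    where M': "invertible M \<and> (\<forall>u. u \<noteq> 0 \<longrightarrow> T (point u) = point (M *v u))" ..
  note M = conjunct1[OF M'] conjunct2[OF M']
  from strictly_convex_orientation[OF T(2)] obtain s where s': "(s = 1 \<or> s = (-1::real)) \<and>
    (\<forall>j k. k \<noteq> j \<longrightarrow> k \<noteq> j + 1 \<longrightarrow> s * orientation (v $ j) (v $ (j + 1)) (v $ k) > 0)" ..
  note s = conjunct1[OF s'] conjunct2[OF s', rule_format]
  define a where "a j = (vector [v $ j $ 1, v $ j $ 2, 1] :: real^3)" for j
  have "\<forall>j. \<exists>t. t \<noteq> 0 \<and> M *v U j = t *\<^sub>R a j"
  proof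
    fix j
    have a0: "a j \<noteq> 0" by (simp add: a_def vec_eq_iff forall_3)
    have "point (a j) = point (M *v U j)"
      using T(3) M(2) U by (simp add: affine_chart_def a_def)
    then show "\<exists>t. t \<noteq> 0 \<and> M *v U j = t *\<^sub>R a j"
      using point_eq_iff[OF a0 invertible_nonzero[OF M(1) U(1)[of j]]] by blast
  qed
  from choice[OF this] obtain t where t: "\<forall>j. t j \<noteq> 0 \<and> M *v U j = t j *\<^sub>R a j" ..
  have D: "det M \<noteq> 0" using M(1) by (simp add: invertible_det_nz)
  \<comment> \<open>With this choice every bracket is a square times the orientation of the convex
    polygon multiplied by its sign s, so all ten become positive together.\<close>
  define \<sigma> where "\<sigma> j = s * det M * t j" for j
  have pos: "triple (\<sigma> i *\<^sub>R U i) (\<sigma> j *\<^sub>R U j) (\<sigma> k *\<^sub>R U k) > 0"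
    if o: "s * orientation (v $ i) (v $ j) (v $ k) > 0" for i j k
  proof -
    have "det M * triple (U i) (U j) (U k) = triple (t i *\<^sub>R a i) (t j *\<^sub>R a j) (t k *\<^sub>R a k)"
      unfolding triple_matrix[symmetric] using t by simp
    also have "\<dots> = t i * t j * t k * orientation (v $ i) (v $ j) (v $ k)"
      unfolding triple_scale a_def triple_affine ..
    finally have "triple (\<sigma> i *\<^sub>R U i) (\<sigma> j *\<^sub>R U j) (\<sigma> k *\<^sub>R U k)
      = (s * det M * t i * t j * t k)^2 * (s * orientation (v $ i) (v $ j) (v $ k))"
      unfolding triple_scale \<sigma>_def by algebra
    moreover have "(s * det M * t i * t j * t k)^2 > 0" using s(1) D t by auto
    ultimately show ?thesis using o by simp
  qed
  show thesis
  proof (rule that[of \<sigma>])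
    show "\<sigma> j \<noteq> 0" for j using s(1) D t by (auto simp: \<sigma>_def)
    show "positive_lift (\<lambda>j. \<sigma> j *\<^sub>R U j)"
      unfolding positive_lift_def edge_det_def diagonal_det_def
    proof (intro allI conjI pos)
      fix j
      show "0 < s * orientation (v $ (j + 2)) (v $ (j + 3)) (v $ (j + 4))"
        using s(2)[of "j + 4" "j + 2"] by (simp add: add.assoc)
      show "0 < s * orientation (v $ j) (v $ (j + 2)) (v $ (j + 3))"
        using s(2)[of j "j + 2"] orientation_rotate[of "v $ (j + 2)" "v $ (j + 3)" "v $ j"]
        by (simp add: add.assoc)
    qed
  qed
qed

lemma positive_lift_configuration:
  assumes V: "positive_lift V"
  shows "configuration (invariants V) (normalized V)"
    and "\<And>j. V j \<noteq> 0" and "\<And>j. point (normalized V j) = point (V j)"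
proof -
  have e: "edge_det V j > 0" "diagonal_det V j > 0" for j using V by (auto simp: positive_lift_def)
  then have e0: "edge_det V j \<noteq> 0" for j by (metis less_irrefl)
  show V0: "V j \<noteq> 0" for j
    using e0[of "j + 1"] by (auto simp: edge_det_def triple_def add.assoc five_wrap)
  have s: "edge_det V j * edge_det V (j + 2) * edge_det V (j + 4) \<noteq> 0" for j using e0 by simp
  show "point (normalized V j) = point (V j)" for j
    unfolding normalized_def by (rule point_scale[OF s V0])
  have "invariants V j > 0" for j unfolding invariants_def using e by simp
  moreover have "edge_det (normalized V) 0 \<noteq> 0"
    unfolding edge_det_def normalized_def triple_scale
    using s[of 2] s[of 3] s[of 4] e0[of 0] by (simp add: edge_det_def)
  ultimately show "configuration (invariants V) (normalized V)"
    unfolding configuration_def using frieze_invariants[OF e0] lift_of_normalized[OF e0] by simp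
qed

section \<open>Topology of the projective plane\<close>

lemma tendsto_point:
  assumes f: "(f \<longlongrightarrow> v) F" and v: "v \<noteq> 0"
  shows "((\<lambda>x. point (f x)) \<longlongrightarrow> point v) F"
proof (rule topological_tendstoI)
  fix S assume S: "open S" "point v \<in> S"
  then have "open {v. v \<noteq> 0 \<and> point v \<in> S}" by (simp add: open_rp2_def)
  from topological_tendstoD[OF f this] v S(2)
  have "\<forall>\<^sub>F x in F. f x \<in> {v. v \<noteq> 0 \<and> point v \<in> S}" by simp
  then show "\<forall>\<^sub>F x in F. point (f x) \<in> S" by (rule eventually_mono) simp
qed

lemma line_points_point:
  assumes w: "w \<noteq> 0"
  shows "line_points (point w) = {point v | v. v \<noteq> 0 \<and> w \<bullet> v = 0}"
proof -
  have "w \<bullet> v = 0" if w': "w' \<noteq> 0" "point w = point w'" "w' \<bullet> v = 0" for w' v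
  proof -
    obtain c where "c \<noteq> 0" "w' = c *\<^sub>R w" using w'(2) point_eq_iff[OF w w'(1)] by blast
    then show ?thesis using w'(3) by simp
  qed
  then have "(\<exists>w'. w' \<noteq> 0 \<and> point w = point w' \<and> w' \<bullet> v = 0) \<longleftrightarrow> w \<bullet> v = 0" for v
    using w by blast
  then show ?thesis unfolding line_points_def by auto
qed

lemma point_in_line_iff:
  assumes w: "w \<noteq> 0" and v: "v \<noteq> 0"
  shows "point v \<in> line_points (point w) \<longleftrightarrow> w \<bullet> v = 0"
proof
  assume "point v \<in> line_points (point w)"
  then obtain u where u: "point v = point u" "u \<noteq> 0" "w \<bullet> u = 0"
    unfolding line_points_point[OF w] by blast
  then obtain c where "c \<noteq> 0" "u = c *\<^sub>R v" using point_eq_iff[OF v u(2)] by blast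
  then show "w \<bullet> v = 0" using u(3) by simp
next
  assume "w \<bullet> v = 0"
  then show "point v \<in> line_points (point w)"
    unfolding line_points_point[OF w] using v by blast
qed

lemma closed_line_points:
  assumes w: "w \<noteq> 0"
  shows "closed (line_points (point w))"
proof -
  have "{v. v \<noteq> 0 \<and> point v \<in> - line_points (point w)} = {v. w \<bullet> v \<noteq> 0}"
  proof (rule set_eqI)
    fix v show "v \<in> {v. v \<noteq> 0 \<and> point v \<in> - line_points (point w)} \<longleftrightarrow> v \<in> {v. w \<bullet> v \<noteq> 0}"
      by (cases "v = 0") (simp_all add: point_in_line_iff[OF w])
  qed
  moreover have "open {v. w \<bullet> v \<noteq> 0}" by (intro open_Collect_neq continuous_intros)
  ultimately have "open (- line_points (point w))" by (simp add: open_rp2_def)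
  then show ?thesis by (simp add: closed_def)
qed

lemma line_points_nonempty: "line_points (point w) \<noteq> {}" if w: "w \<noteq> 0" for w
proof -
  have "\<exists>v. v \<noteq> 0 \<and> w \<bullet> v = 0"
  proof (cases "w$1 = 0 \<and> w$2 = 0")
    case True
    then show ?thesis
      by (intro exI[of _ "vector [1, 0, 0]"]) (simp add: vec_eq_iff forall_3 inner_vec_def sum_3)
  next
    case False
    then show ?thesis
      by (intro exI[of _ "vector [- w$2, w$1, 0]"]) (auto simp: vec_eq_iff forall_3 inner_vec_def sum_3)
  qed
  then show ?thesis unfolding line_points_point[OF w] by blast
qed

context
  fixes d :: "rp2 \<Rightarrow> rp2 \<Rightarrow> real"
  assumes d: "Metric_space UNIV d" and top: "Metric_space.mtopology UNIV d = euclidean"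
begin

interpretation Metric_space UNIV d by (rule d)

lemma rp2_limit_iff: "((\<lambda>k. f k) \<longlonglongrightarrow> p) \<longleftrightarrow> (\<lambda>k. d (f k) p) \<longlonglongrightarrow> 0" for f :: "nat \<Rightarrow> rp2"
proof -
  have "f \<longlonglongrightarrow> p \<longleftrightarrow> limitin mtopology f p sequentially" by (simp add: top)
  also have "\<dots> \<longleftrightarrow> (\<lambda>k. d (f k) p) \<longlonglongrightarrow> 0"
    unfolding limit_metric_sequentially by (simp add: LIMSEQ_iff)
  finally show ?thesis .
qed

lemma rp2_limit_unique:
  fixes f :: "nat \<Rightarrow> rp2"
  assumes "f \<longlonglongrightarrow> p" "f \<longlonglongrightarrow> q"
  shows "p = q"
proof -
  have "limitin mtopology f p sequentially" "limitin mtopology f q sequentially"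
    using assms by (simp_all add: top)
  then show ?thesis using limitin_metric_unique by fastforce
qed

text \<open>The forward direction picks points of the line that are nearest up to 1 / (k + 1); they
  converge to p as well, and a line is closed. The equivalence later yields uniqueness of the line
  of collapse along with its existence.\<close>

lemma distance_to_line_iff:
  fixes f :: "nat \<Rightarrow> rp2"
  assumes f: "f \<longlonglongrightarrow> p" and w: "w \<noteq> 0"
  shows "(\<lambda>k. INF q\<in>line_points (point w). d (f k) q) \<longlonglongrightarrow> 0 \<longleftrightarrow> p \<in> line_points (point w)"
proof
  let ?L = "line_points (point w)"
  have bdd: "bdd_below ((\<lambda>q. d x q) ` ?L)" for x by (rule bdd_belowI[of _ 0]) auto
  have ne: "?L \<noteq> {}" by (rule line_points_nonempty[OF w])
  have nn: "0 \<le> (INF q\<in>?L. d x q)" for x by (rule cINF_greatest[OF ne]) simp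
  {
    assume p: "p \<in> ?L"
    show "(\<lambda>k. INF q\<in>?L. d (f k) q) \<longlonglongrightarrow> 0"
    proof (rule tendsto_sandwich[OF _ _ tendsto_const])
      show "(\<lambda>k. d (f k) p) \<longlonglongrightarrow> 0" using f by (simp add: rp2_limit_iff)
    qed (use nn cINF_lower[OF bdd p] in \<open>auto intro!: always_eventually\<close>)
  next
    assume L: "(\<lambda>k. INF q\<in>?L. d (f k) q) \<longlonglongrightarrow> 0"
    have "\<exists>q\<in>?L. d (f k) q < (INF q\<in>?L. d (f k) q) + 1 / real (Suc k)" for k
    proof -
      have "(INF q\<in>?L. d (f k) q) < (INF q\<in>?L. d (f k) q) + 1 / real (Suc k)" by simp
      then show ?thesis using cINF_less_iff[OF ne bdd] by blast
    qed
    then have "\<forall>k. \<exists>q. q \<in> ?L \<and> d (f k) q < (INF q\<in>?L. d (f k) q) + 1 / real (Suc k)" by blast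
    from choice[OF this] obtain q where
      q: "\<forall>k. q k \<in> ?L \<and> d (f k) (q k) < (INF q\<in>?L. d (f k) q) + 1 / real (Suc k)" ..
    have 1: "(\<lambda>k. (INF q\<in>?L. d (f k) q) + 1 / real (Suc k)) \<longlonglongrightarrow> 0 + 0"
      by (rule tendsto_add[OF L LIMSEQ_Suc[OF lim_1_over_n]])
    have 2: "(\<lambda>k. d (f k) p) \<longlonglongrightarrow> 0" using f by (simp add: rp2_limit_iff)
    have lim: "(\<lambda>k. ((INF q\<in>?L. d (f k) q) + 1 / real (Suc k)) + d (f k) p) \<longlonglongrightarrow> 0"
      using tendsto_add[OF 1 2] by simp
    have "(\<lambda>k. d (q k) p) \<longlonglongrightarrow> 0"
    proof (rule tendsto_sandwich[OF _ _ tendsto_const lim])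
      show "\<forall>\<^sub>F k in sequentially. 0 \<le> d (q k) p" by simp
      have "d (q k) p \<le> ((INF q\<in>?L. d (f k) q) + 1 / real (Suc k)) + d (f k) p" for k
      proof -
        have "d (q k) p \<le> d (q k) (f k) + d (f k) p" by (rule triangle) simp_all
        also have "d (q k) (f k) = d (f k) (q k)" by (rule commute)
        finally show ?thesis using spec[OF q, of k] by simp
      qed
      then show "\<forall>\<^sub>F k in sequentially. d (q k) p \<le> ((INF q\<in>?L. d (f k) q) + 1 / real (Suc k)) + d (f k) p"
        by simp
    qed
    then have lq: "q \<longlonglongrightarrow> p" by (simp add: rp2_limit_iff)
    show "p \<in> ?L"
      by (rule Lim_in_closed_set[OF closed_line_points[OF w] _ _ lq]) (use q in simp_all)
  }
qed

end

section \<open>Limits of orbits\<close>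

primrec frieze_orbit :: "real \<Rightarrow> (5 \<Rightarrow> real) \<Rightarrow> nat \<Rightarrow> 5 \<Rightarrow> real" where
  "frieze_orbit l z 0 = z"
| "frieze_orbit l z (Suc k) = heat_frieze l (frieze_orbit l z k)"

primrec lift_orbit :: "real \<Rightarrow> real \<Rightarrow> (5 \<Rightarrow> real) \<Rightarrow> (5 \<Rightarrow> real^3) \<Rightarrow> nat \<Rightarrow> 5 \<Rightarrow> real^3" where
  "lift_orbit l \<kappa> z V 0 = V"
| "lift_orbit l \<kappa> z V (Suc k) = heat_step l \<kappa> (frieze_orbit l z k) (lift_orbit l \<kappa> z V k)"

lemma configuration_orbit:
  assumes "l > 0" "\<kappa> \<noteq> 0" "configuration z V"
  shows "configuration (frieze_orbit l z k) (lift_orbit l \<kappa> z V k)"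
  using assms by (induction k) (auto intro: configuration_step)

lemma heat_map_orbit:
  assumes "l > 0" "\<kappa> \<noteq> 0" "configuration z V"
  shows "(heat_map l ^^ k) (\<chi> j. point (V j)) = (\<chi> j. point (lift_orbit l \<kappa> z V k j))"
  by (induction k) (simp_all add: heat_map_configuration[OF assms(1,2) configuration_orbit[OF assms]])

text \<open>The entries are squeezed between 1 / (M k - 1) and M k, and both tend to golden because
  1 / (golden - 1) = golden. One good index k is enough: \<open>local_contraction\<close> applies
  from there.\<close>

lemma frieze_orbit_golden:
  assumes l: "l > 0" and c: "configuration z V" and \<epsilon>: "\<epsilon> > 0"
  obtains k where "\<And>j. \<bar>frieze_orbit l z k j - golden\<bar> \<le> \<epsilon>"
proof -
  define K where "K = Max (range z)"
  have zp: "frieze_orbit l z k j > 0" and zf: "frieze (frieze_orbit l z k)" for k j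
    using configuration_orbit[OF l _ c, of 1 k] by (auto simp: configuration_def)
  have zK: "z j \<le> K" for j by (simp add: K_def)
  have K: "golden \<le> K"
    using frieze_golden_le[of z K] zp[of 0] zf[of 0] zK by simp
  define E where "E = edge l (\<lambda>_. K) 0"
  have E1: "E > 1"
  proof -
    have "E = 1 + (l + 4 * l^2 + (1 + l + l^2 + l^3) * K + (2 * l + l^2) * (K + K))"
      by (simp add: E_def edge_def)
    moreover have "l + 4 * l^2 + (1 + l + l^2 + l^3) * K + (2 * l + l^2) * (K + K) > 0"
      using l K golden_bounds by (intro add_pos_pos mult_pos_pos) auto
    ultimately show ?thesis by simp
  qed
  define \<rho> where "\<rho> = 1 - min 1 l / E^2"
  have "E^2 > 1" using E1 by (simp add: one_less_power)
  moreover have "0 < min 1 l" "min 1 l \<le> 1" using l by auto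
  ultimately have "0 < min 1 l / E^2" "min 1 l / E^2 \<le> 1"
    using divide_pos_pos[of "min 1 l" "E^2"] divide_le_eq_1_pos[of "E^2" "min 1 l"] by linarith+
  then have \<rho>: "0 \<le> \<rho>" "\<rho> < 1" by (simp_all add: \<rho>_def)
  define M where "M k = golden + \<rho>^k * (K - golden)" for k :: nat
  have M: "golden \<le> M k" "M k \<le> K" for k
  proof -
    show "golden \<le> M k" using \<rho> K by (simp add: M_def)
    have "\<rho>^k * (K - golden) \<le> 1 * (K - golden)" using \<rho> K by (intro mult_right_mono power_le_one) auto
    then show "M k \<le> K" by (simp add: M_def)
  qed
  have zM: "frieze_orbit l z k j \<le> M k" for k j
  proof (induction k arbitrary: j)
    case 0
    then show ?case using zK by (simp add: M_def)
  next
    case (Suc k)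
    from heat_frieze_contracts[OF l zp zf Suc M(1) M(2), of j]
    have "heat_frieze l (frieze_orbit l z k) j - golden \<le> \<rho> * (M k - golden)"
      by (simp add: \<rho>_def E_def)
    then show ?case by (simp add: M_def)
  qed
  have "(\<lambda>k. \<rho>^k) \<longlonglongrightarrow> 0" using \<rho> by (intro LIMSEQ_power_zero) simp
  then have "(\<lambda>k. \<rho>^k * (K - golden)) \<longlonglongrightarrow> 0" by (rule tendsto_mult_left_zero)
  then have lim: "M \<longlonglongrightarrow> golden"
    unfolding M_def[abs_def] by (auto intro: tendsto_eq_intros)
  have gi: "1 / (golden - 1) = golden" using golden_square golden_bounds by (simp add: field_simps power2_eq_square)
  have "(\<lambda>k. 1 / (M k - 1)) \<longlonglongrightarrow> 1 / (golden - 1)"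
    using golden_bounds by (intro tendsto_intros lim) auto
  then have lim2: "(\<lambda>k. 1 / (M k - 1)) \<longlonglongrightarrow> golden" unfolding gi .
  have "eventually (\<lambda>k. M k < golden + \<epsilon>) sequentially"
    by (rule order_tendstoD(2)[OF lim]) (use \<epsilon> in simp)
  moreover have "eventually (\<lambda>k. golden - \<epsilon> < 1 / (M k - 1)) sequentially"
    by (rule order_tendstoD(1)[OF lim2]) (use \<epsilon> in simp)
  ultimately have "eventually (\<lambda>k. M k < golden + \<epsilon> \<and> golden - \<epsilon> < 1 / (M k - 1)) sequentially"
    by (rule eventually_conj)
  then obtain k where k: "M k < golden + \<epsilon>" "golden - \<epsilon> < 1 / (M k - 1)"
    using eventually_happens' sequentially_bot by blast
  have "M k > 1" using M(1)[of k] golden_bounds by simp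
  then have "1 / (M k - 1) \<le> frieze_orbit l z k j" for j
    by (rule frieze_lower_bound[OF zp zf zM])
  then have "\<bar>frieze_orbit l z k j - golden\<bar> \<le> \<epsilon>" for j
    using k zM[of k j] by (smt (verit))
  then show thesis by (rule that)
qed

section \<open>Uniform estimates for tails of orbits\<close>

definition contracts :: "real \<Rightarrow> real \<Rightarrow> real \<Rightarrow> bool" where
  "contracts l \<theta> \<delta> \<longleftrightarrow> (\<forall>U maj z \<epsilon> i. majorant U maj \<longrightarrow> 0 \<le> \<epsilon> \<longrightarrow> \<epsilon> \<le> \<delta> \<longrightarrow>
     (\<forall>j. maj (\<lambda>x. z j x - golden) \<epsilon>) \<longrightarrow> (\<forall>x\<in>U. frieze (\<lambda>j. z j x)) \<longrightarrow>
     maj (\<lambda>x. heat_frieze l (\<lambda>j. z j x) i - golden) (\<theta> * \<epsilon>))"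

lemma contracts_exists:
  assumes l: "l > 0"
  shows "\<exists>\<theta> \<delta>. 0 < \<theta> \<and> \<theta> < 1 \<and> 0 < \<delta> \<and> contracts l \<theta> \<delta>"
proof (rule local_contraction[OF l])
  fix \<theta> \<delta> :: real
  assume H: "0 < \<theta>" "\<theta> < 1" "0 < \<delta>" and
    C: "\<And>U maj z \<epsilon> i. majorant U maj \<Longrightarrow> 0 \<le> \<epsilon> \<Longrightarrow> \<epsilon> \<le> \<delta> \<Longrightarrow> (\<And>j. maj (\<lambda>x. z j x - golden) \<epsilon>) \<Longrightarrow>
       (\<And>x. x \<in> U \<Longrightarrow> frieze (\<lambda>j. z j x)) \<Longrightarrow>
       maj (\<lambda>x. heat_frieze l (\<lambda>j. z j x) i - golden) (\<theta> * \<epsilon>)"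
  have "contracts l \<theta> \<delta>"
    unfolding contracts_def
  proof (intro allI impI)
    fix U maj and z :: "5 \<Rightarrow> coords \<Rightarrow> real" and \<epsilon> :: real and i :: 5
    assume "majorant U maj" "0 \<le> \<epsilon>" "\<epsilon> \<le> \<delta>" "\<forall>j. maj (\<lambda>x. z j x - golden) \<epsilon>" "\<forall>x\<in>U. frieze (\<lambda>j. z j x)"
    then show "maj (\<lambda>x. heat_frieze l (\<lambda>j. z j x) i - golden) (\<theta> * \<epsilon>)"
      using C[of U maj \<epsilon> z i] by simp
  qed
  then show ?thesis using H by blast
qed

definition lift_bound :: "real \<Rightarrow> real \<Rightarrow> real \<Rightarrow> real \<Rightarrow> bool" where
  "lift_bound l \<kappa> C \<delta> \<longleftrightarrow> (\<forall>U maj z x \<epsilon> B j. majorant U maj \<longrightarrow> 0 \<le> \<epsilon> \<longrightarrow> \<epsilon> \<le> \<delta> \<longrightarrow>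
     (\<forall>j. maj (\<lambda>p. z j p - golden) \<epsilon>) \<longrightarrow>
     (\<forall>p\<in>U. lift_relation (\<lambda>j. z j p) (\<lambda>j. x j p)) \<longrightarrow> (\<forall>j. maj (x j) B) \<longrightarrow>
     maj (\<lambda>p. heat_lift l \<kappa> (\<lambda>j. z j p) (\<lambda>j. x j p) j
        - (mean_eigenvalue l / \<kappa> * mean5 (\<lambda>j. x j p)
           + shape_eigenvalue l / \<kappa> * (x j p - mean5 (\<lambda>j. x j p)))) (C * \<epsilon> * B))"

lemma lift_bound_exists:
  assumes l: "l > 0" and \<kappa>: "\<kappa> \<noteq> 0"
  shows "\<exists>C \<delta>. 0 < C \<and> 0 < \<delta> \<and> lift_bound l \<kappa> C \<delta>"
proof (rule heat_lift_estimate[OF l \<kappa>])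
  fix C \<delta> :: real
  assume H: "0 < C" "0 < \<delta>" and
    E: "\<And>U maj z x \<epsilon> B j. majorant U maj \<Longrightarrow> 0 \<le> \<epsilon> \<Longrightarrow> \<epsilon> \<le> \<delta> \<Longrightarrow> (\<And>j. maj (\<lambda>p. z j p - golden) \<epsilon>) \<Longrightarrow>
       (\<And>p. p \<in> U \<Longrightarrow> lift_relation (\<lambda>j. z j p) (\<lambda>j. x j p)) \<Longrightarrow> (\<And>j. maj (x j) B) \<Longrightarrow>
       maj (\<lambda>p. heat_lift l \<kappa> (\<lambda>j. z j p) (\<lambda>j. x j p) j
          - (mean_eigenvalue l / \<kappa> * mean5 (\<lambda>j. x j p)
             + shape_eigenvalue l / \<kappa> * (x j p - mean5 (\<lambda>j. x j p)))) (C * \<epsilon> * B)"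
  have "lift_bound l \<kappa> C \<delta>"
    unfolding lift_bound_def
  proof (intro allI impI)
    fix U maj and z x :: "5 \<Rightarrow> coords \<Rightarrow> real" and \<epsilon> B :: real and j :: 5
    assume "majorant U maj" "0 \<le> \<epsilon>" "\<epsilon> \<le> \<delta>" "\<forall>j. maj (\<lambda>p. z j p - golden) \<epsilon>"
      "\<forall>p\<in>U. lift_relation (\<lambda>j. z j p) (\<lambda>j. x j p)" "\<forall>j. maj (x j) B"
    then show "maj (\<lambda>p. heat_lift l \<kappa> (\<lambda>j. z j p) (\<lambda>j. x j p) j
          - (mean_eigenvalue l / \<kappa> * mean5 (\<lambda>j. x j p)
             + shape_eigenvalue l / \<kappa> * (x j p - mean5 (\<lambda>j. x j p)))) (C * \<epsilon> * B)"
      using E[of U maj \<epsilon> z x B j] by simp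
  qed
  then show ?thesis using H by blast
qed

lemma (in majorant) tail_frieze:
  assumes c: "contracts l \<theta> \<delta>" and \<theta>: "0 < \<theta>" "\<theta> < 1" and \<epsilon>: "0 \<le> \<epsilon>" "\<epsilon> \<le> \<delta>"
    and z0: "\<And>j. maj (\<lambda>p. z 0 j p - golden) \<epsilon>"
    and step: "\<And>k j p. p \<in> U \<Longrightarrow> z (Suc k) j p = heat_frieze l (\<lambda>j. z k j p) j"
    and fr: "\<And>k p. p \<in> U \<Longrightarrow> frieze (\<lambda>j. z k j p)"
  shows "maj (\<lambda>p. z k j p - golden) (\<epsilon> * \<theta>^k)"
proof (induction k arbitrary: j)
  case 0
  then show ?case using z0 by simp
next
  case (Suc k)
  have le: "\<epsilon> * \<theta>^k \<le> \<delta>"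
    using \<epsilon> \<theta> mult_left_le[of "\<theta>^k" \<epsilon>] power_le_one[of \<theta> k] by simp
  have "maj (\<lambda>p. heat_frieze l (\<lambda>j. z k j p) j - golden) (\<theta> * (\<epsilon> * \<theta>^k))"
    using c[unfolded contracts_def, rule_format, of U maj "\<epsilon> * \<theta>^k" "z k" j] majorant_axioms le \<epsilon> \<theta> Suc fr
    by simp
  then show ?case
    by (rule maj_cong) (simp_all add: step)
qed

lemma (in majorant) tail_lift:
  fixes x z :: "nat \<Rightarrow> 5 \<Rightarrow> coords \<Rightarrow> real"
  defines "a \<equiv> \<lambda>k p. mean5 (\<lambda>j. x k j p)"
  defines "y \<equiv> \<lambda>k j p. x k j p - a k p"
  assumes c: "contracts l \<theta> \<delta>" and \<theta>: "0 < \<theta>" "\<theta> < 1" and \<epsilon>: "0 \<le> \<epsilon>" "\<epsilon> \<le> \<delta>"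
    and z0: "\<And>j. maj (\<lambda>p. z 0 j p - golden) \<epsilon>"
    and zstep: "\<And>k j p. p \<in> U \<Longrightarrow> z (Suc k) j p = heat_frieze l (\<lambda>j. z k j p) j"
    and fr: "\<And>k p. p \<in> U \<Longrightarrow> frieze (\<lambda>j. z k j p)"
    and b: "lift_bound l \<kappa> C \<gamma>" and C: "C > 0" and \<epsilon>': "\<epsilon> \<le> \<gamma>" "8 * C * \<epsilon> \<le> 1 - \<theta>"
    and ev: "\<bar>mean_eigenvalue l / \<kappa>\<bar> \<le> 1" "\<bar>shape_eigenvalue l / \<kappa>\<bar> \<le> 1"
    and rel: "\<And>k p. p \<in> U \<Longrightarrow> lift_relation (\<lambda>j. z k j p) (\<lambda>j. x k j p)"
    and xstep: "\<And>k j p. p \<in> U \<Longrightarrow> x (Suc k) j p = heat_lift l \<kappa> (\<lambda>j. z k j p) (\<lambda>j. x k j p) j"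
    and B: "maj (a 0) B" "\<And>j. maj (y 0 j) B"
  shows "maj (\<lambda>p. a (Suc k) p - mean_eigenvalue l / \<kappa> * a k p) (16 * C * \<epsilon> * B * \<theta>^k)"
    "maj (\<lambda>p. y (Suc k) j p - shape_eigenvalue l / \<kappa> * y k j p) (16 * C * \<epsilon> * B * \<theta>^k)"
proof -
  have step: "maj (\<lambda>p. x (Suc k) j p - (mean_eigenvalue l / \<kappa> * mean5 (\<lambda>j. x k j p)
      + shape_eigenvalue l / \<kappa> * (x k j p - mean5 (\<lambda>j. x k j p)))) (C * (\<epsilon> * \<theta>^k) * D)"
    if D: "\<And>j. maj (x k j) D" for k j D
  proof -
    have le: "\<epsilon> * \<theta>^k \<le> \<gamma>"
      using \<epsilon> \<epsilon>' \<theta> mult_left_le[of "\<theta>^k" \<epsilon>] power_le_one[of \<theta> k] by simp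
    have zk: "maj (\<lambda>p. z k j p - golden) (\<epsilon> * \<theta>^k)" for j
      by (rule tail_frieze[where z = z, OF c \<theta> \<epsilon> z0 zstep fr])
    have "maj (\<lambda>p. heat_lift l \<kappa> (\<lambda>j. z k j p) (\<lambda>j. x k j p) j - (mean_eigenvalue l / \<kappa> * mean5 (\<lambda>j. x k j p)
      + shape_eigenvalue l / \<kappa> * (x k j p - mean5 (\<lambda>j. x k j p)))) (C * (\<epsilon> * \<theta>^k) * D)"
      using b[unfolded lift_bound_def, rule_format, of U maj "\<epsilon> * \<theta>^k" "z k" "x k" D j]
        majorant_axioms le \<epsilon> \<theta> zk rel D by simp
    then show ?thesis by (rule maj_cong) (simp_all add: xstep)
  qed
  note pr = perturbed_recursion[of "mean_eigenvalue l / \<kappa>" "shape_eigenvalue l / \<kappa>" C \<theta> \<epsilon> x B,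
      OF ev C \<theta> \<epsilon>(1) \<epsilon>'(2) step B[unfolded y_def a_def]]
  show "maj (\<lambda>p. a (Suc k) p - mean_eigenvalue l / \<kappa> * a k p) (16 * C * \<epsilon> * B * \<theta>^k)"
    unfolding a_def by (rule pr(3))
  show "maj (\<lambda>p. y (Suc k) j p - shape_eigenvalue l / \<kappa> * y k j p) (16 * C * \<epsilon> * B * \<theta>^k)"
    unfolding y_def a_def by (rule pr(4))
qed

text \<open>Multiplication by s^k, where s * s = 1, turns the recursion with factor s into one with
  factor 1, and the increments form a geometric series.\<close>

lemma (in majorant) signed_limit:
  assumes s: "s = 1 \<or> s = (-1::real)" and \<theta>: "0 < \<theta>" "\<theta> < 1"
    and f: "\<And>k. maj (\<lambda>p. f (Suc k) p - s * f k p) (D * \<theta>^k)" and B: "maj (f 0) B"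
  shows "\<exists>g. maj g (B + D / (1 - \<theta>)) \<and>
    (\<forall>p\<in>U. (\<lambda>k. s^k * f k p) \<longlonglongrightarrow> g p \<and> \<bar>g p - f 0 p\<bar> \<le> D / (1 - \<theta>))"
proof -
  have inc: "maj (\<lambda>p. s^Suc k * f (Suc k) p - s^k * f k p) (D * \<theta>^k)" for k
  proof -
    have m: "maj (\<lambda>p. s^Suc k * (f (Suc k) p - s * f k p)) (\<bar>s^Suc k\<bar> * (D * \<theta>^k))"
      by (rule maj_cmult[OF f])
    have ab: "\<bar>s^Suc k\<bar> * (D * \<theta>^k) \<le> D * \<theta>^k" using s by (auto simp: power_abs)
    have ss: "s * s = 1" using s by auto
    have eq: "s^Suc k * (f (Suc k) p - s * f k p) = s^Suc k * f (Suc k) p - s^k * f k p" for p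
    proof -
      have "s^Suc k * (f (Suc k) p - s * f k p) = s^Suc k * f (Suc k) p - (s * s) * (s^k * f k p)"
        by (simp add: algebra_simps)
      then show ?thesis unfolding ss by simp
    qed
    show ?thesis by (rule maj_cong[OF m ab eq])
  qed
  have K: "(\<lambda>k. D * \<theta>^k) sums (D * (1 / (1 - \<theta>)))"
    using \<theta> by (intro sums_mult geometric_sums) simp
  then have Ks: "summable (\<lambda>k. D * \<theta>^k)" "suminf (\<lambda>k. D * \<theta>^k) = D / (1 - \<theta>)"
    by (simp_all add: sums_iff)
  have B': "maj (\<lambda>p. s^0 * f 0 p) B" using B by simp
  show ?thesis
  proof (rule maj_limit[where f = "\<lambda>k p. s^k * f k p", OF B' inc Ks(1)])
    fix g assume g: "maj (\<lambda>x. g x - s^0 * f 0 x) (suminf (\<lambda>k. D * \<theta>^k))"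
      "maj g (B + suminf (\<lambda>k. D * \<theta>^k))" "\<And>x. x \<in> U \<Longrightarrow> (\<lambda>n. s^n * f n x) \<longlonglongrightarrow> g x"
    show ?thesis
    proof (intro exI[of _ g] conjI ballI)
      show "maj g (B + D / (1 - \<theta>))" using g(2) by (simp add: Ks)
      fix p assume p: "p \<in> U"
      show "(\<lambda>n. s^n * f n p) \<longlonglongrightarrow> g p" by (rule g(3)[OF p])
      show "\<bar>g p - f 0 p\<bar> \<le> D / (1 - \<theta>)" using maj_eval[OF g(1) p] by (simp add: Ks)
    qed
  qed
qed

lemma decaying_limit:
  fixes f :: "nat \<Rightarrow> real"
  assumes s: "\<bar>s\<bar> < 1" and \<theta>: "0 < \<theta>" "\<theta> < 1" and f: "\<And>k. \<bar>f (Suc k) - s * f k\<bar> \<le> D * \<theta>^k"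
  shows "f \<longlonglongrightarrow> 0"
proof -
  define q where "q = max \<bar>s\<bar> \<theta>"
  define t where "t = (1 + q) / 2"
  have q: "\<bar>s\<bar> \<le> q" "\<theta> \<le> q" "0 < q" "q < 1" using s \<theta> by (auto simp: q_def)
  have t: "q < t" "0 < t" "t < 1" using q by (auto simp: t_def)
  have D: "D \<ge> 0" using f[of 0] by (simp add: order_trans[OF abs_ge_zero])
  \<comment> \<open>The smallest convenient value for which |f k| \<le> K * t^k passes to the next
    index, that is q * K + D \<le> t * K. The rate t exceeds both |s| and \<theta>, so that their
    coincidence causes no trouble.\<close>
  define K where "K = \<bar>f 0\<bar> + D / (t - q)"
  have K: "q * K + D \<le> t * K"
  proof -
    have "D = (t - q) * (D / (t - q))" using t by simp
    also have "\<dots> \<le> (t - q) * K" unfolding K_def using t by (intro mult_left_mono) auto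
    finally show ?thesis by (simp add: algebra_simps)
  qed
  have K0: "K \<ge> 0" unfolding K_def using D t by simp
  have "\<bar>f k\<bar> \<le> K * t^k" for k
  proof (induction k)
    case 0
    then show ?case using D t by (simp add: K_def)
  next
    case (Suc k)
    have "\<bar>f (Suc k)\<bar> \<le> \<bar>s * f k\<bar> + D * \<theta>^k" using f[of k] by linarith
    also have "\<dots> \<le> q * (K * t^k) + D * t^k"
      unfolding abs_mult using Suc q t \<theta> D K0 by (intro add_mono mult_mono power_mono) auto
    also have "\<dots> = (q * K + D) * t^k" by (simp add: algebra_simps)
    also have "\<dots> \<le> t * K * t^k" using K t by (intro mult_right_mono) auto
    finally show ?case by (simp add: algebra_simps)
  qed
  moreover have "(\<lambda>k. K * t^k) \<longlonglongrightarrow> 0"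
    using t by (intro tendsto_mult_right_zero LIMSEQ_power_zero) simp
  ultimately show ?thesis
    by (intro Lim_null_comparison[of f "\<lambda>k. K * t^k"]) (auto intro: always_eventually)
qed

text \<open>The numerical constants leave room for the approximation errors in the independence argument
  below.\<close>

definition tail_parameters :: "real \<Rightarrow> real \<Rightarrow> real \<Rightarrow> real \<Rightarrow> real \<Rightarrow> bool" where
  "tail_parameters l \<kappa> \<theta> C \<epsilon> \<longleftrightarrow> 0 < \<theta> \<and> \<theta> < 1 \<and> 0 < C \<and> 0 < \<epsilon> \<and> \<epsilon> \<le> 1 / 400 \<and> 1280 * C * \<epsilon> \<le> 1 - \<theta> \<and>
     contracts l \<theta> \<epsilon> \<and> lift_bound l \<kappa> C \<epsilon>"

lemma tail_parameters_exist:
  assumes l: "l > 0" and \<kappa>: "\<kappa> \<noteq> 0"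
  shows "\<exists>\<theta> C \<epsilon>. tail_parameters l \<kappa> \<theta> C \<epsilon>"
proof -
  obtain \<theta> \<delta> where t: "0 < \<theta>" "\<theta> < 1" "0 < \<delta>" "contracts l \<theta> \<delta>" using contracts_exists[OF l] by blast
  obtain C \<gamma> where c: "0 < C" "0 < \<gamma>" "lift_bound l \<kappa> C \<gamma>" using lift_bound_exists[OF l \<kappa>] by blast
  define \<epsilon> where "\<epsilon> = min (min \<delta> \<gamma>) (min (1 / 400) ((1 - \<theta>) / (1280 * C)))"
  have e: "0 < \<epsilon>" "\<epsilon> \<le> \<delta>" "\<epsilon> \<le> \<gamma>" "\<epsilon> \<le> 1 / 400" "\<epsilon> \<le> (1 - \<theta>) / (1280 * C)"
    using t c by (auto simp: \<epsilon>_def)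
  have "1280 * C * \<epsilon> \<le> 1 - \<theta>" using e(5) c(1) by (simp add: field_simps)
  moreover have "contracts l \<theta> \<epsilon>"
    unfolding contracts_def
  proof (intro allI impI)
    fix U maj and z :: "5 \<Rightarrow> coords \<Rightarrow> real" and \<eta> :: real and i :: 5
    assume "majorant U maj" "0 \<le> \<eta>" "\<eta> \<le> \<epsilon>" "\<forall>j. maj (\<lambda>x. z j x - golden) \<eta>" "\<forall>x\<in>U. frieze (\<lambda>j. z j x)"
    then show "maj (\<lambda>x. heat_frieze l (\<lambda>j. z j x) i - golden) (\<theta> * \<eta>)"
      using t(4)[unfolded contracts_def, rule_format, of U maj \<eta> z i] e(2) by simp
  qed
  moreover have "lift_bound l \<kappa> C \<epsilon>"
    unfolding lift_bound_def
  proof (intro allI impI)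
    fix U maj and z x :: "5 \<Rightarrow> coords \<Rightarrow> real" and \<eta> B :: real and j :: 5
    assume "majorant U maj" "0 \<le> \<eta>" "\<eta> \<le> \<epsilon>" "\<forall>j. maj (\<lambda>p. z j p - golden) \<eta>"
      "\<forall>p\<in>U. lift_relation (\<lambda>j. z j p) (\<lambda>j. x j p)" "\<forall>j. maj (x j) B"
    then show "maj (\<lambda>p. heat_lift l \<kappa> (\<lambda>j. z j p) (\<lambda>j. x j p) j
          - (mean_eigenvalue l / \<kappa> * mean5 (\<lambda>j. x j p)
             + shape_eigenvalue l / \<kappa> * (x j p - mean5 (\<lambda>j. x j p)))) (C * \<eta> * B)"
      using c(3)[unfolded lift_bound_def, rule_format, of U maj \<eta> z x B j] e(3) by simp
  qed
  ultimately have "tail_parameters l \<kappa> \<theta> C \<epsilon>"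
    unfolding tail_parameters_def using t c e by simp
  then show ?thesis by blast
qed

lemma lift_relation_orbit:
  assumes "l > 0" "\<kappa> \<noteq> 0" "configuration z V"
  shows "lift_relation (frieze_orbit l z k) (\<lambda>j. \<eta> \<bullet> lift_orbit l \<kappa> z V k j)"
proof -
  have V: "lift_of (frieze_orbit l z k) (lift_orbit l \<kappa> z V k)"
    using configuration_orbit[OF assms, of k] by (simp add: configuration_def)
  show ?thesis
    unfolding lift_relation_def
  proof
    fix j
    from arg_cong[OF V[unfolded lift_of_def, rule_format, of j], of "\<lambda>v. \<eta> \<bullet> v"]
    show "\<eta> \<bullet> lift_orbit l \<kappa> z V k (j + 1) - frieze_orbit l z k (j + 1) * (\<eta> \<bullet> lift_orbit l \<kappa> z V k (j + 2))
      + frieze_orbit l z k (j + 4) * (\<eta> \<bullet> lift_orbit l \<kappa> z V k (j + 3)) - \<eta> \<bullet> lift_orbit l \<kappa> z V k (j + 4) = 0"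
      by (simp add: inner_simps)
  qed
qed

lemma heat_step_inner: "\<eta> \<bullet> heat_step l \<kappa> z V j = heat_lift l \<kappa> z (\<lambda>j. \<eta> \<bullet> V j) j"
  by (simp add: heat_step_def heat_lift_def heat_vector_def heat_combination_def inner_simps)

lemma tail_scalar:
  fixes \<eta> :: "real^3"
  assumes l: "l > 0" and \<kappa>: "\<kappa> \<noteq> 0" and p: "tail_parameters l \<kappa> \<theta> C \<epsilon>"
    and ev: "\<bar>mean_eigenvalue l / \<kappa>\<bar> \<le> 1" "\<bar>shape_eigenvalue l / \<kappa>\<bar> \<le> 1"
    and c: "configuration z V" and z: "\<And>j. \<bar>z j - golden\<bar> \<le> \<epsilon>"
  defines "x \<equiv> \<lambda>k j. \<eta> \<bullet> lift_orbit l \<kappa> z V k j"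
  assumes B: "\<bar>mean5 (x 0)\<bar> \<le> B" "\<And>j. \<bar>x 0 j - mean5 (x 0)\<bar> \<le> B"
  shows "\<bar>mean5 (x (Suc k)) - mean_eigenvalue l / \<kappa> * mean5 (x k)\<bar> \<le> 16 * C * \<epsilon> * B * \<theta>^k"
    "\<bar>(x (Suc k) j - mean5 (x (Suc k))) - shape_eigenvalue l / \<kappa> * (x k j - mean5 (x k))\<bar> \<le> 16 * C * \<epsilon> * B * \<theta>^k"
proof -
  \<comment> \<open>The tuples are regarded as constant functions on \<open>coords\<close>, and the
    absolute value at any point serves as the majorant.\<close>
  let ?w = "0 :: coords"
  interpret majorant "{?w}" "\<lambda>f C. \<bar>f ?w\<bar> \<le> C" by (rule majorant_point)
  have P: "0 < \<theta>" "\<theta> < 1" "0 < C" "0 \<le> \<epsilon>" "\<epsilon> \<le> \<epsilon>" "8 * C * \<epsilon> \<le> 1 - \<theta>" "contracts l \<theta> \<epsilon>" "lift_bound l \<kappa> C \<epsilon>"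
  proof -
    have "8 * C * \<epsilon> \<le> 1280 * C * \<epsilon>" using p by (simp add: tail_parameters_def)
    then show "8 * C * \<epsilon> \<le> 1 - \<theta>" using p unfolding tail_parameters_def by linarith
  qed (use p in \<open>simp_all add: tail_parameters_def\<close>)
  note t = tail_lift[where x = "\<lambda>k j _. x k j" and z = "\<lambda>k j _. frieze_orbit l z k j" and B = B,
      OF P(7,1,2,4,5) _ _ _ P(8,3,5,6) ev]
  have fr: "frieze (frieze_orbit l z k)" for k
    using configuration_orbit[OF l \<kappa> c, of k] by (simp add: configuration_def)
  have rel: "lift_relation (frieze_orbit l z k) (x k)" for k
    unfolding x_def by (rule lift_relation_orbit[OF l \<kappa> c])
  have xs: "x (Suc k) j = heat_lift l \<kappa> (frieze_orbit l z k) (x k) j" for k j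
    unfolding x_def by (simp add: heat_step_inner)
  show "\<bar>mean5 (x (Suc k)) - mean_eigenvalue l / \<kappa> * mean5 (x k)\<bar> \<le> 16 * C * \<epsilon> * B * \<theta>^k"
    by (rule t(1)) (use z fr rel xs B in simp_all)
  show "\<bar>(x (Suc k) j - mean5 (x (Suc k))) - shape_eigenvalue l / \<kappa> * (x k j - mean5 (x k))\<bar> \<le> 16 * C * \<epsilon> * B * \<theta>^k"
    by (rule t(2)) (use z fr rel xs B in simp_all)
qed

text \<open>Any three values on consecutive vertices are taken by some covector; near the regular class the
  other two values are then close to those of a tuple that satisfies the limiting relations.\<close>

lemma covector_exists:
  assumes c: "configuration z V" and z: "\<And>j. \<bar>z j - golden\<bar> \<le> \<epsilon>" and \<epsilon>: "\<epsilon> \<le> 1 / 400"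
    and m: "lift_relation (\<lambda>_. golden) m" and R: "\<And>j. \<bar>m j\<bar> \<le> R"
  shows "\<exists>\<eta>. \<forall>j. \<bar>\<eta> \<bullet> V j - m j\<bar> \<le> 10 * \<epsilon> * R"
proof -
  have t: "triple (V 1) (V 2) (V 3) \<noteq> 0"
    using configuration_edge_det[OF c, of 4] by (simp add: edge_det_def five_numerals)
  have e0: "0 \<le> \<epsilon>" using z[of 0] by simp
  have R0: "0 \<le> R" using R[of 0] by simp
  obtain M :: "real^3^3" where M: "M *v (V 1) = axis 1 1" "M *v (V 2) = axis 2 1" "M *v (V 3) = axis 3 1"
  proof -
    have "triple (axis 1 1) (axis 2 1) (axis 3 1) \<noteq> 0" by (simp add: triple_def axis_def)
    from frame_matrix[OF t this] that show thesis by blast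
  qed
  define \<eta> where "\<eta> = transpose M *v (vector [m 1, m 2, m 3])"
  have \<eta>: "\<eta> \<bullet> v = vector [m 1, m 2, m 3] \<bullet> (M *v v)" for v
    unfolding \<eta>_def by (simp add: dot_lmul_matrix matrix_transpose_mul inner_commute flip: vector_transpose_matrix)
  have x: "\<eta> \<bullet> V 1 = m 1" "\<eta> \<bullet> V 2 = m 2" "\<eta> \<bullet> V 3 = m 3"
    unfolding \<eta> M by (simp_all add: inner_axis)
  define x4 x0 where "x4 = \<eta> \<bullet> V 4" and "x0 = \<eta> \<bullet> V 0"
  have r: "m 1 - golden * m 2 + golden * m 3 - m 4 = 0" "m 2 - golden * m 3 + golden * m 4 - m 0 = 0"
    using m[unfolded lift_relation_def, rule_format, of 0] m[unfolded lift_relation_def, rule_format, of 1]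
    by (simp_all add: five_numerals)
  have V: "lift_of z V" using c by (simp add: configuration_def)
  have "\<eta> \<bullet> (V 1 - z 1 *\<^sub>R V 2 + z 4 *\<^sub>R V 3 - V 4) = 0" "\<eta> \<bullet> (V 2 - z 2 *\<^sub>R V 3 + z 0 *\<^sub>R V 4 - V 0) = 0"
    using V[unfolded lift_of_def, rule_format, of 0] V[unfolded lift_of_def, rule_format, of 1]
    by (simp_all add: five_numerals)
  then have v: "m 1 - z 1 * m 2 + z 4 * m 3 - x4 = 0" "m 2 - z 2 * m 3 + z 0 * x4 - x0 = 0"
    by (simp_all add: inner_simps x x4_def x0_def)
  have prod: "\<bar>(z i - golden) * m j\<bar> \<le> \<epsilon> * R" for i j
    unfolding abs_mult by (intro mult_mono z R) (use e0 in auto)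
  have "x4 - m 4 = - ((z 1 - golden) * m 2) + (z 4 - golden) * m 3" using v(1) r(1) by (simp add: algebra_simps)
  then have d4: "\<bar>x4 - m 4\<bar> \<le> 2 * (\<epsilon> * R)" using prod[of 1 2] prod[of 4 3] by linarith
  have "x0 - m 0 = - ((z 2 - golden) * m 3) + z 0 * (x4 - m 4) + (z 0 - golden) * m 4"
    using v(2) r(2) by (simp add: algebra_simps)
  moreover have "\<bar>z 0 * (x4 - m 4)\<bar> \<le> 2 * (2 * (\<epsilon> * R))"
    unfolding abs_mult
  proof (intro mult_mono d4)
    show "\<bar>z 0\<bar> \<le> 2" using z[of 0] \<epsilon> golden_bounds by linarith
  qed auto
  \<comment> \<open>The value at vertex 4 is off by at most 2 * \<epsilon> * R; since z 0 \<le> 2 it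
    contributes twice this at vertex 0, next to two errors of size \<epsilon> * R. The 10 in the
    statement leaves some slack.\<close>
  ultimately have d0: "\<bar>x0 - m 0\<bar> \<le> 6 * (\<epsilon> * R)" using prod[of 2 3] prod[of 0 4] by linarith
  have eR: "0 \<le> \<epsilon> * R" using e0 R0 by simp
  have "\<bar>\<eta> \<bullet> V j - m j\<bar> \<le> 10 * \<epsilon> * R" for j
    using exhaust_5[of j] d4 d0 x eR by (auto simp: x4_def x0_def mult.assoc)
  then show ?thesis by blast
qed

definition vmean :: "(5 \<Rightarrow> real^3) \<Rightarrow> real^3" where
  "vmean X = (1 / 5) *\<^sub>R (X 0 + X 1 + X 2 + X 3 + X 4)"

lemma inner_vmean: "\<eta> \<bullet> vmean X = mean5 (\<lambda>j. \<eta> \<bullet> X j)"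
  by (simp add: vmean_def mean5_def inner_simps)

lemma mean5_close:
  assumes "\<And>j. \<bar>x j - m j\<bar> \<le> e"
  shows "\<bar>mean5 x - mean5 m\<bar> \<le> e"
proof -
  have "x j - m j \<le> e" "m j - x j \<le> e" for j using assms[of j] by linarith+
  from this[of 0] this[of 1] this[of 2] this[of 3] this[of 4]
  have "mean5 x - mean5 m \<le> e" "mean5 m - mean5 x \<le> e"
    unfolding mean5_def by (simp_all add: field_simps)
  then show ?thesis by linarith
qed

lemma vector_limit:
  fixes F :: "nat \<Rightarrow> real^3"
  assumes "\<And>\<eta>. \<exists>g. (\<lambda>k. \<eta> \<bullet> F k) \<longlonglongrightarrow> g"
  shows "\<exists>A. F \<longlonglongrightarrow> A"
proof -
  have "\<forall>c. \<exists>g. (\<lambda>k. axis c 1 \<bullet> F k) \<longlonglongrightarrow> g" using assms by blast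
  then obtain g where "\<And>c. (\<lambda>k. axis c 1 \<bullet> F k) \<longlonglongrightarrow> g c" by metis
  then have "F \<longlonglongrightarrow> (\<chi> c. g c)" by (intro vec_tendstoI) (simp add: inner_axis')
  then show ?thesis by blast
qed

context
  fixes l \<kappa> \<theta> C \<epsilon> :: real and z :: "5 \<Rightarrow> real" and V :: "5 \<Rightarrow> real^3"
  assumes l: "l > 0" and \<kappa>: "\<kappa> \<noteq> 0" and p: "tail_parameters l \<kappa> \<theta> C \<epsilon>"
    and ev: "\<bar>mean_eigenvalue l / \<kappa>\<bar> \<le> 1" "\<bar>shape_eigenvalue l / \<kappa>\<bar> \<le> 1"
    and c: "configuration z V" and z: "\<And>j. \<bar>z j - golden\<bar> \<le> \<epsilon>"
begin

lemma tail_bounds: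
  "0 < \<theta>" "\<theta> < 1" "0 < C" "0 < \<epsilon>" "\<epsilon> \<le> 1 / 400" "1280 * C * \<epsilon> \<le> 1 - \<theta>"
  using p by (simp_all add: tail_parameters_def)

text \<open>As 1280 = 16 * 80, the total of all later increments, 16 * C * \<epsilon> * B / (1 -
  \<theta>), is at most B / 80.\<close>

lemma scalar_limit:
  assumes s: "s = 1 \<or> s = (-1::real)" and f: "\<And>k. \<bar>f (Suc k) - s * f k\<bar> \<le> 16 * C * \<epsilon> * B * \<theta>^k"
  shows "\<exists>g. (\<lambda>k. s^k * f k) \<longlonglongrightarrow> g \<and> \<bar>g - f 0\<bar> \<le> B / 80"
proof -
  let ?w = "0 :: coords"
  interpret majorant "{?w}" "\<lambda>f C. \<bar>f ?w\<bar> \<le> C" by (rule majorant_point)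
  have B: "0 \<le> B"
  proof -
    have "0 \<le> 16 * C * \<epsilon> * B * \<theta>^0" using f[of 0] by (rule order_trans[OF abs_ge_zero])
    then have "0 \<le> (C * \<epsilon>) * B" by (simp add: mult_ac)
    moreover have "0 < C * \<epsilon>" using tail_bounds by simp
    ultimately show ?thesis by (simp add: zero_le_mult_iff)
  qed
  from signed_limit[OF s tail_bounds(1,2), of "\<lambda>k _. f k" "16 * C * \<epsilon> * B" "\<bar>f 0\<bar>"] f
  obtain g where g: "(\<lambda>k. s^k * f k) \<longlonglongrightarrow> g" "\<bar>g - f 0\<bar> \<le> 16 * C * \<epsilon> * B / (1 - \<theta>)" by auto
  have "16 * C * \<epsilon> * B / (1 - \<theta>) = (1280 * C * \<epsilon>) * (B / 80) / (1 - \<theta>)" by simp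
  also have "\<dots> \<le> (1 - \<theta>) * (B / 80) / (1 - \<theta>)"
    using tail_bounds B by (intro divide_right_mono mult_right_mono) auto
  also have "\<dots> = B / 80" by (rule nonzero_mult_div_cancel_left) (use tail_bounds in simp)
  finally show ?thesis using g by (intro exI[of _ g]) simp
qed

lemma initial_bounds:
  obtains B where "\<bar>mean5 (\<lambda>j. \<eta> \<bullet> V j)\<bar> \<le> B" "\<And>j. \<bar>\<eta> \<bullet> V j - mean5 (\<lambda>j. \<eta> \<bullet> V j)\<bar> \<le> B"
proof (rule that)
  let ?B = "\<bar>mean5 (\<lambda>j. \<eta> \<bullet> V j)\<bar> + (\<Sum>j\<in>UNIV. \<bar>\<eta> \<bullet> V j - mean5 (\<lambda>j. \<eta> \<bullet> V j)\<bar>)"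
  show "\<bar>mean5 (\<lambda>j. \<eta> \<bullet> V j)\<bar> \<le> ?B" by (simp add: sum_nonneg)
  fix j
  have "\<bar>\<eta> \<bullet> V j - mean5 (\<lambda>j. \<eta> \<bullet> V j)\<bar> \<le> (\<Sum>j\<in>UNIV. \<bar>\<eta> \<bullet> V j - mean5 (\<lambda>j. \<eta> \<bullet> V j)\<bar>)"
    by (rule member_le_sum) auto
  then show "\<bar>\<eta> \<bullet> V j - mean5 (\<lambda>j. \<eta> \<bullet> V j)\<bar> \<le> ?B" by simp
qed

text \<open>With \<epsilon> \<le> 1 / 400 the closeness is at most R / 40. The bound 4 * R is fed
  into \<open>scalar_limit\<close>, which adds at most R / 20, so the total errors in
  \<open>mean_limit\<close> and \<open>shape_limit\<close> stay within R / 10.\<close>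

lemma target_bounds:
  assumes close: "\<And>j. \<bar>\<eta> \<bullet> V j - m j\<bar> \<le> 10 * \<epsilon> * R" and R: "\<And>j. \<bar>m j\<bar> \<le> R"
  shows "\<bar>mean5 (\<lambda>j. \<eta> \<bullet> V j)\<bar> \<le> 4 * R" "\<And>j. \<bar>\<eta> \<bullet> V j - mean5 (\<lambda>j. \<eta> \<bullet> V j)\<bar> \<le> 4 * R"
    "\<bar>mean5 (\<lambda>j. \<eta> \<bullet> V j) - mean5 m\<bar> \<le> R / 40"
    "\<And>j. \<bar>(\<eta> \<bullet> V j - mean5 (\<lambda>j. \<eta> \<bullet> V j)) - (m j - mean5 m)\<bar> \<le> R / 20"
proof -
  have R0: "0 \<le> R" using R[of 0] by simp
  have "\<epsilon> * R \<le> 1 / 400 * R" using tail_bounds R0 by (intro mult_right_mono) auto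
  then have cl: "\<bar>\<eta> \<bullet> V j - m j\<bar> \<le> R / 40" for j using close[of j] by simp
  have x: "\<bar>\<eta> \<bullet> V j\<bar> \<le> 2 * R" for j using cl[of j] R[of j] R0 by linarith
  have m0: "\<bar>mean5 (\<lambda>j. \<eta> \<bullet> V j)\<bar> \<le> 2 * R"
    using mean5_close[of "\<lambda>j. \<eta> \<bullet> V j" "\<lambda>_. 0" "2 * R"] x by (simp add: mean5_def)
  then show "\<bar>mean5 (\<lambda>j. \<eta> \<bullet> V j)\<bar> \<le> 4 * R" using R0 by linarith
  show "\<bar>\<eta> \<bullet> V j - mean5 (\<lambda>j. \<eta> \<bullet> V j)\<bar> \<le> 4 * R" for j using m0 x[of j] by linarith
  show mc: "\<bar>mean5 (\<lambda>j. \<eta> \<bullet> V j) - mean5 m\<bar> \<le> R / 40" by (rule mean5_close[OF cl])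
  show "\<bar>(\<eta> \<bullet> V j - mean5 (\<lambda>j. \<eta> \<bullet> V j)) - (m j - mean5 m)\<bar> \<le> R / 20" for j
    using mc cl[of j] by linarith
qed

text \<open>Convergence is shown separately for each covector. The second clause says that the limit
  pairs with a test covector almost like the mean of the tuple prescribed for it; nonvanishing and
  independence of limits are read off from such pairings.\<close>

lemma mean_limit:
  assumes s: "s = 1 \<or> s = (-1::real)" and \<alpha>: "mean_eigenvalue l / \<kappa> = s"
  shows "\<exists>A. (\<lambda>k. s^k *\<^sub>R vmean (lift_orbit l \<kappa> z V k)) \<longlonglongrightarrow> A \<and>
    (\<forall>\<eta> m R. (\<forall>j. \<bar>\<eta> \<bullet> V j - m j\<bar> \<le> 10 * \<epsilon> * R) \<longrightarrow> (\<forall>j. \<bar>m j\<bar> \<le> R) \<longrightarrow> \<bar>\<eta> \<bullet> A - mean5 m\<bar> \<le> R / 10)"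
proof -
  have lim: "\<exists>g. (\<lambda>k. \<eta> \<bullet> (s^k *\<^sub>R vmean (lift_orbit l \<kappa> z V k))) \<longlonglongrightarrow> g \<and> \<bar>g - mean5 (\<lambda>j. \<eta> \<bullet> V j)\<bar> \<le> B / 80"
    if B: "\<bar>mean5 (\<lambda>j. \<eta> \<bullet> V j)\<bar> \<le> B" "\<And>j. \<bar>\<eta> \<bullet> V j - mean5 (\<lambda>j. \<eta> \<bullet> V j)\<bar> \<le> B" for \<eta> B
  proof -
    have "\<bar>mean5 (\<lambda>j. \<eta> \<bullet> lift_orbit l \<kappa> z V (Suc k) j) - s * mean5 (\<lambda>j. \<eta> \<bullet> lift_orbit l \<kappa> z V k j)\<bar> \<le> 16 * C * \<epsilon> * B * \<theta>^k" for k
      using tail_scalar(1)[OF l \<kappa> p ev c z, of \<eta> B k] B unfolding \<alpha> by simp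
    from scalar_limit[of s "\<lambda>k. mean5 (\<lambda>j. \<eta> \<bullet> lift_orbit l \<kappa> z V k j)", OF s this]
    show ?thesis by (simp add: inner_vmean)
  qed
  have "\<exists>g. (\<lambda>k. \<eta> \<bullet> (s^k *\<^sub>R vmean (lift_orbit l \<kappa> z V k))) \<longlonglongrightarrow> g" for \<eta>
  proof -
    obtain B where "\<bar>mean5 (\<lambda>j. \<eta> \<bullet> V j)\<bar> \<le> B" "\<And>j. \<bar>\<eta> \<bullet> V j - mean5 (\<lambda>j. \<eta> \<bullet> V j)\<bar> \<le> B"
      using initial_bounds[of \<eta>] by blast
    from lim[OF this] show ?thesis by blast
  qed
  from vector_limit[OF this] obtain A where A: "(\<lambda>k. s^k *\<^sub>R vmean (lift_orbit l \<kappa> z V k)) \<longlonglongrightarrow> A" ..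
  show ?thesis
  proof (intro exI[of _ A] conjI allI impI A)
    fix \<eta> m R
    assume m: "\<forall>j. \<bar>\<eta> \<bullet> V j - m j\<bar> \<le> 10 * \<epsilon> * R" "\<forall>j. \<bar>m j\<bar> \<le> R"
    note t = target_bounds[of \<eta> m R, OF m[rule_format]]
    obtain g where g: "(\<lambda>k. \<eta> \<bullet> (s^k *\<^sub>R vmean (lift_orbit l \<kappa> z V k))) \<longlonglongrightarrow> g" "\<bar>g - mean5 (\<lambda>j. \<eta> \<bullet> V j)\<bar> \<le> 4 * R / 80"
      using lim[OF t(1,2)] by blast
    have "g = \<eta> \<bullet> A" by (rule LIMSEQ_unique[OF g(1) tendsto_inner[OF tendsto_const A]])
    then show "\<bar>\<eta> \<bullet> A - mean5 m\<bar> \<le> R / 10" using g(2) t(3) by linarith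
  qed
qed

lemma shape_limit:
  assumes s: "s = 1 \<or> s = (-1::real)" and \<beta>: "shape_eigenvalue l / \<kappa> = s"
  shows "\<exists>Y. (\<lambda>k. s^k *\<^sub>R (lift_orbit l \<kappa> z V k j - vmean (lift_orbit l \<kappa> z V k))) \<longlonglongrightarrow> Y \<and>
    (\<forall>\<eta> m R. (\<forall>j. \<bar>\<eta> \<bullet> V j - m j\<bar> \<le> 10 * \<epsilon> * R) \<longrightarrow> (\<forall>j. \<bar>m j\<bar> \<le> R) \<longrightarrow> \<bar>\<eta> \<bullet> Y - (m j - mean5 m)\<bar> \<le> R / 10)"
proof -
  have lim: "\<exists>g. (\<lambda>k. \<eta> \<bullet> (s^k *\<^sub>R (lift_orbit l \<kappa> z V k j - vmean (lift_orbit l \<kappa> z V k)))) \<longlonglongrightarrow> g \<and> \<bar>g - (\<eta> \<bullet> V j - mean5 (\<lambda>j. \<eta> \<bullet> V j))\<bar> \<le> B / 80"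
    if B: "\<bar>mean5 (\<lambda>j. \<eta> \<bullet> V j)\<bar> \<le> B" "\<And>j. \<bar>\<eta> \<bullet> V j - mean5 (\<lambda>j. \<eta> \<bullet> V j)\<bar> \<le> B" for \<eta> B
  proof -
    have "\<bar>(\<eta> \<bullet> lift_orbit l \<kappa> z V (Suc k) j - mean5 (\<lambda>j. \<eta> \<bullet> lift_orbit l \<kappa> z V (Suc k) j)) - s * (\<eta> \<bullet> lift_orbit l \<kappa> z V k j - mean5 (\<lambda>j. \<eta> \<bullet> lift_orbit l \<kappa> z V k j))\<bar>
        \<le> 16 * C * \<epsilon> * B * \<theta>^k" for k
      using tail_scalar(2)[OF l \<kappa> p ev c z, of \<eta> B k j] B unfolding \<beta> by simp
    from scalar_limit[of s "\<lambda>k. \<eta> \<bullet> lift_orbit l \<kappa> z V k j - mean5 (\<lambda>j. \<eta> \<bullet> lift_orbit l \<kappa> z V k j)", OF s this]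
    show ?thesis by (simp add: inner_vmean inner_diff_right)
  qed
  have "\<exists>g. (\<lambda>k. \<eta> \<bullet> (s^k *\<^sub>R (lift_orbit l \<kappa> z V k j - vmean (lift_orbit l \<kappa> z V k)))) \<longlonglongrightarrow> g" for \<eta>
  proof -
    obtain B where "\<bar>mean5 (\<lambda>j. \<eta> \<bullet> V j)\<bar> \<le> B" "\<And>j. \<bar>\<eta> \<bullet> V j - mean5 (\<lambda>j. \<eta> \<bullet> V j)\<bar> \<le> B"
      using initial_bounds[of \<eta>] by blast
    from lim[OF this] show ?thesis by blast
  qed
  from vector_limit[OF this] obtain Y where Y: "(\<lambda>k. s^k *\<^sub>R (lift_orbit l \<kappa> z V k j - vmean (lift_orbit l \<kappa> z V k))) \<longlonglongrightarrow> Y" ..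
  show ?thesis
  proof (intro exI[of _ Y] conjI allI impI Y)
    fix \<eta> m R
    assume m: "\<forall>j. \<bar>\<eta> \<bullet> V j - m j\<bar> \<le> 10 * \<epsilon> * R" "\<forall>j. \<bar>m j\<bar> \<le> R"
    note t = target_bounds[of \<eta> m R, OF m[rule_format]]
    obtain g where g: "(\<lambda>k. \<eta> \<bullet> (s^k *\<^sub>R (lift_orbit l \<kappa> z V k j - vmean (lift_orbit l \<kappa> z V k)))) \<longlonglongrightarrow> g"
      "\<bar>g - (\<eta> \<bullet> V j - mean5 (\<lambda>j. \<eta> \<bullet> V j))\<bar> \<le> 4 * R / 80"
      using lim[OF t(1,2)] by blast
    have "g = \<eta> \<bullet> Y" by (rule LIMSEQ_unique[OF g(1) tendsto_inner[OF tendsto_const Y]])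
    then show "\<bar>\<eta> \<bullet> Y - (m j - mean5 m)\<bar> \<le> R / 10" using g(2) t(4)[of j] by linarith
  qed
qed

lemma mean_decay:
  assumes "\<bar>mean_eigenvalue l / \<kappa>\<bar> < 1"
  shows "(\<lambda>k. vmean (lift_orbit l \<kappa> z V k)) \<longlonglongrightarrow> 0"
proof (rule vec_tendstoI)
  fix i :: 3
  obtain B where B: "\<bar>mean5 (\<lambda>j. axis i 1 \<bullet> V j)\<bar> \<le> B" "\<And>j. \<bar>axis i 1 \<bullet> V j - mean5 (\<lambda>j. axis i 1 \<bullet> V j)\<bar> \<le> B"
    using initial_bounds[of "axis i 1"] by blast
  have "(\<lambda>k. mean5 (\<lambda>j. axis i 1 \<bullet> lift_orbit l \<kappa> z V k j)) \<longlonglongrightarrow> 0"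
    by (rule decaying_limit[OF assms tail_bounds(1,2), of _ "16 * C * \<epsilon> * B"])
      (use tail_scalar(1)[OF l \<kappa> p ev c z, of "axis i 1" B] B in simp)
  then show "(\<lambda>k. vmean (lift_orbit l \<kappa> z V k) $ i) \<longlonglongrightarrow> 0 $ i"
    unfolding inner_vmean[symmetric] by (simp add: inner_axis')
qed

lemma shape_decay:
  assumes "\<bar>shape_eigenvalue l / \<kappa>\<bar> < 1"
  shows "(\<lambda>k. lift_orbit l \<kappa> z V k j - vmean (lift_orbit l \<kappa> z V k)) \<longlonglongrightarrow> 0"
proof (rule vec_tendstoI)
  fix i :: 3
  obtain B where B: "\<bar>mean5 (\<lambda>j. axis i 1 \<bullet> V j)\<bar> \<le> B" "\<And>j. \<bar>axis i 1 \<bullet> V j - mean5 (\<lambda>j. axis i 1 \<bullet> V j)\<bar> \<le> B"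
    using initial_bounds[of "axis i 1"] by blast
  have "(\<lambda>k. axis i 1 \<bullet> lift_orbit l \<kappa> z V k j - mean5 (\<lambda>j. axis i 1 \<bullet> lift_orbit l \<kappa> z V k j)) \<longlonglongrightarrow> 0"
    by (rule decaying_limit[OF assms tail_bounds(1,2), of _ "16 * C * \<epsilon> * B"])
      (use tail_scalar(2)[OF l \<kappa> p ev c z, of "axis i 1" B _ j] B in simp)
  then show "(\<lambda>k. (lift_orbit l \<kappa> z V k j - vmean (lift_orbit l \<kappa> z V k)) $ i) \<longlonglongrightarrow> 0 $ i"
    unfolding inner_vmean[symmetric] by (simp add: inner_axis')
qed

end

lemma frieze_orbit_add: "frieze_orbit l z (k + n) = frieze_orbit l (frieze_orbit l z k) n"
  by (induction n) simp_all

lemma lift_orbit_add: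
  "lift_orbit l \<kappa> z V (k + n) = lift_orbit l \<kappa> (frieze_orbit l z k) (lift_orbit l \<kappa> z V k) n"
  by (induction n) (simp_all add: frieze_orbit_add)

text \<open>Tuples satisfying the limiting relations, parametrized by their mean and by two entries of the
  mean-free part.\<close>

definition regular_tuple :: "real \<Rightarrow> real \<Rightarrow> real \<Rightarrow> 5 \<Rightarrow> real" where
  "regular_tuple \<gamma> \<alpha> \<beta> j = \<gamma> + (if j = 0 then \<alpha> else if j = 1 then \<beta> else if j = 2 then (golden - 1) * \<beta> - \<alpha>
     else if j = 3 then - (golden - 1) * (\<alpha> + \<beta>) else (golden - 1) * \<alpha> - \<beta>)"

lemma regular_tuple_simps:
  "regular_tuple \<gamma> \<alpha> \<beta> 0 = \<gamma> + \<alpha>" "regular_tuple \<gamma> \<alpha> \<beta> 1 = \<gamma> + \<beta>"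
  "regular_tuple \<gamma> \<alpha> \<beta> 2 = \<gamma> + ((golden - 1) * \<beta> - \<alpha>)"
  "regular_tuple \<gamma> \<alpha> \<beta> 3 = \<gamma> + (- (golden - 1) * (\<alpha> + \<beta>))"
  "regular_tuple \<gamma> \<alpha> \<beta> 4 = \<gamma> + ((golden - 1) * \<alpha> - \<beta>)"
  by (simp_all add: regular_tuple_def)

lemma regular_tuple_relation: "lift_relation (\<lambda>_. golden) (regular_tuple \<gamma> \<alpha> \<beta>)"
proof -
  let ?r = "regular_tuple \<gamma> \<alpha> \<beta>"
  have "?r 1 - golden * ?r 2 + golden * ?r 3 - ?r 4 = 0" "?r 2 - golden * ?r 3 + golden * ?r 4 - ?r 0 = 0"
    "?r 3 - golden * ?r 4 + golden * ?r 0 - ?r 1 = 0" "?r 4 - golden * ?r 0 + golden * ?r 1 - ?r 2 = 0"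
    "?r 0 - golden * ?r 1 + golden * ?r 2 - ?r 3 = 0"
    unfolding regular_tuple_simps using golden_square by (simp_all add: algebra_simps power2_eq_square) algebra+
  then have "?r (j + 1) - golden * ?r (j + 2) + golden * ?r (j + 3) - ?r (j + 4) = 0" for j
    using exhaust_5[of j] by (auto simp: five_numerals)
  then show ?thesis unfolding lift_relation_def by blast
qed

lemma mean5_regular_tuple: "mean5 (regular_tuple \<gamma> \<alpha> \<beta>) = \<gamma>"
  unfolding mean5_def regular_tuple_simps by (simp add: algebra_simps)

lemma abs_regular_tuple_le: "\<bar>regular_tuple \<gamma> \<alpha> \<beta> j\<bar> \<le> \<bar>\<gamma>\<bar> + \<bar>\<alpha>\<bar> + \<bar>\<beta>\<bar>"
proof -
  have g: "0 \<le> golden - 1" "golden - 1 \<le> 1" using golden_bounds by auto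
  have p: "\<bar>(golden - 1) * t\<bar> \<le> \<bar>t\<bar>" for t
    using mult_right_mono[OF g(2), of "\<bar>t\<bar>"] g(1) by (simp add: abs_mult)
  define a b c where "a = (golden - 1) * \<alpha>" and "b = (golden - 1) * \<beta>" and "c = (golden - 1) * (\<alpha> + \<beta>)"
  have "\<bar>a\<bar> \<le> \<bar>\<alpha>\<bar>" "\<bar>b\<bar> \<le> \<bar>\<beta>\<bar>" "\<bar>c\<bar> \<le> \<bar>\<alpha> + \<beta>\<bar>" unfolding a_def b_def c_def by (rule p)+
  then have "\<bar>\<gamma> + \<alpha>\<bar> \<le> \<bar>\<gamma>\<bar> + \<bar>\<alpha>\<bar> + \<bar>\<beta>\<bar>" "\<bar>\<gamma> + \<beta>\<bar> \<le> \<bar>\<gamma>\<bar> + \<bar>\<alpha>\<bar> + \<bar>\<beta>\<bar>"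
    "\<bar>\<gamma> + (b - \<alpha>)\<bar> \<le> \<bar>\<gamma>\<bar> + \<bar>\<alpha>\<bar> + \<bar>\<beta>\<bar>" "\<bar>\<gamma> + - c\<bar> \<le> \<bar>\<gamma>\<bar> + \<bar>\<alpha>\<bar> + \<bar>\<beta>\<bar>"
    "\<bar>\<gamma> + (a - \<beta>)\<bar> \<le> \<bar>\<gamma>\<bar> + \<bar>\<alpha>\<bar> + \<bar>\<beta>\<bar>"
    by linarith+
  then have "\<bar>regular_tuple \<gamma> \<alpha> \<beta> 0\<bar> \<le> \<bar>\<gamma>\<bar> + \<bar>\<alpha>\<bar> + \<bar>\<beta>\<bar>" "\<bar>regular_tuple \<gamma> \<alpha> \<beta> 1\<bar> \<le> \<bar>\<gamma>\<bar> + \<bar>\<alpha>\<bar> + \<bar>\<beta>\<bar>"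
    "\<bar>regular_tuple \<gamma> \<alpha> \<beta> 2\<bar> \<le> \<bar>\<gamma>\<bar> + \<bar>\<alpha>\<bar> + \<bar>\<beta>\<bar>" "\<bar>regular_tuple \<gamma> \<alpha> \<beta> 3\<bar> \<le> \<bar>\<gamma>\<bar> + \<bar>\<alpha>\<bar> + \<bar>\<beta>\<bar>"
    "\<bar>regular_tuple \<gamma> \<alpha> \<beta> 4\<bar> \<le> \<bar>\<gamma>\<bar> + \<bar>\<alpha>\<bar> + \<bar>\<beta>\<bar>"
    unfolding regular_tuple_simps mult_minus_left a_def[symmetric] b_def[symmetric] c_def[symmetric] .
  then show ?thesis using exhaust_5[of j] by auto
qed

text \<open>Solutions of the limiting relation are constants plus tuples of a single Fourier
  frequency, as golden - 1 = 2 * cos (2 * pi / 5). So the mean-free part is an affine image of a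
  regular pentagon.\<close>

lemma lift_relation_golden_shape:
  assumes r: "lift_relation (\<lambda>_. golden) x"
  shows "(x (j + 1) - mean5 x) + (x (j + 4) - mean5 x) = (golden - 1) * (x j - mean5 x)"
proof -
  define x0 x1 x2 x3 x4 where "x0 = x j" and "x1 = x (j + 1)" and "x2 = x (j + 2)"
    and "x3 = x (j + 3)" and "x4 = x (j + 4)"
  note xd = x0_def[symmetric] x1_def[symmetric] x2_def[symmetric] x3_def[symmetric] x4_def[symmetric]
  have R: "x2 - golden * x3 + golden * x4 - x0 = 0" "x0 - golden * x1 + golden * x2 - x3 = 0"
    using r[unfolded lift_relation_def, rule_format, of "j + 1"] r[unfolded lift_relation_def, rule_format, of "j + 4"]
    by (simp_all add: add.assoc five_wrap xd)
  have a: "5 * mean5 x = x0 + x1 + x2 + x3 + x4" unfolding mean5_shift[of x j] xd by simp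
  have "5 * ((x1 - mean5 x) + (x4 - mean5 x)) = 5 * ((golden - 1) * (x0 - mean5 x))"
    using R a golden_square by algebra
  then show ?thesis unfolding xd by simp
qed

lemma lift_of_golden_shape:
  assumes "lift_of (\<lambda>_. golden) L"
  shows "(L (j + 1) - vmean L) + (L (j + 4) - vmean L) = (golden - 1) *\<^sub>R (L j - vmean L)"
proof -
  have "(vmean L) $ c = mean5 (\<lambda>j. L j $ c)" for c by (simp add: vmean_def mean5_def)
  then show ?thesis
    unfolding vec_eq_iff
    using lift_relation_golden_shape[of "\<lambda>j. L j $ c" j for c] assms unfolding lift_of_component by simp
qed

section \<open>The three regimes of the lifted orbit\<close>

lemma mean_eigenvalue_pos: "l > 0 \<Longrightarrow> mean_eigenvalue l > 0"
  unfolding mean_eigenvalue_def using golden_bounds by (intro add_pos_pos mult_pos_pos) auto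

lemma shape_eigenvalue_neg: "l > 0 \<Longrightarrow> shape_eigenvalue l < 0"
proof -
  assume "l > 0"
  then have "0 < golden * l" using golden_bounds by (intro mult_pos_pos) auto
  then show ?thesis by (simp add: shape_eigenvalue_def)
qed

lemma eigenvalue_sum: "mean_eigenvalue l + shape_eigenvalue l = golden - l"
  unfolding mean_eigenvalue_def shape_eigenvalue_def using golden_square by algebra

lemma tendsto_vmean: "(\<And>j. (\<lambda>k. X k j) \<longlonglongrightarrow> L j) \<Longrightarrow> (\<lambda>k. vmean (X k)) \<longlonglongrightarrow> vmean L"
  unfolding vmean_def by (intro tendsto_intros)

lemma lift_of_limit:
  assumes X: "\<And>j. (\<lambda>k. X k j) \<longlonglongrightarrow> L j" and z: "\<And>j. (\<lambda>k. z k j) \<longlonglongrightarrow> golden" and r: "\<And>k. lift_of (z k) (X k)"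
  shows "lift_of (\<lambda>_. golden) L"
  unfolding lift_of_def
proof
  fix j
  have "(\<lambda>k. X k (j + 1) - z k (j + 1) *\<^sub>R X k (j + 2) + z k (j + 4) *\<^sub>R X k (j + 3) - X k (j + 4))
    \<longlonglongrightarrow> L (j + 1) - golden *\<^sub>R L (j + 2) + golden *\<^sub>R L (j + 3) - L (j + 4)"
    by (intro tendsto_intros X z)
  moreover have "X k (j + 1) - z k (j + 1) *\<^sub>R X k (j + 2) + z k (j + 4) *\<^sub>R X k (j + 3) - X k (j + 4) = 0" for k
    using r[of k] by (simp add: lift_of_def)
  ultimately show "L (j + 1) - golden *\<^sub>R L (j + 2) + golden *\<^sub>R L (j + 3) - L (j + 4) = 0"
    by (simp add: LIMSEQ_const_iff)
qed

lemma frieze_orbit_tendsto: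
  assumes l: "l > 0" and c: "configuration z V"
  shows "(\<lambda>k. frieze_orbit l z k j) \<longlonglongrightarrow> golden"
proof -
  obtain \<theta> \<delta> where t: "0 < \<theta>" "\<theta> < 1" "0 < \<delta>" "contracts l \<theta> \<delta>" using contracts_exists[OF l] by blast
  obtain k0 where k0: "\<And>j. \<bar>frieze_orbit l z k0 j - golden\<bar> \<le> \<delta>"
    using frieze_orbit_golden[OF l c t(3)] by blast
  have one: "(1::real) \<noteq> 0" by simp
  let ?w = "0 :: coords"
  interpret majorant "{?w}" "\<lambda>f C. \<bar>f ?w\<bar> \<le> C" by (rule majorant_point)
  have fr: "frieze (frieze_orbit l z k)" for k
    using configuration_orbit[OF l one c, of k] by (simp add: configuration_def)
  have d: "0 \<le> \<delta>" "\<delta> \<le> \<delta>" using t by auto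
  have "\<bar>frieze_orbit l z (k0 + k) j - golden\<bar> \<le> \<delta> * \<theta>^k" for k
    using tail_frieze[where z = "\<lambda>k j _. frieze_orbit l z (k0 + k) j", OF t(4,1,2) d, of k j] k0 fr by simp
  moreover have "(\<lambda>k. \<delta> * \<theta>^k) \<longlonglongrightarrow> 0"
    using t by (intro tendsto_mult_right_zero LIMSEQ_power_zero) simp
  ultimately have "(\<lambda>k. frieze_orbit l z (k0 + k) j - golden) \<longlonglongrightarrow> 0"
    by (intro Lim_null_comparison[of "\<lambda>k. frieze_orbit l z (k0 + k) j - golden" "\<lambda>k. \<delta> * \<theta>^k"])
      (auto intro: always_eventually)
  then have "(\<lambda>k. frieze_orbit l z (k + k0) j) \<longlonglongrightarrow> golden"
    by (simp add: LIM_zero_iff add.commute)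
  then show ?thesis by (rule LIMSEQ_offset)
qed

lemma orbit_tail:
  assumes l: "l > 0" and \<kappa>: "\<kappa> \<noteq> 0" and c: "configuration z V" and p: "tail_parameters l \<kappa> \<theta> C \<epsilon>"
  obtains k where "configuration (frieze_orbit l z k) (lift_orbit l \<kappa> z V k)"
    "\<And>j. \<bar>frieze_orbit l z k j - golden\<bar> \<le> \<epsilon>"
proof -
  have "\<epsilon> > 0" using p by (simp add: tail_parameters_def)
  then obtain k where "\<And>j. \<bar>frieze_orbit l z k j - golden\<bar> \<le> \<epsilon>"
    using frieze_orbit_golden[OF l c] by blast
  then show thesis using configuration_orbit[OF l \<kappa> c] that by blast
qed

text \<open>The eigenvalues have opposite signs and sum golden - l > 0, so after division by the
  mean eigenvalue the shape eigenvalue has modulus less than 1: deviations die out and the mean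
  converges. A covector nearly equal to 1 on all vertices takes a value of at least 9 / 10 on the
  limit, which is therefore nonzero.\<close>

lemma point_case:
  assumes l: "l > 0" "l < golden" and c: "configuration z V"
  shows "\<exists>A. A \<noteq> 0 \<and> (\<forall>j. (\<lambda>k. lift_orbit l (mean_eigenvalue l) z V k j) \<longlonglongrightarrow> A)"
proof -
  let ?\<kappa> = "mean_eigenvalue l"
  have \<kappa>0: "?\<kappa> > 0" using mean_eigenvalue_pos[OF l(1)] .
  then have \<kappa>: "?\<kappa> \<noteq> 0" by simp
  have b: "\<bar>shape_eigenvalue l / ?\<kappa>\<bar> < 1"
    using eigenvalue_sum[of l] shape_eigenvalue_neg[OF l(1)] l(2) \<kappa>0 by (simp add: abs_less_iff field_simps)
  have ev: "\<bar>mean_eigenvalue l / ?\<kappa>\<bar> \<le> 1" "\<bar>shape_eigenvalue l / ?\<kappa>\<bar> \<le> 1" using \<kappa> b by simp_all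
  have one: "mean_eigenvalue l / ?\<kappa> = 1" using \<kappa> by simp
  obtain \<theta> C \<epsilon> where p: "tail_parameters l ?\<kappa> \<theta> C \<epsilon>" using tail_parameters_exist[OF l(1) \<kappa>] by blast
  obtain k0 where k0: "configuration (frieze_orbit l z k0) (lift_orbit l ?\<kappa> z V k0)"
    "\<And>j. \<bar>frieze_orbit l z k0 j - golden\<bar> \<le> \<epsilon>" using orbit_tail[OF l(1) \<kappa> c p] by blast
  have e: "\<epsilon> \<le> 1 / 400" using p by (simp add: tail_parameters_def)
  let ?z = "frieze_orbit l z k0" and ?V = "lift_orbit l ?\<kappa> z V k0"
  let ?X = "\<lambda>k. lift_orbit l ?\<kappa> ?z ?V k"
  obtain A where A: "(\<lambda>k. 1^k *\<^sub>R vmean (?X k)) \<longlonglongrightarrow> A"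
    and Am: "\<forall>\<eta> m R. (\<forall>j. \<bar>\<eta> \<bullet> ?V j - m j\<bar> \<le> 10 * \<epsilon> * R) \<longrightarrow> (\<forall>j. \<bar>m j\<bar> \<le> R) \<longrightarrow> \<bar>\<eta> \<bullet> A - mean5 m\<bar> \<le> R / 10"
    using mean_limit[OF l(1) \<kappa> p ev k0, of 1] one by blast
  let ?m = "regular_tuple 1 0 0"
  have mR: "\<bar>?m j\<bar> \<le> 1" for j using abs_regular_tuple_le[of 1 0 0 j] by simp
  obtain \<eta> where \<eta>: "\<forall>j. \<bar>\<eta> \<bullet> ?V j - ?m j\<bar> \<le> 10 * \<epsilon> * 1"
    using covector_exists[OF k0 e regular_tuple_relation mR] by blast
  have "\<bar>\<eta> \<bullet> A - mean5 ?m\<bar> \<le> 1 / 10" using Am \<eta> mR by blast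
  then have "A \<noteq> 0" unfolding mean5_regular_tuple by auto
  moreover have "(\<lambda>k. lift_orbit l ?\<kappa> z V k j) \<longlonglongrightarrow> A" for j
  proof -
    have "(\<lambda>k. vmean (?X k) + (?X k j - vmean (?X k))) \<longlonglongrightarrow> A + 0"
      using A by (intro tendsto_add shape_decay[OF l(1) \<kappa> p ev k0 b]) simp
    then have "(\<lambda>k. lift_orbit l ?\<kappa> z V (k + k0) j) \<longlonglongrightarrow> A"
      by (simp add: lift_orbit_add add.commute[of _ k0])
    then show ?thesis by (rule LIMSEQ_offset)
  qed
  ultimately show ?thesis by blast
qed

text \<open>Now the mean dies out and the deviations converge. For independence, a vanishing
  combination with coefficients \<alpha>, \<beta> is paired with a covector whose values on Y 0 and
  Y 1 are \<alpha> and \<beta> up to R / 10. This gives 10 * (\<alpha>^2 + \<beta>^2) \<le> R^2,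
  whereas R^2 \<le> 2 * (\<alpha>^2 + \<beta>^2).\<close>

lemma line_case:
  assumes l: "l > golden" and c: "configuration z V"
  shows "\<exists>Y. (\<forall>j. (\<lambda>k. lift_orbit l (shape_eigenvalue l) z V k j) \<longlonglongrightarrow> Y j) \<and>
    (\<forall>j. Y (j + 1) + Y (j + 4) = (golden - 1) *\<^sub>R Y j) \<and>
    (\<forall>\<alpha> \<beta>. \<alpha> *\<^sub>R Y 0 + \<beta> *\<^sub>R Y 1 = 0 \<longrightarrow> \<alpha> = 0 \<and> \<beta> = 0)"
proof -
  have l0: "l > 0" using l golden_bounds by simp
  let ?\<kappa> = "shape_eigenvalue l"
  have \<kappa>0: "?\<kappa> < 0" using shape_eigenvalue_neg[OF l0] .
  then have \<kappa>: "?\<kappa> \<noteq> 0" by simp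
  have b: "\<bar>mean_eigenvalue l / ?\<kappa>\<bar> < 1"
    using eigenvalue_sum[of l] mean_eigenvalue_pos[OF l0] l \<kappa>0 by (simp add: abs_less_iff field_simps)
  have ev: "\<bar>mean_eigenvalue l / ?\<kappa>\<bar> \<le> 1" "\<bar>shape_eigenvalue l / ?\<kappa>\<bar> \<le> 1" using \<kappa> b by simp_all
  have one: "shape_eigenvalue l / ?\<kappa> = 1" using \<kappa> by simp
  obtain \<theta> C \<epsilon> where p: "tail_parameters l ?\<kappa> \<theta> C \<epsilon>" using tail_parameters_exist[OF l0 \<kappa>] by blast
  obtain k0 where k0: "configuration (frieze_orbit l z k0) (lift_orbit l ?\<kappa> z V k0)"
    "\<And>j. \<bar>frieze_orbit l z k0 j - golden\<bar> \<le> \<epsilon>" using orbit_tail[OF l0 \<kappa> c p] by blast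
  have e: "\<epsilon> \<le> 1 / 400" using p by (simp add: tail_parameters_def)
  let ?z = "frieze_orbit l z k0" and ?V = "lift_orbit l ?\<kappa> z V k0"
  let ?X = "\<lambda>k. lift_orbit l ?\<kappa> ?z ?V k"
  have "\<forall>j. \<exists>Y. (\<lambda>k. 1^k *\<^sub>R (?X k j - vmean (?X k))) \<longlonglongrightarrow> Y \<and>
    (\<forall>\<eta> m R. (\<forall>j. \<bar>\<eta> \<bullet> ?V j - m j\<bar> \<le> 10 * \<epsilon> * R) \<longrightarrow> (\<forall>j. \<bar>m j\<bar> \<le> R) \<longrightarrow> \<bar>\<eta> \<bullet> Y - (m j - mean5 m)\<bar> \<le> R / 10)"
    using shape_limit[OF l0 \<kappa> p ev k0, of 1] one by blast
  from choice[OF this] obtain Y where Y: "\<forall>j. (\<lambda>k. 1^k *\<^sub>R (?X k j - vmean (?X k))) \<longlonglongrightarrow> Y j \<and>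
    (\<forall>\<eta> m R. (\<forall>j. \<bar>\<eta> \<bullet> ?V j - m j\<bar> \<le> 10 * \<epsilon> * R) \<longrightarrow> (\<forall>j. \<bar>m j\<bar> \<le> R) \<longrightarrow> \<bar>\<eta> \<bullet> Y j - (m j - mean5 m)\<bar> \<le> R / 10)" ..
  have dec: "(\<lambda>k. vmean (?X k)) \<longlonglongrightarrow> 0" by (rule mean_decay[OF l0 \<kappa> p ev k0 b])
  have Xl: "(\<lambda>k. lift_orbit l ?\<kappa> z V k j) \<longlonglongrightarrow> Y j" for j
  proof -
    have "(\<lambda>k. vmean (?X k) + (?X k j - vmean (?X k))) \<longlonglongrightarrow> 0 + Y j"
      using Y by (intro tendsto_add dec) simp
    then have "(\<lambda>k. lift_orbit l ?\<kappa> z V (k + k0) j) \<longlonglongrightarrow> Y j"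
      by (simp add: lift_orbit_add add.commute[of _ k0])
    then show ?thesis by (rule LIMSEQ_offset)
  qed
  have rel: "lift_of (\<lambda>_. golden) Y"
  proof (rule lift_of_limit[OF Xl frieze_orbit_tendsto[OF l0 c]])
    show "lift_of (frieze_orbit l z k) (lift_orbit l ?\<kappa> z V k)" for k
      using configuration_orbit[OF l0 \<kappa> c, of k] by (simp add: configuration_def)
  qed
  have "(\<lambda>k. vmean (lift_orbit l ?\<kappa> z V k)) \<longlonglongrightarrow> vmean Y" by (rule tendsto_vmean[OF Xl])
  from LIMSEQ_ignore_initial_segment[OF this, of k0]
  have "(\<lambda>k. vmean (?X k)) \<longlonglongrightarrow> vmean Y" by (simp add: lift_orbit_add add.commute[of _ k0])
  then have m0: "vmean Y = 0" using dec by (rule LIMSEQ_unique)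
  have "Y (j + 1) + Y (j + 4) = (golden - 1) *\<^sub>R Y j" for j
    using lift_of_golden_shape[OF rel, of j] by (simp add: m0)
  moreover have "\<alpha> = 0 \<and> \<beta> = 0" if dep: "\<alpha> *\<^sub>R Y 0 + \<beta> *\<^sub>R Y 1 = 0" for \<alpha> \<beta>
  proof -
    define R where "R = \<bar>\<alpha>\<bar> + \<bar>\<beta>\<bar>"
    let ?m = "regular_tuple 0 \<alpha> \<beta>"
    have mR: "\<bar>?m j\<bar> \<le> R" for j using abs_regular_tuple_le[of 0 \<alpha> \<beta> j] by (simp add: R_def)
    obtain \<eta> where \<eta>: "\<forall>j. \<bar>\<eta> \<bullet> ?V j - ?m j\<bar> \<le> 10 * \<epsilon> * R"
      using covector_exists[OF k0 e regular_tuple_relation mR] by blast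
    have cl: "\<bar>\<eta> \<bullet> Y j - ?m j\<bar> \<le> R / 10" for j
      using spec[OF Y, of j] \<eta> mR mean5_regular_tuple[of 0 \<alpha> \<beta>] by fastforce
    define d0 d1 where "d0 = \<eta> \<bullet> Y 0 - \<alpha>" and "d1 = \<eta> \<bullet> Y 1 - \<beta>"
    have d: "\<bar>d0\<bar> \<le> R / 10" "\<bar>d1\<bar> \<le> R / 10"
      using cl[of 0] cl[of 1] by (simp_all add: regular_tuple_simps d0_def d1_def)
    have "\<eta> \<bullet> (\<alpha> *\<^sub>R Y 0 + \<beta> *\<^sub>R Y 1) = 0" unfolding dep by simp
    then have s: "\<alpha>^2 + \<beta>^2 = - (\<alpha> * d0) - \<beta> * d1"
      by (simp add: inner_simps d0_def d1_def algebra_simps power2_eq_square)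
    have "- (\<alpha> * d0) \<le> \<bar>\<alpha>\<bar> * (R / 10)"
      using mult_left_mono[OF d(1), of "\<bar>\<alpha>\<bar>"] abs_ge_minus_self[of "\<alpha> * d0"] by (simp add: abs_mult)
    moreover have "- (\<beta> * d1) \<le> \<bar>\<beta>\<bar> * (R / 10)"
      using mult_left_mono[OF d(2), of "\<bar>\<beta>\<bar>"] abs_ge_minus_self[of "\<beta> * d1"] by (simp add: abs_mult)
    ultimately have "10 * (\<alpha>^2 + \<beta>^2) \<le> (\<bar>\<alpha>\<bar> + \<bar>\<beta>\<bar>) * R" using s by (simp add: algebra_simps)
    also have "\<dots> = \<alpha>^2 + \<beta>^2 + 2 * (\<bar>\<alpha>\<bar> * \<bar>\<beta>\<bar>)"
      by (simp add: R_def algebra_simps power2_eq_square)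
    also have "2 * (\<bar>\<alpha>\<bar> * \<bar>\<beta>\<bar>) \<le> \<alpha>^2 + \<beta>^2"
      using sum_squares_bound[of "\<bar>\<alpha>\<bar>" "\<bar>\<beta>\<bar>"] by (simp add: mult.assoc)
    finally have "\<alpha>^2 + \<beta>^2 \<le> 0" by simp
    then show ?thesis by (simp add: sum_power2_le_zero_iff)
  qed
  ultimately show ?thesis using Xl by blast
qed

text \<open>Here the scaled eigenvalues are 1 and -1: the mean converges and the deviation
  alternates in sign, hence the limits A + Y j and A - Y j. Independence is shown by the same
  duality with three coefficients, where R^2 \<le> 3 * (\<gamma>^2 + \<alpha>^2 + \<beta>^2)
  contradicts the factor 10 unless all are zero.\<close>

lemma balanced_case:
  assumes l: "l = golden" and c: "configuration z V"
  shows "\<exists>A Y. (\<forall>j. (\<lambda>k. lift_orbit l (mean_eigenvalue l) z V (2 * k) j) \<longlonglongrightarrow> A + Y j \<and>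
      (\<lambda>k. lift_orbit l (mean_eigenvalue l) z V (2 * k + 1) j) \<longlonglongrightarrow> A - Y j) \<and>
    (\<forall>j. Y (j + 1) + Y (j + 4) = (golden - 1) *\<^sub>R Y j) \<and>
    (\<forall>\<gamma> \<alpha> \<beta>. \<gamma> *\<^sub>R A + \<alpha> *\<^sub>R Y 0 + \<beta> *\<^sub>R Y 1 = 0 \<longrightarrow> \<gamma> = 0 \<and> \<alpha> = 0 \<and> \<beta> = 0)"
proof -
  have l0: "l > 0" using l golden_bounds by simp
  let ?\<kappa> = "mean_eigenvalue l"
  have \<kappa>0: "?\<kappa> > 0" using mean_eigenvalue_pos[OF l0] .
  then have \<kappa>: "?\<kappa> \<noteq> 0" by simp
  have b: "shape_eigenvalue l / ?\<kappa> = -1"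
    using eigenvalue_sum[of l] l \<kappa>0 by (simp add: field_simps)
  have one: "mean_eigenvalue l / ?\<kappa> = 1" using \<kappa> by simp
  have ev: "\<bar>mean_eigenvalue l / ?\<kappa>\<bar> \<le> 1" "\<bar>shape_eigenvalue l / ?\<kappa>\<bar> \<le> 1" unfolding b one by simp_all
  obtain \<theta> C \<epsilon> where p: "tail_parameters l ?\<kappa> \<theta> C \<epsilon>" using tail_parameters_exist[OF l0 \<kappa>] by blast
  obtain k0 where k0: "configuration (frieze_orbit l z k0) (lift_orbit l ?\<kappa> z V k0)"
    "\<And>j. \<bar>frieze_orbit l z k0 j - golden\<bar> \<le> \<epsilon>" using orbit_tail[OF l0 \<kappa> c p] by blast
  have e: "\<epsilon> \<le> 1 / 400" using p by (simp add: tail_parameters_def)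
  let ?z = "frieze_orbit l z k0" and ?V = "lift_orbit l ?\<kappa> z V k0"
  let ?X = "\<lambda>k. lift_orbit l ?\<kappa> ?z ?V k"
  obtain A where A: "(\<lambda>k. 1^k *\<^sub>R vmean (?X k)) \<longlonglongrightarrow> A"
    and Am: "\<forall>\<eta> m R. (\<forall>j. \<bar>\<eta> \<bullet> ?V j - m j\<bar> \<le> 10 * \<epsilon> * R) \<longrightarrow> (\<forall>j. \<bar>m j\<bar> \<le> R) \<longrightarrow> \<bar>\<eta> \<bullet> A - mean5 m\<bar> \<le> R / 10"
    using mean_limit[OF l0 \<kappa> p ev k0, of 1] one by blast
  have "\<forall>j. \<exists>Y. (\<lambda>k. (-1)^k *\<^sub>R (?X k j - vmean (?X k))) \<longlonglongrightarrow> Y \<and>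
    (\<forall>\<eta> m R. (\<forall>j. \<bar>\<eta> \<bullet> ?V j - m j\<bar> \<le> 10 * \<epsilon> * R) \<longrightarrow> (\<forall>j. \<bar>m j\<bar> \<le> R) \<longrightarrow> \<bar>\<eta> \<bullet> Y - (m j - mean5 m)\<bar> \<le> R / 10)"
    using shape_limit[OF l0 \<kappa> p ev k0, of "-1"] b by blast
  from choice[OF this] obtain Y' where Y': "\<forall>j. (\<lambda>k. (-1)^k *\<^sub>R (?X k j - vmean (?X k))) \<longlonglongrightarrow> Y' j \<and>
    (\<forall>\<eta> m R. (\<forall>j. \<bar>\<eta> \<bullet> ?V j - m j\<bar> \<le> 10 * \<epsilon> * R) \<longrightarrow> (\<forall>j. \<bar>m j\<bar> \<le> R) \<longrightarrow> \<bar>\<eta> \<bullet> Y' j - (m j - mean5 m)\<bar> \<le> R / 10)" ..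
  let ?Z = "lift_orbit l ?\<kappa> z V"
  \<comment> \<open>The tail starts at k0, so its alternating sign differs from that of the whole
    orbit by this factor. The test tuple below carries the same factor.\<close>
  define s where "s = (-1::real)^k0"
  have ss: "s * s = 1" "s = 1 \<or> s = -1" unfolding s_def by (auto simp: minus_one_power_iff)
  define Y where "Y j = s *\<^sub>R Y' j" for j
  have Aall: "(\<lambda>k. vmean (?Z k)) \<longlonglongrightarrow> A"
    by (rule LIMSEQ_offset[of _ k0]) (use A in \<open>simp add: lift_orbit_add add.commute[of _ k0]\<close>)
  have Yall: "(\<lambda>k. (-1)^k *\<^sub>R (?Z k j - vmean (?Z k))) \<longlonglongrightarrow> Y j" for j
  proof (rule LIMSEQ_offset[of _ k0])
    have "(\<lambda>k. s *\<^sub>R ((-1)^k *\<^sub>R (?X k j - vmean (?X k)))) \<longlonglongrightarrow> s *\<^sub>R Y' j"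
      using Y' by (intro tendsto_scaleR tendsto_const) simp
    then show "(\<lambda>k. (-1)^(k + k0) *\<^sub>R (?Z (k + k0) j - vmean (?Z (k + k0)))) \<longlonglongrightarrow> Y j"
      by (simp add: lift_orbit_add add.commute[of _ k0] power_add s_def Y_def)
  qed
  have dbl: "filterlim (\<lambda>k::nat. 2 * k) sequentially sequentially" "filterlim (\<lambda>k::nat. 2 * k + 1) sequentially sequentially"
    by (intro filterlim_subseq, simp add: strict_mono_def)+
  have even: "(\<lambda>k. ?Z (2 * k) j) \<longlonglongrightarrow> A + Y j" for j
    using tendsto_add[OF filterlim_compose[OF Aall dbl(1)] filterlim_compose[OF Yall dbl(1)], of j] by simp
  have odd: "(\<lambda>k. ?Z (2 * k + 1) j) \<longlonglongrightarrow> A - Y j" for j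
    using tendsto_diff[OF filterlim_compose[OF Aall dbl(2)] filterlim_compose[OF Yall dbl(2)], of j] by simp
  have rel: "lift_of (\<lambda>_. golden) (\<lambda>j. A + Y j)"
  proof (rule lift_of_limit[OF even])
    show "(\<lambda>k. frieze_orbit l z (2 * k) j) \<longlonglongrightarrow> golden" for j
      by (rule filterlim_compose[OF frieze_orbit_tendsto[OF l0 c] dbl(1)])
    show "lift_of (frieze_orbit l z (2 * k)) (?Z (2 * k))" for k
      using configuration_orbit[OF l0 \<kappa> c, of "2 * k"] by (simp add: configuration_def)
  qed
  have "(\<lambda>k. vmean (?Z (2 * k))) \<longlonglongrightarrow> vmean (\<lambda>j. A + Y j)" by (rule tendsto_vmean[OF even])
  then have mA: "vmean (\<lambda>j. A + Y j) = A"
    by (rule LIMSEQ_unique) (rule filterlim_compose[OF Aall dbl(1)])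
  have "Y (j + 1) + Y (j + 4) = (golden - 1) *\<^sub>R Y j" for j
    using lift_of_golden_shape[OF rel, of j] unfolding mA by simp
  moreover have "\<gamma> = 0 \<and> \<alpha> = 0 \<and> \<beta> = 0" if dep: "\<gamma> *\<^sub>R A + \<alpha> *\<^sub>R Y 0 + \<beta> *\<^sub>R Y 1 = 0" for \<gamma> \<alpha> \<beta>
  proof -
    define R where "R = \<bar>\<gamma>\<bar> + \<bar>\<alpha>\<bar> + \<bar>\<beta>\<bar>"
    let ?m = "regular_tuple \<gamma> (s * \<alpha>) (s * \<beta>)"
    have "\<bar>s * t\<bar> = \<bar>t\<bar>" for t using ss(2) by auto
    then have mR: "\<bar>?m j\<bar> \<le> R" for j using abs_regular_tuple_le[of \<gamma> "s * \<alpha>" "s * \<beta>" j] by (simp add: R_def)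
    obtain \<eta> where \<eta>: "\<forall>j. \<bar>\<eta> \<bullet> ?V j - ?m j\<bar> \<le> 10 * \<epsilon> * R"
      using covector_exists[OF k0 e regular_tuple_relation mR] by blast
    have clA: "\<bar>\<eta> \<bullet> A - \<gamma>\<bar> \<le> R / 10"
      using Am \<eta> mR mean5_regular_tuple[of \<gamma> "s * \<alpha>" "s * \<beta>"] by fastforce
    have cl: "\<bar>\<eta> \<bullet> Y' j - (?m j - \<gamma>)\<bar> \<le> R / 10" for j
      using spec[OF Y', of j] \<eta> mR mean5_regular_tuple[of \<gamma> "s * \<alpha>" "s * \<beta>"] by fastforce
    define dA d0 d1 where "dA = \<eta> \<bullet> A - \<gamma>" and "d0 = \<eta> \<bullet> Y 0 - \<alpha>" and "d1 = \<eta> \<bullet> Y 1 - \<beta>"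
    have dY: "d0 = s * (\<eta> \<bullet> Y' 0 - s * \<alpha>)" "d1 = s * (\<eta> \<bullet> Y' 1 - s * \<beta>)"
      using ss(1) by (simp_all add: d0_def d1_def Y_def right_diff_distrib mult.assoc[symmetric])
    have d: "\<bar>dA\<bar> \<le> R / 10" "\<bar>d0\<bar> \<le> R / 10" "\<bar>d1\<bar> \<le> R / 10"
      unfolding dY \<open>\<And>t. \<bar>s * t\<bar> = \<bar>t\<bar>\<close>
      using clA cl[of 0] cl[of 1] by (simp_all add: regular_tuple_simps dA_def)
    have "\<eta> \<bullet> (\<gamma> *\<^sub>R A + \<alpha> *\<^sub>R Y 0 + \<beta> *\<^sub>R Y 1) = 0" unfolding dep by simp
    then have sq: "\<gamma>^2 + \<alpha>^2 + \<beta>^2 = - (\<gamma> * dA) - \<alpha> * d0 - \<beta> * d1"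
      by (simp add: inner_simps dA_def d0_def d1_def algebra_simps power2_eq_square)
    have bd: "- (t * u) \<le> \<bar>t\<bar> * (R / 10)" if "\<bar>u\<bar> \<le> R / 10" for t u
      using mult_left_mono[OF that, of "\<bar>t\<bar>"] abs_ge_minus_self[of "t * u"] by (simp add: abs_mult)
    have "10 * (\<gamma>^2 + \<alpha>^2 + \<beta>^2) \<le> (\<bar>\<gamma>\<bar> + \<bar>\<alpha>\<bar> + \<bar>\<beta>\<bar>) * R"
      using sq bd[OF d(1), of \<gamma>] bd[OF d(2), of \<alpha>] bd[OF d(3), of \<beta>] by (simp add: algebra_simps)
    also have "\<dots> = \<gamma>^2 + \<alpha>^2 + \<beta>^2 + 2 * (\<bar>\<alpha>\<bar> * \<bar>\<beta>\<bar>) + 2 * (\<bar>\<alpha>\<bar> * \<bar>\<gamma>\<bar>) + 2 * (\<bar>\<beta>\<bar> * \<bar>\<gamma>\<bar>)"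
      by (simp add: R_def algebra_simps power2_eq_square)
    also have "\<dots> \<le> \<gamma>^2 + \<alpha>^2 + \<beta>^2 + (\<alpha>^2 + \<beta>^2) + (\<alpha>^2 + \<gamma>^2) + (\<beta>^2 + \<gamma>^2)"
      using sum_squares_bound[of "\<bar>\<alpha>\<bar>" "\<bar>\<beta>\<bar>"] sum_squares_bound[of "\<bar>\<alpha>\<bar>" "\<bar>\<gamma>\<bar>"] sum_squares_bound[of "\<bar>\<beta>\<bar>" "\<bar>\<gamma>\<bar>"]
      by (simp add: mult.assoc)
    finally have "\<gamma>^2 + \<alpha>^2 + \<beta>^2 \<le> 0" by simp
    then have "\<gamma>^2 = 0" "\<alpha>^2 = 0" "\<beta>^2 = 0"
      using zero_le_power2[of \<gamma>] zero_le_power2[of \<alpha>] zero_le_power2[of \<beta>] by linarith+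
    then show ?thesis by simp
  qed
  ultimately show ?thesis using even odd by blast
qed

section \<open>Projectively regular limits\<close>

lemma triple_nonzeroI:
  assumes "\<And>x y w. x *\<^sub>R a + y *\<^sub>R b + w *\<^sub>R c = 0 \<Longrightarrow> x = 0 \<and> y = 0 \<and> w = 0"
  shows "triple a b c \<noteq> 0"
proof -
  let ?f = "\<lambda>v::real^3. v$1 *\<^sub>R a + v$2 *\<^sub>R b + v$3 *\<^sub>R c"
  have "linear ?f" by (simp add: linear_iff vec_eq_iff algebra_simps)
  from fun_cong[OF matrix_vector_mul(2)[OF this]] have M: "matrix ?f *v v = ?f v" for v .
  have "\<forall>v. matrix ?f *v v = 0 \<longrightarrow> v = 0"
  proof (intro allI impI)
    fix v assume "matrix ?f *v v = 0"
    from assms[OF this[unfolded M]] show "v = 0" by (simp add: vec_eq_iff forall_3)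
  qed
  then have "invertible (matrix ?f)"
    using matrix_left_invertible_ker invertible_left_inverse by blast
  then have "det (matrix ?f) \<noteq> 0" by (simp add: invertible_det_nz)
  moreover have "triple a b c = triple (matrix ?f *v axis 1 1) (matrix ?f *v axis 2 1) (matrix ?f *v axis 3 1)"
    unfolding M by (simp add: axis_def)
  moreover have "triple (axis 1 1) (axis 2 1) (axis 3 1) = 1" by (simp add: triple_def axis_def)
  ultimately show ?thesis by (simp add: triple_matrix)
qed

text \<open>The image of the point at angle t of the unit circle under the linear map with columns
  u, v, A. For independent columns, equally spaced angles give projectively regular polygons on one
  conic.\<close>

definition conic_point :: "real^3 \<Rightarrow> real^3 \<Rightarrow> real^3 \<Rightarrow> real \<Rightarrow> rp2" where
  "conic_point A u v t = point (A + cos t *\<^sub>R u + sin t *\<^sub>R v)"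

lemma conic_point_periodic: "conic_point A u v (t + 2 * pi * real n) = conic_point A u v t"
proof -
  have "cos (t + 2 * pi * real n) = cos t" "sin (t + 2 * pi * real n) = sin t"
    using cos_2npi[of n] sin_2npi[of n] by (simp_all add: cos_add sin_add mult_ac)
  then show ?thesis by (simp add: conic_point_def)
qed

lemma projectively_regularI:
  fixes Q :: "rp2^'n::{finite,comm_ring_1}" and p :: "real^2^'n::{finite,comm_ring_1}"
  assumes t: "triple u v A \<noteq> 0"
    and p: "\<And>k. p $ of_nat k = vector [cos (s + 2 * pi * real k / real CARD('n)), sin (s + 2 * pi * real k / real CARD('n))]"
    and Q: "\<And>j. \<exists>k. j = of_nat k \<and> Q $ j = conic_point A u v (s + 2 * pi * real k / real CARD('n))"
  shows "projectively_regular Q"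
proof -
  have "triple (axis 1 1) (axis 2 1) (axis 3 1) \<noteq> 0" by (simp add: triple_def axis_def)
  then obtain M :: "real^3^3" where M: "invertible M" "M *v (axis 1 1) = u" "M *v (axis 2 1) = v" "M *v (axis 3 1) = A"
    using frame_matrix[OF _ t] by blast
  have Mv: "M *v (vector [x, y, 1]) = A + x *\<^sub>R u + y *\<^sub>R v" for x y
  proof -
    have "(vector [x, y, 1] :: real^3) = x *\<^sub>R axis 1 1 + y *\<^sub>R axis 2 1 + axis 3 1"
      by (simp add: vec_eq_iff forall_3 axis_def)
    then show ?thesis by (simp add: matrix_vector_right_distrib matrix_vector_mult_scaleR M)
  qed
  have nz: "(vector [x, y, 1] :: real^3) \<noteq> 0" for x y by (simp add: vec_eq_iff forall_3)
  obtain T where T: "projective_transformation T" "\<And>v. v \<noteq> 0 \<Longrightarrow> T (point v) = point (M *v v)"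
    using projective_transformation_exists[OF M(1)] by blast
  have "regular_polygon p"
    unfolding regular_polygon_def
    by (intro exI[of _ 0] exI[of _ 1] exI[of _ s]) (auto simp: p)
  moreover have "Q $ j = T (affine_point (p $ j))" for j
  proof -
    obtain k where k: "j = of_nat k" "Q $ j = conic_point A u v (s + 2 * pi * real k / real CARD('n))" using Q by blast
    show ?thesis unfolding k(2) unfolding k(1) p by (simp add: affine_chart_def T(2)[OF nz] Mv conic_point_def)
  qed
  ultimately show ?thesis unfolding projectively_regular_def using T(1) by blast
qed

lemma angle_mod:
  assumes "n > 0"
  shows "s + 2 * pi * real k / real n = (s + 2 * pi * real (k mod n) / real n) + 2 * pi * real (k div n)"
proof -
  have "real k = real n * real (k div n) + real (k mod n)"
    by (metis mult_div_mod_eq of_nat_add of_nat_mult)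
  then show ?thesis using assms by (simp add: field_simps)
qed

text \<open>The angle of a vertex needs a natural number that represents its cyclic index; the
  choice among congruent numbers disappears by periodicity.\<close>

definition index5 :: "5 \<Rightarrow> nat" where "index5 j = nat (Rep_bit1 j)"
definition index10 :: "10 \<Rightarrow> nat" where "index10 j = nat (Rep_bit0 j)"

lemma index5_of_nat: "index5 (of_nat k) = k mod 5"
proof -
  have "Rep_bit1 (of_nat k :: 5) = int k mod 5"
    unfolding bit1.of_nat_eq using bit1.Rep_Abs_mod[where 'a = "num1 bit0", of "int k"] by simp
  then show ?thesis unfolding index5_def by (simp add: nat_mod_distrib)
qed

lemma index10_of_nat: "index10 (of_nat k) = k mod 10"
proof -
  have "Rep_bit0 (of_nat k :: 10) = int k mod 10"
    unfolding bit0.of_nat_eq using bit0.Rep_Abs_mod[where 'a = "num1 bit0 bit1", of "int k"] by simp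
  then show ?thesis unfolding index10_def by (simp add: nat_mod_distrib)
qed

lemma of_nat_index5: "of_nat (index5 j) = j"
proof -
  obtain z where z: "j = of_int z" "0 \<le> z" "z < int CARD(5)" by (rule bit1_cases)
  then have "j = of_nat (nat z)" by simp
  then show ?thesis using z index5_of_nat[of "nat z"] by (simp add: nat_mod_distrib)
qed

lemma of_nat_index10: "of_nat (index10 j) = j"
proof -
  obtain z where z: "j = of_int z" "0 \<le> z" "z < int CARD(10)" by (rule bit0_cases)
  then have "j = of_nat (nat z)" by simp
  then show ?thesis using z index10_of_nat[of "nat z"] by (simp add: nat_mod_distrib)
qed

lemma cos_sin_angle_mod:
  assumes "n > 0"
  shows "cos (s + 2 * pi * real (k mod n) / real n) = cos (s + 2 * pi * real k / real n)"
    "sin (s + 2 * pi * real (k mod n) / real n) = sin (s + 2 * pi * real k / real n)"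
  unfolding angle_mod[OF assms, of s k] using cos_2npi[of "k div n"] sin_2npi[of "k div n"]
  by (simp_all only: cos_add sin_add mult.commute[of 2 pi] mult.assoc mult.left_commute[of pi 2]) (simp_all add: mult_ac)

lemma projectively_regular_pentagon:
  assumes t: "triple u v A \<noteq> 0" and Q: "\<And>k. Q $ (of_nat k :: 5) = conic_point A u v (s + 2 * pi * real k / 5)"
  shows "projectively_regular (Q :: rp2^5)"
proof (rule projectively_regularI[OF t, where s = s and
    p = "\<chi> j. vector [cos (s + 2 * pi * real (index5 j) / 5), sin (s + 2 * pi * real (index5 j) / 5)]"])
  show "(\<chi> j::5. (vector [cos (s + 2 * pi * real (index5 j) / 5), sin (s + 2 * pi * real (index5 j) / 5)] :: real^2)) $ (of_nat k)
    = vector [cos (s + 2 * pi * real k / real CARD(5)), sin (s + 2 * pi * real k / real CARD(5))]" for k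
    using cos_sin_angle_mod[of 5 s k] by (simp add: index5_of_nat)
  show "\<exists>k. j = of_nat k \<and> Q $ j = conic_point A u v (s + 2 * pi * real k / real CARD(5))" for j
    using Q[of "index5 j"] by (intro exI[of _ "index5 j"]) (simp add: of_nat_index5)
qed

lemma projectively_regular_decagon:
  assumes t: "triple u v A \<noteq> 0" and Q: "\<And>k. Q $ (of_nat k :: 10) = conic_point A u v (s + 2 * pi * real k / 10)"
  shows "projectively_regular (Q :: rp2^10)"
proof (rule projectively_regularI[OF t, where s = s and
    p = "\<chi> j. vector [cos (s + 2 * pi * real (index10 j) / 10), sin (s + 2 * pi * real (index10 j) / 10)]"])
  show "(\<chi> j::10. (vector [cos (s + 2 * pi * real (index10 j) / 10), sin (s + 2 * pi * real (index10 j) / 10)] :: real^2)) $ (of_nat k)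
    = vector [cos (s + 2 * pi * real k / real CARD(10)), sin (s + 2 * pi * real k / real CARD(10))]" for k
    using cos_sin_angle_mod[of 10 s k] by (simp add: index10_of_nat)
  show "\<exists>k. j = of_nat k \<and> Q $ j = conic_point A u v (s + 2 * pi * real k / real CARD(10))" for j
    using Q[of "index10 j"] by (intro exI[of _ "index10 j"]) (simp add: of_nat_index10)
qed

text \<open>As golden - 1 = 2 * cos \<gamma>, the relation is the three-term recursion satisfied by
  the cosines and sines of multiples of \<gamma>. \<open>W\<close> is determined by the value at
  index 1.\<close>

lemma shape_trigonometric:
  fixes Y :: "5 \<Rightarrow> real^3"
  assumes Y: "\<And>j. Y (j + 1) + Y (j + 4) = (golden - 1) *\<^sub>R Y j"
  defines "\<gamma> \<equiv> 2 * pi / 5"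
  defines "W \<equiv> (1 / sin \<gamma>) *\<^sub>R (Y 1 - cos \<gamma> *\<^sub>R Y 0)"
  shows "Y (of_nat k) = cos (\<gamma> * real k) *\<^sub>R Y 0 + sin (\<gamma> * real k) *\<^sub>R W"
    and "sin \<gamma> > 0"
proof -
  show s: "sin \<gamma> > 0" unfolding \<gamma>_def by (intro sin_gt_zero) auto
  have "\<gamma> = 2 * (pi / 5)" by (simp add: \<gamma>_def)
  then have "cos \<gamma> = 2 * (cos (pi / 5))^2 - 1" by (simp only: cos_double_cos)
  moreover have "cos (pi / 5) = golden / 2" using golden_eq by simp
  ultimately have g: "2 * cos \<gamma> = golden - 1" using golden_square by (simp add: power_divide)
  have rec: "Y (of_nat (Suc (Suc k))) = (2 * cos \<gamma>) *\<^sub>R Y (of_nat (Suc k)) - Y (of_nat k)" for k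
  proof -
    have "(of_nat k + 1 :: 5) + 1 = of_nat (Suc (Suc k))" "(of_nat k + 1 :: 5) + 4 = of_nat k"
      by simp_all
    with Y[of "of_nat k + 1"] have "Y (of_nat (Suc (Suc k))) + Y (of_nat k) = (golden - 1) *\<^sub>R Y (of_nat k + 1)"
      by (simp only:)
    then show ?thesis unfolding g by (simp add: algebra_simps)
  qed
  have c: "cos (\<gamma> * real (Suc (Suc k))) = 2 * cos \<gamma> * cos (\<gamma> * real (Suc k)) - cos (\<gamma> * real k)"
    "sin (\<gamma> * real (Suc (Suc k))) = 2 * cos \<gamma> * sin (\<gamma> * real (Suc k)) - sin (\<gamma> * real k)" for k
  proof -
    define t where "t = \<gamma> * real (Suc k)"
    have e: "\<gamma> * real (Suc (Suc k)) = t + \<gamma>" "\<gamma> * real k = t - \<gamma>" by (simp_all add: t_def algebra_simps)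
    show "cos (\<gamma> * real (Suc (Suc k))) = 2 * cos \<gamma> * cos (\<gamma> * real (Suc k)) - cos (\<gamma> * real k)"
      "sin (\<gamma> * real (Suc (Suc k))) = 2 * cos \<gamma> * sin (\<gamma> * real (Suc k)) - sin (\<gamma> * real k)"
      unfolding e t_def[symmetric] by (simp_all add: cos_add cos_diff sin_add sin_diff)
  qed
  have "Y (of_nat k) = cos (\<gamma> * real k) *\<^sub>R Y 0 + sin (\<gamma> * real k) *\<^sub>R W \<and>
    Y (of_nat (Suc k)) = cos (\<gamma> * real (Suc k)) *\<^sub>R Y 0 + sin (\<gamma> * real (Suc k)) *\<^sub>R W"
  proof (induction k)
    case 0
    then show ?case using s by (simp add: W_def)
  next
    case (Suc k)
    have "Y (of_nat (Suc (Suc k))) = cos (\<gamma> * real (Suc (Suc k))) *\<^sub>R Y 0 + sin (\<gamma> * real (Suc (Suc k))) *\<^sub>R W"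
      unfolding rec c using Suc by (simp add: algebra_simps)
    then show ?case using Suc by simp
  qed
  then show "Y (of_nat k) = cos (\<gamma> * real k) *\<^sub>R Y 0 + sin (\<gamma> * real k) *\<^sub>R W" by blast
qed

text \<open>Replacing Y j by - Y j adds pi to the angle on the common conic. This is five steps of
  pi / 5, an odd number, so in the decagon \<open>Q\<close> occupies the even positions and
  \<open>R\<close> the odd ones.\<close>

lemma balanced_pentagons:
  fixes Y :: "5 \<Rightarrow> real^3"
  assumes Y: "\<And>j. Y (j + 1) + Y (j + 4) = (golden - 1) *\<^sub>R Y j"
    and ind: "\<And>\<gamma> \<alpha> \<beta>. \<gamma> *\<^sub>R A + \<alpha> *\<^sub>R Y 0 + \<beta> *\<^sub>R Y 1 = 0 \<Longrightarrow> \<gamma> = 0 \<and> \<alpha> = 0 \<and> \<beta> = 0"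
  defines "Q \<equiv> (\<chi> j. point (A + Y j)) :: pentagon" and "R \<equiv> (\<chi> j. point (A - Y j)) :: pentagon"
  shows "projectively_regular Q" "projectively_regular R" "Q \<noteq> R"
    "\<exists>D :: rp2^10. projectively_regular D \<and> range (\<lambda>j. D $ j) = range (\<lambda>j. Q $ j) \<union> range (\<lambda>j. R $ j)"
    "\<And>j. A + Y j \<noteq> 0" "\<And>j. A - Y j \<noteq> 0"
proof -
  define \<gamma> where "\<gamma> = 2 * pi / 5"
  define W where "W = (1 / sin \<gamma>) *\<^sub>R (Y 1 - cos \<gamma> *\<^sub>R Y 0)"
  note tr = shape_trigonometric[of Y, OF Y, folded \<gamma>_def, folded W_def]
  have t: "triple (Y 0) W A \<noteq> 0"
  proof (rule triple_nonzeroI)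
    fix x y w assume "x *\<^sub>R Y 0 + y *\<^sub>R W + w *\<^sub>R A = 0"
    then have "w *\<^sub>R A + (x - y * cos \<gamma> / sin \<gamma>) *\<^sub>R Y 0 + (y / sin \<gamma>) *\<^sub>R Y 1 = 0"
      by (simp add: W_def algebra_simps)
    from ind[OF this] tr(2) show "x = 0 \<and> y = 0 \<and> w = 0" by auto
  qed
  let ?G = "conic_point A (Y 0) W"
  have Qk: "Q $ of_nat k = ?G (0 + 2 * pi * real k / 5)" for k
    using tr(1)[of k] by (simp add: Q_def conic_point_def \<gamma>_def algebra_simps)
  have Rk: "R $ of_nat k = ?G (pi + 2 * pi * real k / 5)" for k
    using tr(1)[of k] by (simp add: R_def conic_point_def \<gamma>_def cos_add sin_add algebra_simps)
  show "projectively_regular Q" by (rule projectively_regular_pentagon[OF t Qk])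
  show "projectively_regular R" by (rule projectively_regular_pentagon[OF t Rk])
  have nz: "A + s *\<^sub>R Y j \<noteq> 0" for s j
  proof
    assume e: "A + s *\<^sub>R Y j = 0"
    define k where "k = index5 j"
    have "Y j = cos (\<gamma> * real k) *\<^sub>R Y 0 + sin (\<gamma> * real k) *\<^sub>R W"
      using tr(1)[of k] by (simp add: k_def of_nat_index5)
    then have "(s * cos (\<gamma> * real k)) *\<^sub>R Y 0 + (s * sin (\<gamma> * real k)) *\<^sub>R W + 1 *\<^sub>R A = 0"
      using e by (simp add: algebra_simps)
    from triple_independent(3)[OF t this] show False by simp
  qed
  show Q0: "A + Y j \<noteq> 0" for j using nz[of 1 j] by simp
  show R0: "A - Y j \<noteq> 0" for j using nz[of "-1" j] by simp
  show "Q \<noteq> R"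
  proof
    assume "Q = R"
    then have "point (A + Y 0) = point (A - Y 0)" by (simp add: Q_def R_def vec_eq_iff)
    then obtain c where c: "A - Y 0 = c *\<^sub>R (A + Y 0)" using point_eq_iff[OF Q0 R0] by blast
    then have "(1 - c) *\<^sub>R A + (- 1 - c) *\<^sub>R Y 0 + 0 *\<^sub>R Y 1 = 0" by (simp add: algebra_simps)
    from ind[OF this] have "1 - c = 0" "- 1 - c = 0" by blast+
    then show False by linarith
  qed
  define D where "D = (\<chi> j. ?G (0 + 2 * pi * real (index10 j) / 10)) "
  have Dk: "D $ (of_nat k :: 10) = ?G (0 + 2 * pi * real k / 10)" for k
    using cos_sin_angle_mod[of 10 0 k] by (simp add: D_def index10_of_nat conic_point_def)
  have "range (\<lambda>j. D $ j) = range (\<lambda>j. Q $ j) \<union> range (\<lambda>j. R $ j)"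
  proof (intro equalityI subsetI)
    fix x assume "x \<in> range (\<lambda>j. D $ j)"
    then obtain j where "x = D $ j" by auto
    then have x: "x = ?G (2 * pi * real (index10 j) / 10)" using Dk[of "index10 j"] by (simp add: of_nat_index10)
    show "x \<in> range (\<lambda>j. Q $ j) \<union> range (\<lambda>j. R $ j)"
    proof (cases "even (index10 j)")
      case True
      then obtain m where "index10 j = 2 * m" by (elim evenE)
      then have "x = Q $ of_nat m" unfolding x Qk by (simp add: mult.assoc)
      then show ?thesis by auto
    next
      case False
      then obtain m where m: "index10 j = 2 * m + 1" by (elim oddE)
      \<comment> \<open>Vertex k of \<open>R\<close> has position 5 + 2 * k; for k = m + 3 this is 2
        * m + 1 modulo 10.\<close>
      have "pi + 2 * pi * real (m + 3) / 5 = 2 * pi * real (2 * m + 1) / 10 + 2 * pi * real 1"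
        by (simp add: field_simps)
      then have "R $ of_nat (m + 3) = ?G (2 * pi * real (2 * m + 1) / 10)"
        unfolding Rk using conic_point_periodic[of A "Y 0" W _ 1] by (simp only:)
      then have "x = R $ of_nat (m + 3)" unfolding x m by simp
      then show ?thesis by auto
    qed
  next
    fix x assume "x \<in> range (\<lambda>j. Q $ j) \<union> range (\<lambda>j. R $ j)"
    then consider j where "x = Q $ j" | j where "x = R $ j" by auto
    then show "x \<in> range (\<lambda>j. D $ j)"
    proof cases
      case 1
      then have "x = D $ of_nat (2 * index5 j)" using Qk[of "index5 j"] unfolding Dk by (simp add: of_nat_index5 mult.assoc)
      then show ?thesis by auto
    next
      case 2
      have ang: "0 + 2 * pi * real (2 * index5 j + 5) / 10 = pi + 2 * pi * real (index5 j) / 5" by (simp add: field_simps)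
      have "x = D $ of_nat (2 * index5 j + 5)"
        unfolding Dk ang using 2 Rk[of "index5 j"] by (simp add: of_nat_index5)
      then show ?thesis by auto
    qed
  qed
  moreover have "projectively_regular D" by (rule projectively_regular_decagon[OF t Dk])
  ultimately show "\<exists>D :: rp2^10. projectively_regular D \<and> range (\<lambda>j. D $ j) = range (\<lambda>j. Q $ j) \<union> range (\<lambda>j. R $ j)"
    by blast
qed

section \<open>Analyticity\<close>

definition analytic_near :: "coords \<Rightarrow> (coords \<Rightarrow> real) \<Rightarrow> bool" where
  "analytic_near w f \<longleftrightarrow> (\<exists>r C. r > 0 \<and> majorized w r f C)"

lemma majorized_restrict:
  assumes "majorized w r f C" "0 < t" "t \<le> r"
  shows "majorized w t f (\<bar>f w\<bar> + t / r * C)"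
proof -
  have "majorized w t (\<lambda>x. f w + (f x - f w)) (\<bar>f w\<bar> + t / r * C)"
    by (rule majorized_add[OF assms(2) majorized_const[OF assms(2)] majorized_shrink[OF assms]])
  then show ?thesis by simp
qed

lemma analytic_near_restrict:
  assumes "analytic_near w f"
  obtains r where "r > 0" "\<And>t. 0 < t \<Longrightarrow> t \<le> r \<Longrightarrow> \<exists>C. majorized w t f C"
proof -
  obtain r C where "r > 0" "majorized w r f C" using assms unfolding analytic_near_def by blast
  then show thesis using majorized_restrict that by blast
qed

text \<open>By \<open>majorized_shrink\<close> the distance to the value at w falls in proportion to
  the radius. It holds for all smaller radii, so that several functions can be given a common
  cube.\<close>

lemma analytic_near_small:
  assumes f: "analytic_near w f" and e: "e > 0"
  shows "\<exists>r>0. \<forall>t. 0 < t \<longrightarrow> t \<le> r \<longrightarrow> majorized w t (\<lambda>x. f x - f w) e"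
proof -
  obtain r C where r: "r > 0" "majorized w r f C" using f unfolding analytic_near_def by blast
  have C: "C \<ge> 0" using majorized_eval[OF r(2), of w] r(1) by (force simp: cube_def)
  define s where "s = min r (r * e / (C + 1))"
  have s: "s > 0" "s \<le> r" "s \<le> r * e / (C + 1)" using r e C by (auto simp: s_def)
  have "majorized w t (\<lambda>x. f x - f w) e" if t: "0 < t" "t \<le> s" for t
  proof (rule majorized_cong[OF majorized_shrink[OF r(2) t(1)]])
    show "t \<le> r" using t s by simp
    have "t \<le> r * e / (C + 1)" using t s by simp
    then have "t * (C + 1) \<le> r * e" using C by (simp add: pos_le_divide_eq)
    moreover have "t * C \<le> t * (C + 1)" using t by simp
    ultimately have "t * C \<le> e * r" by (simp add: mult.commute)
    then show "t / r * C \<le> e" using r by (simp add: pos_divide_le_eq)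
  qed simp
  then show ?thesis using s(1) by blast
qed

lemma analytic_near_family:
  fixes f :: "'i::finite \<Rightarrow> coords \<Rightarrow> real"
  assumes f: "\<And>i. analytic_near w (f i)" and e: "e > 0"
  shows "\<exists>r>0. \<forall>t. 0 < t \<longrightarrow> t \<le> r \<longrightarrow> (\<forall>i. majorized w t (\<lambda>x. f i x - f i w) e)"
proof -
  have "\<forall>i. \<exists>r. r > 0 \<and> (\<forall>t. 0 < t \<longrightarrow> t \<le> r \<longrightarrow> majorized w t (\<lambda>x. f i x - f i w) e)"
    using analytic_near_small[OF f e] by blast
  from choice[OF this] obtain r where
    r: "\<forall>i. r i > 0 \<and> (\<forall>t. 0 < t \<longrightarrow> t \<le> r i \<longrightarrow> majorized w t (\<lambda>x. f i x - f i w) e)" ..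
  have m: "Min (range r) \<le> r i" for i by (rule Min_le) auto
  have "Min (range r) > 0" using r by auto
  moreover have "majorized w t (\<lambda>x. f i x - f i w) e" if "0 < t" "t \<le> Min (range r)" for t i
    using r m[of i] that by (meson order_trans)
  ultimately show ?thesis by blast
qed

lemma analytic_near_const: "analytic_near w (\<lambda>x. c)"
  unfolding analytic_near_def using majorized_const[of 1 w c] by (intro exI[of _ 1] exI[of _ "\<bar>c\<bar>"]) simp

lemma analytic_near_add:
  assumes "analytic_near w f" "analytic_near w g"
  shows "analytic_near w (\<lambda>x. f x + g x)"
proof -
  obtain r where r: "r > 0" "\<And>t. 0 < t \<Longrightarrow> t \<le> r \<Longrightarrow> \<exists>C. majorized w t f C"
    using analytic_near_restrict[OF assms(1)] by blast
  obtain s where s: "s > 0" "\<And>t. 0 < t \<Longrightarrow> t \<le> s \<Longrightarrow> \<exists>C. majorized w t g C"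
    using analytic_near_restrict[OF assms(2)] by blast
  have m: "min r s > 0" "min r s \<le> r" "min r s \<le> s" using r(1) s(1) by auto
  obtain C where C: "majorized w (min r s) f C" using r(2)[OF m(1,2)] by blast
  obtain D where D: "majorized w (min r s) g D" using s(2)[OF m(1,3)] by blast
  show ?thesis unfolding analytic_near_def using majorized_add[OF m(1) C D] m(1) by blast
qed

lemma analytic_near_mult:
  assumes "analytic_near w f" "analytic_near w g"
  shows "analytic_near w (\<lambda>x. f x * g x)"
proof -
  obtain r where r: "r > 0" "\<And>t. 0 < t \<Longrightarrow> t \<le> r \<Longrightarrow> \<exists>C. majorized w t f C"
    using analytic_near_restrict[OF assms(1)] by blast
  obtain s where s: "s > 0" "\<And>t. 0 < t \<Longrightarrow> t \<le> s \<Longrightarrow> \<exists>C. majorized w t g C"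
    using analytic_near_restrict[OF assms(2)] by blast
  have m: "min r s > 0" "min r s \<le> r" "min r s \<le> s" using r(1) s(1) by auto
  obtain C where C: "majorized w (min r s) f C" using r(2)[OF m(1,2)] by blast
  obtain D where D: "majorized w (min r s) g D" using s(2)[OF m(1,3)] by blast
  show ?thesis unfolding analytic_near_def using majorized_mult[OF m(1) C D] m(1) by blast
qed

lemma analytic_near_diff: "analytic_near w f \<Longrightarrow> analytic_near w g \<Longrightarrow> analytic_near w (\<lambda>x. f x - g x)"
  using analytic_near_add[of w f "\<lambda>x. -1 * g x"] analytic_near_mult[OF analytic_near_const, of w g "-1"] by simp

lemma analytic_near_inverse:
  assumes f: "analytic_near w f" and nz: "f w \<noteq> 0"
  shows "analytic_near w (\<lambda>x. 1 / f x)"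
proof -
  obtain r where r: "r > 0" "\<forall>t. 0 < t \<longrightarrow> t \<le> r \<longrightarrow> majorized w t (\<lambda>x. f x - f w) (\<bar>f w\<bar> / 2)"
    using analytic_near_small[OF f, of "\<bar>f w\<bar> / 2"] nz by auto
  then have "majorized w r (\<lambda>x. f x - f w) (\<bar>f w\<bar> / 2)" by simp
  from majorant.maj_inverse[OF majorant_majorized[OF r(1)] this] nz
  show ?thesis unfolding analytic_near_def using r(1) by auto
qed

lemma analytic_near_divide:
  "analytic_near w f \<Longrightarrow> analytic_near w g \<Longrightarrow> g w \<noteq> 0 \<Longrightarrow> analytic_near w (\<lambda>x. f x / g x)"
  using analytic_near_mult[OF _ analytic_near_inverse, of w f g] by simp

lemmas analytic_intros = analytic_near_const analytic_near_add analytic_near_diff analytic_near_mult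

lemma analytic_near_coordinate: "analytic_near w (\<lambda>x. x $ j $ i)"
proof -
  have b: "axis j (axis i 1) \<in> (Basis :: coords set)" by (auto simp: axis_in_Basis_iff)
  have "analytic_near w (\<lambda>x. (x - w) \<bullet> axis j (axis i 1))"
    unfolding analytic_near_def using majorized_coordinate[OF _ b, of 1 w] by (intro exI[of _ 1]) auto
  from analytic_near_add[OF this analytic_near_const[of w "w $ j $ i"]]
  show ?thesis by (simp add: inner_axis)
qed

lemma analytic_near_nonzero:
  assumes f: "analytic_near w f" and nz: "f w \<noteq> 0"
  shows "\<exists>r>0. \<forall>x\<in>cube w r. f x \<noteq> 0"
proof -
  obtain r where r: "r > 0" "\<forall>t. 0 < t \<longrightarrow> t \<le> r \<longrightarrow> majorized w t (\<lambda>x. f x - f w) (\<bar>f w\<bar> / 2)"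
    using analytic_near_small[OF f, of "\<bar>f w\<bar> / 2"] nz by auto
  then have m: "majorized w r (\<lambda>x. f x - f w) (\<bar>f w\<bar> / 2)" by simp
  have "f x \<noteq> 0" if "x \<in> cube w r" for x
    using majorized_eval[OF m that] nz by auto
  then show ?thesis using r(1) by blast
qed

lemma cube_mono: "t \<le> r \<Longrightarrow> cube w t \<subseteq> cube w r"
  unfolding cube_def by force

lemma eventually_cube:
  fixes w :: "'a::euclidean_space"
  assumes "r > 0"
  shows "\<forall>\<^sub>F x in nhds w. x \<in> cube w r"
proof -
  have "ball w r \<subseteq> cube w r"
  proof
    fix x assume "x \<in> ball w r"
    then have "norm (x - w) < r" by (simp add: dist_norm norm_minus_commute)
    then show "x \<in> cube w r"
      unfolding cube_def using Basis_le_norm[of _ "x - w"] by fastforce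
  qed
  moreover have "\<forall>\<^sub>F x in nhds w. x \<in> ball w r" by (rule eventually_nhds_in_open) (use assms in auto)
  ultimately show ?thesis by (auto elim!: eventually_mono)
qed

lemma real_analytic_at_components:
  fixes G :: "coords \<Rightarrow> real^2"
  assumes G: "\<And>i. analytic_near w (\<lambda>x. G x $ i)"
  shows "real_analytic_at G w"
proof -
  obtain r1 where r1: "r1 > 0" "\<And>t. 0 < t \<Longrightarrow> t \<le> r1 \<Longrightarrow> \<exists>C. majorized w t (\<lambda>x. G x $ 1) C"
    using analytic_near_restrict[OF G[of 1]] by blast
  obtain r2 where r2: "r2 > 0" "\<And>t. 0 < t \<Longrightarrow> t \<le> r2 \<Longrightarrow> \<exists>C. majorized w t (\<lambda>x. G x $ 2) C"
    using analytic_near_restrict[OF G[of 2]] by blast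
  define r where "r = min r1 r2"
  have r: "r > 0" "r \<le> r1" "r \<le> r2" using r1(1) r2(1) by (auto simp: r_def)
  obtain C D where CD: "majorized w r (\<lambda>x. G x $ 1) C" "majorized w r (\<lambda>x. G x $ 2) D"
    using r1(2)[OF r(1,2)] r2(2)[OF r(1,3)] by blast
  obtain a where a: "\<And>x. x \<in> cube w r \<Longrightarrow> ((\<lambda>m. a m * monomial m (x - w)) has_sum G x $ 1) multi_indices"
    using CD(1) unfolding majorized_def by blast
  obtain b where b: "\<And>x. x \<in> cube w r \<Longrightarrow> ((\<lambda>m. b m * monomial m (x - w)) has_sum G x $ 2) multi_indices"
    using CD(2) unfolding majorized_def by blast
  show ?thesis
    unfolding real_analytic_at_def
  proof (intro exI[of _ "\<lambda>m. vector [a m, b m]"] exI[of _ r] conjI r(1) allI impI)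
    fix h :: coords assume h: "norm h < r"
    have c: "w + h \<in> cube w r"
      unfolding cube_def using Basis_le_norm[of _ h] h by fastforce
    have 1: "((\<lambda>m. (a m * monomial m h) *\<^sub>R axis 1 1) has_sum (G (w + h) $ 1) *\<^sub>R (axis 1 1 :: real^2)) multi_indices"
      using has_sum_bounded_linear[OF bounded_linear_scaleR_left[of "axis 1 1 :: real^2"] a[OF c]] by (simp add: o_def)
    have 2: "((\<lambda>m. (b m * monomial m h) *\<^sub>R axis 2 1) has_sum (G (w + h) $ 2) *\<^sub>R (axis 2 1 :: real^2)) multi_indices"
      using has_sum_bounded_linear[OF bounded_linear_scaleR_left[of "axis 2 1 :: real^2"] b[OF c]] by (simp add: o_def)
    have eq1: "(a m * monomial m h) *\<^sub>R axis 1 1 + (b m * monomial m h) *\<^sub>R axis 2 1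
      = (\<Prod>b\<in>Basis. (h \<bullet> b) ^ m b) *\<^sub>R (vector [a m, b m] :: real^2)" for m
      by (simp add: vec_eq_iff forall_2 axis_def monomial_def)
    have eq2: "(G (w + h) $ 1) *\<^sub>R axis 1 1 + (G (w + h) $ 2) *\<^sub>R axis 2 1 = G (w + h)"
      by (simp add: vec_eq_iff forall_2 axis_def)
    show "((\<lambda>m. (\<Prod>b\<in>Basis. (h \<bullet> b) ^ m b) *\<^sub>R vector [a m, b m]) has_sum G (w + h)) multi_indices"
      using has_sum_add[OF 1 2] unfolding eq1 eq2 .
  qed
qed

text \<open>A finite iterate is a rational expression in the initial data whose denominators are
  positive at w. The cube may shrink with k, so this only serves to reach one fixed step; the limit
  needs the uniform tail estimates.\<close>

lemma analytic_near_orbit: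
  assumes l: "l > 0" and \<kappa>: "\<kappa> \<noteq> 0" and c: "configuration (Z w) (X w)"
    and Z: "\<And>j. analytic_near w (\<lambda>p. Z p j)" and X: "\<And>j i. analytic_near w (\<lambda>p. X p j $ i)"
  shows "analytic_near w (\<lambda>p. frieze_orbit l (Z p) k j)"
    "analytic_near w (\<lambda>p. lift_orbit l \<kappa> (Z p) (X p) k j $ i)"
proof -
  have e: "edge l (frieze_orbit l (Z w) k) j > 0" for k j
    using configuration_orbit[OF l \<kappa> c, of k] by (intro edge_pos[OF l]) (simp add: configuration_def)
  have an_edge: "analytic_near w (\<lambda>p. edge l (f p) j)" if "\<And>j. analytic_near w (\<lambda>p. f p j)" for f j
    unfolding edge_def by (intro analytic_intros that)
  have an_diagonal: "analytic_near w (\<lambda>p. diagonal l (f p) j)" if "\<And>j. analytic_near w (\<lambda>p. f p j)" for f j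
    unfolding diagonal_def by (intro analytic_intros that)
  have fo: "analytic_near w (\<lambda>p. frieze_orbit l (Z p) k j)" for k j
  proof (induction k arbitrary: j)
    case 0
    then show ?case using Z by simp
  next
    case (Suc k)
    have "edge l (frieze_orbit l (Z w) k) (j + 1) * edge l (frieze_orbit l (Z w) k) (j + 3) \<noteq> 0"
      using e[of k "j + 1"] e[of k "j + 3"] by simp
    then show ?case
      unfolding frieze_orbit.simps heat_frieze_def
      by (intro analytic_near_divide analytic_near_mult an_edge an_diagonal Suc)
  qed
  then show "analytic_near w (\<lambda>p. frieze_orbit l (Z p) k j)" .
  show "analytic_near w (\<lambda>p. lift_orbit l \<kappa> (Z p) (X p) k j $ i)"
  proof (induction k arbitrary: j i)
    case 0
    then show ?case using X by simp
  next
    case (Suc k)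
    have "analytic_near w (\<lambda>p. (1 / (regular_edge l ^ 3 * \<kappa>)) * gauge l (frieze_orbit l (Z p) k) j
       * ((1 + l) * frieze_orbit l (Z p) k (j + 1) * lift_orbit l \<kappa> (Z p) (X p) k (j + 2) $ i
         + lift_orbit l \<kappa> (Z p) (X p) k (j + 4) $ i - l * lift_orbit l \<kappa> (Z p) (X p) k (j + 1) $ i))"
      unfolding gauge_def by (intro analytic_intros an_edge fo Suc)
    then show ?case
      unfolding lift_orbit.simps heat_step_component heat_lift_def heat_combination_def by simp
  qed
qed

text \<open>Beyond a fixed step the whole orbit is controlled in the norm of power series on a cube, so the
  limit is again a power series.\<close>

lemma analytic_limit:
  assumes l: "l > 0" and \<kappa>: "\<kappa> \<noteq> 0"
    and ev: "\<bar>mean_eigenvalue l / \<kappa>\<bar> \<le> 1" "\<bar>shape_eigenvalue l / \<kappa>\<bar> \<le> 1"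
    and r0: "r0 > 0" "\<And>p. p \<in> cube w r0 \<Longrightarrow> configuration (Z p) (X p)"
    and Z: "\<And>j. analytic_near w (\<lambda>p. Z p j)" and X: "\<And>j i. analytic_near w (\<lambda>p. X p j $ i)"
  shows "mean_eigenvalue l / \<kappa> = 1 \<Longrightarrow> \<exists>g r. analytic_near w g \<and> 0 < r \<and>
      (\<forall>p\<in>cube w r. (\<lambda>k. mean5 (\<lambda>j. lift_orbit l \<kappa> (Z p) (X p) k j $ i)) \<longlonglongrightarrow> g p)"
    and "shape_eigenvalue l / \<kappa> = 1 \<Longrightarrow> \<exists>g r. analytic_near w g \<and> 0 < r \<and>
      (\<forall>p\<in>cube w r. (\<lambda>k. lift_orbit l \<kappa> (Z p) (X p) k j $ i - mean5 (\<lambda>j. lift_orbit l \<kappa> (Z p) (X p) k j $ i)) \<longlonglongrightarrow> g p)"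
proof -
  obtain \<theta> C \<epsilon> where tp: "tail_parameters l \<kappa> \<theta> C \<epsilon>" using tail_parameters_exist[OF l \<kappa>] by blast
  have P: "0 < \<theta>" "\<theta> < 1" "0 < C" "0 \<le> \<epsilon>" "\<epsilon> \<le> \<epsilon>" "8 * C * \<epsilon> \<le> 1 - \<theta>" "contracts l \<theta> \<epsilon>" "lift_bound l \<kappa> C \<epsilon>" "0 < \<epsilon>"
  proof -
    have "8 * C * \<epsilon> \<le> 1280 * C * \<epsilon>" using tp by (simp add: tail_parameters_def)
    then show "8 * C * \<epsilon> \<le> 1 - \<theta>" using tp unfolding tail_parameters_def by linarith
  qed (use tp in \<open>simp_all add: tail_parameters_def\<close>)
  have "w \<in> cube w r0" using r0(1) by (simp add: cube_def)
  then have cw: "configuration (Z w) (X w)" by (rule r0(2))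
  have e2: "\<epsilon> / 2 > 0" using P by simp
  \<comment> \<open>Half of \<epsilon> is spent at the centre w, the other half on the variation
    over the cube.\<close>
  obtain k0 where k0: "\<And>j. \<bar>frieze_orbit l (Z w) k0 j - golden\<bar> \<le> \<epsilon> / 2"
    using frieze_orbit_golden[OF l cw e2] by blast
  define z where "z n j p = frieze_orbit l (Z p) (k0 + n) j" for n j p
  define x where "x n j p = lift_orbit l \<kappa> (Z p) (X p) (k0 + n) j $ i" for n j p
  have an: "analytic_near w (z 0 j)" "analytic_near w (x 0 j)" for j
    unfolding z_def x_def using analytic_near_orbit[OF l \<kappa> cw Z X, of k0 j] by simp_all
  obtain r1 where r1: "r1 > 0" "\<forall>t. 0 < t \<longrightarrow> t \<le> r1 \<longrightarrow> (\<forall>j. majorized w t (\<lambda>p. z 0 j p - z 0 j w) (\<epsilon> / 2))"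
    using analytic_near_family[of w "z 0", OF an(1) e2] by blast
  obtain r2 where r2: "r2 > 0" "\<forall>t. 0 < t \<longrightarrow> t \<le> r2 \<longrightarrow> (\<forall>j. majorized w t (\<lambda>p. x 0 j p - x 0 j w) 1)"
    using analytic_near_family[of w "x 0" 1, OF an(2)] by auto
  define r where "r = min r0 (min r1 r2)"
  have r: "0 < r" "r \<le> r0" "r \<le> r1" "r \<le> r2" using r0(1) r1(1) r2(1) by (auto simp: r_def)
  interpret majorant "cube w r" "majorized w r" by (rule majorant_majorized[OF r(1)])
  have conf: "configuration (Z p) (X p)" if "p \<in> cube w r" for p
    using that r0(2) cube_mono[OF r(2)] by blast
  have z0: "majorized w r (\<lambda>p. z 0 j p - golden) \<epsilon>" for j
  proof -
    have "majorized w r (\<lambda>p. z 0 j p - z 0 j w) (\<epsilon> / 2)" using r1(2) r by blast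
    from maj_add[OF this maj_const[of "z 0 j w - golden"]]
    show ?thesis by (rule maj_cong) (use k0[of j] in \<open>simp_all add: z_def\<close>)
  qed
  define b where "b = (\<Sum>j\<in>UNIV. \<bar>x 0 j w\<bar>) + 1"
  have x0: "majorized w r (x 0 j) b" for j
  proof -
    have "majorized w r (\<lambda>p. x 0 j p - x 0 j w) 1" using r2(2) r by blast
    from maj_add[OF this maj_const[of "x 0 j w"]]
    show ?thesis
    proof (rule maj_cong)
      have "\<bar>x 0 j w\<bar> \<le> (\<Sum>j\<in>UNIV. \<bar>x 0 j w\<bar>)" by (rule member_le_sum) auto
      then show "1 + \<bar>x 0 j w\<bar> \<le> b" by (simp add: b_def)
    qed simp
  qed
  have b0: "b \<ge> 0" unfolding b_def by (simp add: add_nonneg_nonneg sum_nonneg)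
  have a0: "majorized w r (\<lambda>p. mean5 (\<lambda>j. x 0 j p)) b"
  proof -
    have "majorized w r (\<lambda>p. 1 / 5 * (x 0 0 p + x 0 1 p + x 0 2 p + x 0 3 p + x 0 4 p)) (\<bar>1 / 5\<bar> * (b + b + b + b + b))"
      by (intro maj_cmult maj_add x0)
    then show ?thesis by (rule maj_cong) (simp_all add: mean5_def)
  qed
  have y0: "majorized w r (\<lambda>p. x 0 j p - mean5 (\<lambda>j. x 0 j p)) (2 * b)" for j
    using maj_diff[OF x0 a0, of j] by simp
  have B: "majorized w r (\<lambda>p. mean5 (\<lambda>j. x 0 j p)) (2 * b)" by (rule maj_le[OF a0]) (use b0 in simp)
  have zstep: "z (Suc k) j p = heat_frieze l (\<lambda>j. z k j p) j" for k j p by (simp add: z_def)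
  have xstep: "x (Suc k) j p = heat_lift l \<kappa> (\<lambda>j. z k j p) (\<lambda>j. x k j p) j" for k j p
    by (simp add: x_def z_def heat_step_component)
  have orb: "frieze (\<lambda>j. z k j p)" "lift_relation (\<lambda>j. z k j p) (\<lambda>j. x k j p)" if "p \<in> cube w r" for k p
    using configuration_orbit[OF l \<kappa> conf[OF that], of "k0 + k"]
    by (simp_all add: configuration_def z_def x_def lift_of_component)
  note t = tail_lift[where x = x and z = z and B = "2 * b", OF P(7,1,2,4,5) z0 zstep orb(1) P(8,3,5,6) ev orb(2) xstep B y0]
  let ?D = "16 * C * \<epsilon> * (2 * b)"
  show "\<exists>g r. analytic_near w g \<and> 0 < r \<and>
      (\<forall>p\<in>cube w r. (\<lambda>k. mean5 (\<lambda>j. lift_orbit l \<kappa> (Z p) (X p) k j $ i)) \<longlonglongrightarrow> g p)"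
    if one: "mean_eigenvalue l / \<kappa> = 1"
  proof -
    have "majorized w r (\<lambda>p. mean5 (\<lambda>j. x (Suc k) j p) - 1 * mean5 (\<lambda>j. x k j p)) (?D * \<theta>^k)" for k
      using t(1)[of k] unfolding one .
    from signed_limit[where f = "\<lambda>k p. mean5 (\<lambda>j. x k j p)" and s = 1, OF _ P(1,2) this a0]
    obtain g where g: "majorized w r g (b + ?D / (1 - \<theta>))"
      "\<forall>p\<in>cube w r. (\<lambda>k. 1^k * mean5 (\<lambda>j. x k j p)) \<longlonglongrightarrow> g p" by blast
    have "(\<lambda>k. mean5 (\<lambda>j. lift_orbit l \<kappa> (Z p) (X p) k j $ i)) \<longlonglongrightarrow> g p" if "p \<in> cube w r" for p
      by (rule LIMSEQ_offset[of _ k0]) (use g(2) that in \<open>simp add: x_def add.commute[of _ k0]\<close>)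
    then show ?thesis using g(1) r(1) unfolding analytic_near_def by blast
  qed
  show "\<exists>g r. analytic_near w g \<and> 0 < r \<and>
      (\<forall>p\<in>cube w r. (\<lambda>k. lift_orbit l \<kappa> (Z p) (X p) k j $ i - mean5 (\<lambda>j. lift_orbit l \<kappa> (Z p) (X p) k j $ i)) \<longlonglongrightarrow> g p)"
    if one: "shape_eigenvalue l / \<kappa> = 1"
  proof -
    have "majorized w r (\<lambda>p. (x (Suc k) j p - mean5 (\<lambda>j. x (Suc k) j p)) - 1 * (x k j p - mean5 (\<lambda>j. x k j p))) (?D * \<theta>^k)" for k
      using t(2)[of k j] unfolding one .
    from signed_limit[where f = "\<lambda>k p. x k j p - mean5 (\<lambda>j. x k j p)" and s = 1, OF _ P(1,2) this y0]
    obtain g where g: "majorized w r g (2 * b + ?D / (1 - \<theta>))"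
      "\<forall>p\<in>cube w r. (\<lambda>k. 1^k * (x k j p - mean5 (\<lambda>j. x k j p))) \<longlonglongrightarrow> g p" by blast
    have "(\<lambda>k. lift_orbit l \<kappa> (Z p) (X p) k j $ i - mean5 (\<lambda>j. lift_orbit l \<kappa> (Z p) (X p) k j $ i)) \<longlonglongrightarrow> g p"
      if "p \<in> cube w r" for p
      by (rule LIMSEQ_offset[of _ k0]) (use g(2) that in \<open>simp add: x_def add.commute[of _ k0]\<close>)
    then show ?thesis using g(1) r(1) unfolding analytic_near_def by blast
  qed
qed

section \<open>The points and lines of collapse\<close>

lemma point_surj: "\<exists>v. v \<noteq> 0 \<and> p = point v"
  by (metis point_cases)

lemma heat_map_positive_lift:
  assumes "l > 0" "\<kappa> \<noteq> 0" "positive_lift V"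
  shows "(heat_map l ^^ k) (\<chi> j. point (V j)) = (\<chi> j. point (lift_orbit l \<kappa> (invariants V) (normalized V) k j))"
  using heat_map_orbit[OF assms(1,2) positive_lift_configuration(1)[OF assms(3)]]
  by (simp add: positive_lift_configuration(3)[OF assms(3)])

lemma vertex_limit:
  assumes l: "l > 0" "\<kappa> \<noteq> 0" and V: "positive_lift V"
    and A: "(\<lambda>k. lift_orbit l \<kappa> (invariants V) (normalized V) k j) \<longlonglongrightarrow> A" "A \<noteq> 0"
  shows "(\<lambda>k. (heat_map l ^^ k) (\<chi> j. point (V j)) $ j) \<longlonglongrightarrow> point A"
  unfolding heat_map_positive_lift[OF l V] using tendsto_point[OF A] by simp

lemma cross3_nonzero:
  fixes u v :: "real^3"
  assumes ind: "\<And>\<alpha> \<beta>. \<alpha> *\<^sub>R u + \<beta> *\<^sub>R v = 0 \<Longrightarrow> \<alpha> = 0 \<and> \<beta> = 0"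
  shows "cross3 u v \<noteq> 0"
proof
  assume 0: "cross3 u v = 0"
  have c: "u$2 * v$3 = u$3 * v$2" "u$3 * v$1 = u$1 * v$3" "u$1 * v$2 = u$2 * v$1"
    using 0 by (simp_all add: cross3_def vec_eq_iff forall_3)
  have "(v $ i) *\<^sub>R u + (- (u $ i)) *\<^sub>R v = 0" for i
    using exhaust_3[of i] c by (auto simp: vec_eq_iff forall_3 mult.commute)
  then have "u $ i = 0" for i using ind by (metis neg_equal_0_iff_equal)
  then have "u = 0" by (simp add: vec_eq_iff)
  then show False using ind[of 1 0] by simp
qed

lemma cross3_parallel:
  fixes u v w :: "real^3"
  assumes w: "w \<bullet> u = 0" "w \<bullet> v = 0"
  shows "(cross3 u v \<bullet> cross3 u v) *\<^sub>R w = (cross3 u v \<bullet> w) *\<^sub>R cross3 u v"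
proof -
  have "cross3 w (cross3 u v) = 0" unfolding Lagrange using w by simp
  then show ?thesis using Lagrange[of "cross3 u v" w "cross3 u v"] by simp
qed

lemma shape_span:
  fixes Y :: "5 \<Rightarrow> real^3"
  assumes Y: "\<And>j. Y (j + 1) + Y (j + 4) = (golden - 1) *\<^sub>R Y j"
  shows "Y 4 = (golden - 1) *\<^sub>R Y 0 - Y 1" "Y 2 = (golden - 1) *\<^sub>R Y 1 - Y 0"
    "Y 3 = (golden - 1) *\<^sub>R Y 2 - Y 1"
  using Y[of 0] Y[of 1] Y[of 2] by (simp_all add: five_numerals algebra_simps)

lemma shape_sum:
  fixes Y :: "5 \<Rightarrow> real^3"
  assumes Y: "\<And>j. Y (j + 1) + Y (j + 4) = (golden - 1) *\<^sub>R Y j"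
  shows "mean5 (\<lambda>j. Y j $ i) = 0"
proof -
  let ?y = "\<lambda>j. Y j $ i"
  have c: "(golden - 1) * ?y j = ?y (j + 1) + ?y (j + 4)" for j
    using arg_cong[OF Y[of j], of "\<lambda>v. v $ i"] by simp
  have "(golden - 1) * (?y 0 + ?y 1 + ?y 2 + ?y 3 + ?y 4) = 2 * (?y 0 + ?y 1 + ?y 2 + ?y 3 + ?y 4)"
    unfolding distrib_left c by (simp add: five_numerals)
  then have "(golden - 3) * (?y 0 + ?y 1 + ?y 2 + ?y 3 + ?y 4) = 0" by (simp only: left_diff_distrib)
  then have "?y 0 + ?y 1 + ?y 2 + ?y 3 + ?y 4 = 0" using golden_bounds by (simp only: mult_eq_0_iff) simp
  then show ?thesis by (simp add: mean5_def)
qed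

lemma shape_nonzero:
  fixes Y :: "5 \<Rightarrow> real^3"
  assumes Y: "\<And>j. Y (j + 1) + Y (j + 4) = (golden - 1) *\<^sub>R Y j"
    and ind: "\<And>\<alpha> \<beta>. \<alpha> *\<^sub>R Y 0 + \<beta> *\<^sub>R Y 1 = 0 \<Longrightarrow> \<alpha> = 0 \<and> \<beta> = 0"
  shows "Y j \<noteq> 0"
proof
  assume 0: "Y j = 0"
  have 3: "Y 3 = ((golden - 1)^2 - 1) *\<^sub>R Y 1 - (golden - 1) *\<^sub>R Y 0"
    unfolding shape_span(3)[OF Y] shape_span(2)[OF Y] by (simp add: vec_eq_iff algebra_simps power2_eq_square)
  consider "Y 0 = 0" | "Y 1 = 0" | "Y 2 = 0" | "Y 3 = 0" | "Y 4 = 0" using exhaust_5[of j] 0 by auto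
  then show False
  proof cases
    case 1
    then show ?thesis using ind[of 1 0] by simp
  next
    case 2
    then show ?thesis using ind[of 0 1] by simp
  next
    case 3
    then show ?thesis using ind[of "-1" "golden - 1"] shape_span(2)[OF Y] by simp
  next
    case 4
    then show ?thesis using ind[of "- (golden - 1)" "(golden - 1)^2 - 1"] 3 golden_bounds by (simp add: algebra_simps)
  next
    case 5
    then show ?thesis using ind[of "golden - 1" "-1"] shape_span(1)[OF Y] by simp
  qed
qed

lemma collapse_point_iff:
  fixes d :: "rp2 \<Rightarrow> rp2 \<Rightarrow> real"
  assumes d: "Metric_space UNIV d" "Metric_space.mtopology UNIV d = euclidean"
    and l: "l > 0" "\<kappa> \<noteq> 0" and V: "positive_lift V"
    and A: "\<And>j. (\<lambda>k. lift_orbit l \<kappa> (invariants V) (normalized V) k j) \<longlonglongrightarrow> A" "A \<noteq> 0"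
  shows "collapses_to_point l (\<chi> j. point (V j)) p \<longleftrightarrow> p = point A"
proof -
  have "(\<lambda>k. (heat_map l ^^ k) (\<chi> j. point (V j)) $ j) \<longlonglongrightarrow> point A" for j
    by (rule vertex_limit[OF l V A])
  then show ?thesis unfolding collapses_to_point_def using rp2_limit_unique[OF d] by metis
qed

text \<open>All Y j lie in the plane spanned by the independent vectors Y 0 and Y 1. The covectors
  that annihilate this plane are the multiples of the cross product, so exactly one line contains
  all limit vertices.\<close>

lemma collapse_line_iff:
  fixes d :: "rp2 \<Rightarrow> rp2 \<Rightarrow> real"
  assumes d: "Metric_space UNIV d" "Metric_space.mtopology UNIV d = euclidean"
    and l: "l > 0" "\<kappa> \<noteq> 0" and V: "positive_lift V"
    and lim: "\<And>j. (\<lambda>k. lift_orbit l \<kappa> (invariants V) (normalized V) k j) \<longlonglongrightarrow> Y j"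
    and Y: "\<And>j. Y (j + 1) + Y (j + 4) = (golden - 1) *\<^sub>R Y j"
    and ind: "\<And>\<alpha> \<beta>. \<alpha> *\<^sub>R Y 0 + \<beta> *\<^sub>R Y 1 = 0 \<Longrightarrow> \<alpha> = 0 \<and> \<beta> = 0"
  shows "collapses_to_line d l (\<chi> j. point (V j)) q \<longleftrightarrow> q = point (cross3 (Y 0) (Y 1))"
proof -
  let ?n = "cross3 (Y 0) (Y 1)"
  have Y0: "Y j \<noteq> 0" for j by (rule shape_nonzero[OF Y ind])
  have n0: "?n \<noteq> 0" by (rule cross3_nonzero[OF ind])
  obtain w where w: "w \<noteq> 0" "q = point w" using point_surj by blast
  have v: "(\<lambda>k. (heat_map l ^^ k) (\<chi> j. point (V j)) $ j) \<longlonglongrightarrow> point (Y j)" for j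
    by (rule vertex_limit[OF l V lim Y0])
  have "collapses_to_line d l (\<chi> j. point (V j)) q \<longleftrightarrow> (\<forall>j. w \<bullet> Y j = 0)"
    unfolding collapses_to_line_def w(2) distance_to_line_iff[OF d v w(1)] point_in_line_iff[OF w(1) Y0] ..
  also have "\<dots> \<longleftrightarrow> w \<bullet> Y 0 = 0 \<and> w \<bullet> Y 1 = 0"
  proof
    assume 01: "w \<bullet> Y 0 = 0 \<and> w \<bullet> Y 1 = 0"
    then have 2: "w \<bullet> Y 2 = 0" "w \<bullet> Y 4 = 0" using shape_span[OF Y] by (simp_all add: inner_diff_right)
    then have "w \<bullet> Y 3 = 0" unfolding shape_span(3)[OF Y] inner_diff_right using 01 by simp
    then show "\<forall>j. w \<bullet> Y j = 0" using 01 2 exhaust_5 by metis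
  qed simp
  also have "\<dots> \<longleftrightarrow> point ?n = point w"
  proof
    assume "w \<bullet> Y 0 = 0 \<and> w \<bullet> Y 1 = 0"
    then have p: "(?n \<bullet> ?n) *\<^sub>R w = (?n \<bullet> w) *\<^sub>R ?n" by (intro cross3_parallel) auto
    have nn: "?n \<bullet> ?n \<noteq> 0" using n0 by simp
    have "w = inverse (?n \<bullet> ?n) *\<^sub>R ((?n \<bullet> ?n) *\<^sub>R w)" using nn by simp
    then have wc: "w = ((?n \<bullet> w) / (?n \<bullet> ?n)) *\<^sub>R ?n" unfolding p by (simp add: divide_inverse mult.commute)
    then have "(?n \<bullet> w) / (?n \<bullet> ?n) \<noteq> 0" using w(1) by force
    then show "point ?n = point w" using point_eq_iff[OF n0 w(1)] wc by blast
  next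
    assume "point ?n = point w"
    then obtain c where "w = c *\<^sub>R ?n" using point_eq_iff[OF n0 w(1)] by blast
    then show "w \<bullet> Y 0 = 0 \<and> w \<bullet> Y 1 = 0" by (simp add: dot_cross_self)
  qed
  finally show ?thesis using w(2) by auto
qed

section \<open>Analytic dependence\<close>

definition chart_vector :: "3 \<Rightarrow> real^2 \<Rightarrow> real^3" where
  "chart_vector k u = (if k = 1 then vector [1, u$1, u$2]
     else if k = 2 then vector [u$1, 1, u$2] else vector [u$1, u$2, 1])"

lemma affine_chart_eq: "affine_chart k u = point (chart_vector k u)"
  by (simp add: affine_chart_def chart_vector_def)

lemma chart_vector_nonzero: "chart_vector k u \<noteq> 0"
  by (auto simp: chart_vector_def vec_eq_iff forall_3)

lemma analytic_near_chart_vector: "analytic_near w (\<lambda>p. chart_vector k (p $ j) $ i)"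
  using exhaust_3[of i] exhaust_3[of k]
  by (elim disjE) (simp_all add: chart_vector_def analytic_near_const analytic_near_coordinate)

lemma analytic_near_triple:
  assumes "\<And>i. analytic_near w (\<lambda>p. a p $ i)" "\<And>i. analytic_near w (\<lambda>p. b p $ i)" "\<And>i. analytic_near w (\<lambda>p. c p $ i)"
  shows "analytic_near w (\<lambda>p. triple (a p) (b p) (c p))"
  unfolding triple_def by (intro analytic_intros assms)

lemma finite_cube:
  fixes Q :: "'i::finite \<Rightarrow> 'a::euclidean_space \<Rightarrow> bool"
  assumes "\<And>i. \<exists>r>0. \<forall>x\<in>cube w r. Q i x"
  shows "\<exists>r>0. \<forall>x\<in>cube w r. \<forall>i. Q i x"
proof -
  have "\<forall>i. \<exists>r. r > 0 \<and> (\<forall>x\<in>cube w r. Q i x)" using assms by blast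
  from choice[OF this] obtain r where r: "\<forall>i. r i > 0 \<and> (\<forall>x\<in>cube w (r i). Q i x)" ..
  have "Min (range r) \<le> r i" for i by (rule Min_le) auto
  then have "cube w (Min (range r)) \<subseteq> cube w (r i)" for i by (rule cube_mono)
  moreover have "Min (range r) > 0" using r by auto
  ultimately show ?thesis using r by (intro exI[of _ "Min (range r)"]) blast
qed

lemma analytic_near_pos:
  assumes f: "analytic_near w f" and p: "f w > 0"
  shows "\<exists>r>0. \<forall>x\<in>cube w r. f x > 0"
proof -
  obtain r where r: "r > 0" "\<forall>t. 0 < t \<longrightarrow> t \<le> r \<longrightarrow> majorized w t (\<lambda>x. f x - f w) (f w / 2)"
    using analytic_near_small[OF f, of "f w / 2"] p by auto
  then have m: "majorized w r (\<lambda>x. f x - f w) (f w / 2)" by simp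
  have "f x > 0" if "x \<in> cube w r" for x
    using majorized_eval[OF m that] p by linarith
  then show ?thesis using r(1) by blast
qed

lemma analytic_point:
  fixes g :: "coords \<Rightarrow> real^3"
  assumes g: "\<And>i. analytic_near w (\<lambda>p. g p $ i)" and nz: "g w \<noteq> 0"
  shows "\<exists>k G. real_analytic_at G w \<and> (\<forall>\<^sub>F p in nhds w. point (g p) = affine_chart k (G p))"
proof -
  obtain k where k: "g w $ k \<noteq> 0" using nz by (auto simp: vec_eq_iff)
  \<comment> \<open>The two indices other than k in increasing order, as in
    \<open>affine_chart\<close>.\<close>
  define m n where "m = (if k = 1 then 2 else 1 :: 3)" and "n = (if k = 3 then 2 else 3 :: 3)"
  define G where "G p = (vector [g p $ m / g p $ k, g p $ n / g p $ k] :: real^2)" for p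
  have "analytic_near w (\<lambda>p. G p $ i)" for i
    using exhaust_2[of i] analytic_near_divide[OF g g k] by (auto simp: G_def)
  then have "real_analytic_at G w" by (rule real_analytic_at_components)
  moreover have "point (g p) = affine_chart k (G p)" if "g p $ k \<noteq> 0" for p
  proof -
    have "(1 / g p $ k) *\<^sub>R g p = chart_vector k (G p)"
      using exhaust_3[of k] that by (auto simp: G_def m_def n_def chart_vector_def vec_eq_iff forall_3)
    moreover have "g p \<noteq> 0" using that by auto
    ultimately show ?thesis using point_scale[of "1 / g p $ k" "g p"] that by (simp add: affine_chart_eq)
  qed
  ultimately have G: "real_analytic_at G w" "\<And>p. g p $ k \<noteq> 0 \<Longrightarrow> point (g p) = affine_chart k (G p)" by simp_all
  obtain r where r: "r > 0" "\<forall>x\<in>cube w r. g x $ k \<noteq> 0"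
    using analytic_near_nonzero[of w "\<lambda>p. g p $ k", OF g k] by (elim exE conjE) (rule that)
  have "\<forall>\<^sub>F p in nhds w. point (g p) = affine_chart k (G p)"
    by (rule eventually_mono[OF eventually_cube[OF r(1)]]) (use r(2) G(2) in simp)
  with G(1) show ?thesis by (intro exI conjI)
qed

text \<open>The correcting constants \<sigma> are found at w and kept fixed. The ten brackets are
  analytic and positive at w, hence positive on a cube, and there the normalized lift is again a
  configuration.\<close>

lemma analytic_lift:
  assumes P: "convex_pentagon (pentagon_chart i w)"
  shows "\<exists>V r. r > 0 \<and> (\<forall>p\<in>cube w r. positive_lift (V p)) \<and> (\<forall>p. pentagon_chart i p = (\<chi> j. point (V p j))) \<and>
    (\<forall>j c. analytic_near w (\<lambda>p. normalized (V p) j $ c)) \<and> (\<forall>j. analytic_near w (\<lambda>p. invariants (V p) j))"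
proof -
  define U where "U p j = chart_vector (i $ j) (p $ j)" for p j
  have U0: "U p j \<noteq> 0" for p j unfolding U_def by (rule chart_vector_nonzero)
  have "pentagon_chart i w $ j = point (U w j)" for j by (simp add: pentagon_chart_def affine_chart_eq U_def)
  from convex_pentagon_positive_lift[OF P U0 this]
  obtain \<sigma> where \<sigma>: "\<And>j. \<sigma> j \<noteq> (0::real)" "positive_lift (\<lambda>j. \<sigma> j *\<^sub>R U w j)" by blast
  define V where "V p j = \<sigma> j *\<^sub>R U p j" for p j
  have V: "analytic_near w (\<lambda>p. V p j $ c)" for j c
    unfolding V_def U_def vector_scaleR_component real_scaleR_def
    by (intro analytic_near_mult analytic_near_const analytic_near_chart_vector)
  have e: "analytic_near w (\<lambda>p. edge_det (V p) j)" and g: "analytic_near w (\<lambda>p. diagonal_det (V p) j)" for j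
    unfolding edge_det_def diagonal_det_def by (intro analytic_near_triple V)+
  have pos: "edge_det (V w) j > 0" "diagonal_det (V w) j > 0" for j
    using \<sigma>(2) unfolding positive_lift_def V_def by auto
  obtain r1 where r1: "r1 > 0" "\<forall>x\<in>cube w r1. \<forall>j. edge_det (V x) j > 0"
    using finite_cube[of w "\<lambda>j x. edge_det (V x) j > 0", OF analytic_near_pos[OF e pos(1)]] by (elim exE conjE) (rule that)
  obtain r2 where r2: "r2 > 0" "\<forall>x\<in>cube w r2. \<forall>j. diagonal_det (V x) j > 0"
    using finite_cube[of w "\<lambda>j x. diagonal_det (V x) j > 0", OF analytic_near_pos[OF g pos(2)]] by (elim exE conjE) (rule that)
  have "\<forall>p\<in>cube w (min r1 r2). positive_lift (V p)"
    using r1(2) r2(2) cube_mono[of "min r1 r2" r1 w] cube_mono[of "min r1 r2" r2 w]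
    unfolding positive_lift_def by (simp add: subset_iff)
  moreover have "pentagon_chart i p = (\<chi> j. point (V p j))" for p
    unfolding pentagon_chart_def affine_chart_eq V_def U_def
    by (simp add: point_scale[OF \<sigma>(1) chart_vector_nonzero])
  moreover have "analytic_near w (\<lambda>p. normalized (V p) j $ c)" for j c
    unfolding normalized_def vector_scaleR_component real_scaleR_def by (intro analytic_near_mult e V)
  moreover have "analytic_near w (\<lambda>p. invariants (V p) j)" for j
    unfolding invariants_def using pos(1)[of "j + 1"] pos(1)[of "j + 3"]
    by (intro analytic_near_divide analytic_near_mult e g) simp
  ultimately show ?thesis using r1(1) r2(1) by (intro exI[of _ V] exI[of _ "min r1 r2"]) simp
qed

lemma rp2_analytic_onI:
  assumes F: "\<And>i w. convex_pentagon (pentagon_chart i w) \<Longrightarrow>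
    \<exists>g r. (\<forall>c. analytic_near w (\<lambda>p. g p $ c)) \<and> g w \<noteq> 0 \<and> r > 0 \<and> (\<forall>p\<in>cube w r. F (pentagon_chart i p) = point (g p))"
  shows "rp2_analytic_on F {P. convex_pentagon P}"
  unfolding rp2_analytic_on_def
proof (intro allI impI)
  fix i w assume "pentagon_chart i w \<in> {P. convex_pentagon P}"
  then have "convex_pentagon (pentagon_chart i w)" by simp
  from F[OF this] obtain g r where g: "\<forall>c. analytic_near w (\<lambda>p. g p $ c)" "g w \<noteq> 0" "r > 0"
    "\<forall>p\<in>cube w r. F (pentagon_chart i p) = point (g p)" by (elim exE conjE) (rule that)
  obtain k G where G: "real_analytic_at G w" "\<forall>\<^sub>F p in nhds w. point (g p) = affine_chart k (G p)"
    using analytic_point[OF g(1)[rule_format] g(2)] by (elim exE conjE) (rule that)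
  have "\<forall>\<^sub>F p in nhds w. F (pentagon_chart i p) = affine_chart k (G p)"
    by (rule eventually_elim2[OF G(2) eventually_cube[OF g(3)]]) (use g(4) in simp)
  then show "\<exists>k G. real_analytic_at G w \<and> (\<forall>\<^sub>F w' in nhds w. F (pentagon_chart i w') = affine_chart k (G w'))"
    using G(1) by blast
qed

lemma convex_pentagon_lift:
  assumes P: "convex_pentagon P"
  shows "\<exists>V. positive_lift V \<and> P = (\<chi> j. point (V j))"
proof -
  have "\<forall>j. \<exists>u. u \<noteq> 0 \<and> P $ j = point u" using point_surj by blast
  from choice[OF this] obtain U where U: "\<forall>j. U j \<noteq> 0 \<and> P $ j = point (U j)" ..
  obtain \<sigma> where \<sigma>: "\<And>j. \<sigma> j \<noteq> (0::real)" "positive_lift (\<lambda>j. \<sigma> j *\<^sub>R U j)"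
    using convex_pentagon_positive_lift[OF P, of U] U by blast
  have "point (\<sigma> j *\<^sub>R U j) = P $ j" for j using U point_scale[OF \<sigma>(1)] by simp
  then have "P = (\<chi> j. point (\<sigma> j *\<^sub>R U j))" by (simp add: vec_eq_iff)
  then show ?thesis using \<sigma>(2) by blast
qed

text \<open>The coordinates of the point are the limits of the means of the five lifts, which
  \<open>analytic_limit\<close> provides as power series. They agree with the vector of
  \<open>point_case\<close>, since all five lifts converge to it.\<close>

lemma point_of_collapse_analytic:
  fixes d :: "rp2 \<Rightarrow> rp2 \<Rightarrow> real"
  assumes d: "Metric_space UNIV d" "Metric_space.mtopology UNIV d = euclidean"
    and l: "l > 0" "l < golden"
  shows "rp2_analytic_on (\<lambda>P. THE p. collapses_to_point l P p) {P. convex_pentagon P}"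
proof (rule rp2_analytic_onI)
  fix i w assume "convex_pentagon (pentagon_chart i w)"
  from analytic_lift[OF this] obtain V r where r: "r > 0" "\<forall>p\<in>cube w r. positive_lift (V p)"
    and V: "\<forall>p. pentagon_chart i p = (\<chi> j. point (V p j))"
    and an: "\<forall>j c. analytic_near w (\<lambda>p. normalized (V p) j $ c)" "\<forall>j. analytic_near w (\<lambda>p. invariants (V p) j)" by (elim exE conjE) (rule that)
  let ?\<kappa> = "mean_eigenvalue l"
  let ?X = "\<lambda>p. lift_orbit l ?\<kappa> (invariants (V p)) (normalized (V p))"
  have \<kappa>0: "?\<kappa> > 0" using mean_eigenvalue_pos[OF l(1)] .
  then have \<kappa>: "?\<kappa> \<noteq> 0" by simp
  have one: "mean_eigenvalue l / ?\<kappa> = 1" using \<kappa> by simp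
  have ev: "\<bar>mean_eigenvalue l / ?\<kappa>\<bar> \<le> 1" "\<bar>shape_eigenvalue l / ?\<kappa>\<bar> \<le> 1"
    using eigenvalue_sum[of l] shape_eigenvalue_neg[OF l(1)] l(2) \<kappa>0 by (simp_all add: abs_le_iff field_simps)
  have conf: "configuration (invariants (V p)) (normalized (V p))" if "p \<in> cube w r" for p
    using positive_lift_configuration(1) r(2) that by blast
  have "\<forall>c. \<exists>g r. analytic_near w g \<and> 0 < r \<and> (\<forall>p\<in>cube w r. (\<lambda>k. mean5 (\<lambda>j. ?X p k j $ c)) \<longlonglongrightarrow> g p)"
    by (intro allI analytic_limit(1)[OF l(1) \<kappa> ev r(1) conf an(2)[rule_format] an(1)[rule_format] one])
  from choice[OF this] obtain g where
    g: "\<forall>c. \<exists>r. analytic_near w (g c) \<and> 0 < r \<and> (\<forall>p\<in>cube w r. (\<lambda>k. mean5 (\<lambda>j. ?X p k j $ c)) \<longlonglongrightarrow> g c p)" ..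
  then have "\<exists>r>0. \<forall>p\<in>cube w r. (\<lambda>k. mean5 (\<lambda>j. ?X p k j $ c)) \<longlonglongrightarrow> g c p" for c
    by (elim allE[of _ c] exE conjE) (rule exI, rule conjI)
  from finite_cube[of w "\<lambda>c p. (\<lambda>k. mean5 (\<lambda>j. ?X p k j $ c)) \<longlonglongrightarrow> g c p", OF this] obtain s where s: "s > 0"
    "\<forall>p\<in>cube w s. \<forall>c. (\<lambda>k. mean5 (\<lambda>j. ?X p k j $ c)) \<longlonglongrightarrow> g c p" by (elim exE conjE) (rule that)
  define t where "t = min r s"
  have t: "t > 0" "t \<le> r" "t \<le> s" using r(1) s(1) by (auto simp: t_def)
  have A: "(\<chi> c. g c p) \<noteq> 0 \<and> (THE q. collapses_to_point l (pentagon_chart i p) q) = point (\<chi> c. g c p)"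
    if "p \<in> cube w t" for p
  proof -
    have pr: "p \<in> cube w r" "p \<in> cube w s" using that cube_mono t by blast+
    obtain A where A: "A \<noteq> 0" "\<forall>j. (\<lambda>k. ?X p k j) \<longlonglongrightarrow> A" using point_case[OF l conf[OF pr(1)]] by (elim exE conjE) (rule that)
    have "A $ c = g c p" for c
    proof (rule LIMSEQ_unique)
      have "(\<lambda>k. (?X p k 0 $ c + ?X p k 1 $ c + ?X p k 2 $ c + ?X p k 3 $ c + ?X p k 4 $ c) / 5)
        \<longlonglongrightarrow> (A $ c + A $ c + A $ c + A $ c + A $ c) / 5" by (intro tendsto_intros A(2)[rule_format]) simp_all
      then show "(\<lambda>k. mean5 (\<lambda>j. ?X p k j $ c)) \<longlonglongrightarrow> A $ c" by (simp add: mean5_def)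
      show "(\<lambda>k. mean5 (\<lambda>j. ?X p k j $ c)) \<longlonglongrightarrow> g c p" using s(2) pr(2) by blast
    qed
    then have Ag: "A = (\<chi> c. g c p)" by (simp add: vec_eq_iff)
    have "positive_lift (V p)" using r(2) pr(1) by blast
    from collapse_point_iff[OF d l(1) \<kappa> this A(2)[rule_format] A(1)]
    have "collapses_to_point l (pentagon_chart i p) q \<longleftrightarrow> q = point A" for q by (simp only: V[rule_format])
    then show ?thesis using A(1) Ag by simp
  qed
  show "\<exists>g r. (\<forall>c. analytic_near w (\<lambda>p. g p $ c)) \<and> g w \<noteq> 0 \<and> r > 0 \<and>
    (\<forall>p\<in>cube w r. (THE q. collapses_to_point l (pentagon_chart i p) q) = point (g p))"
  proof (intro exI[of _ "\<lambda>p. \<chi> c. g c p"] exI[of _ t] conjI allI ballI t(1))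
    show "analytic_near w (\<lambda>p. (\<chi> c. g c p) $ c)" for c using g by auto
    have "w \<in> cube w t" using t(1) by (simp add: cube_def)
    then show "(\<chi> c. g c w) \<noteq> 0" using A by blast
  qed (use A in blast)
qed

text \<open>With the shape eigenvalue as scale, \<open>analytic_limit\<close> concerns deviations
  from the mean. The limits have mean zero by \<open>shape_sum\<close>, so these deviations have the
  same limits as the lifts, and the line is their cross product, a polynomial in them.\<close>

lemma line_of_collapse_analytic:
  fixes d :: "rp2 \<Rightarrow> rp2 \<Rightarrow> real"
  assumes d: "Metric_space UNIV d" "Metric_space.mtopology UNIV d = euclidean"
    and l: "l > golden"
  shows "rp2_analytic_on (\<lambda>P. THE q. collapses_to_line d l P q) {P. convex_pentagon P}"
proof (rule rp2_analytic_onI)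
  fix i w assume "convex_pentagon (pentagon_chart i w)"
  from analytic_lift[OF this] obtain V r where r: "r > 0" "\<forall>p\<in>cube w r. positive_lift (V p)"
    and V: "\<forall>p. pentagon_chart i p = (\<chi> j. point (V p j))"
    and an: "\<forall>j c. analytic_near w (\<lambda>p. normalized (V p) j $ c)" "\<forall>j. analytic_near w (\<lambda>p. invariants (V p) j)" by (elim exE conjE) (rule that)
  have l0: "l > 0" using l golden_bounds by simp
  let ?\<kappa> = "shape_eigenvalue l"
  let ?X = "\<lambda>p. lift_orbit l ?\<kappa> (invariants (V p)) (normalized (V p))"
  let ?S = "\<lambda>p j c k. ?X p k j $ c - mean5 (\<lambda>j. ?X p k j $ c)"
  have \<kappa>0: "?\<kappa> < 0" using shape_eigenvalue_neg[OF l0] .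
  then have \<kappa>: "?\<kappa> \<noteq> 0" by simp
  have one: "shape_eigenvalue l / ?\<kappa> = 1" using \<kappa> by simp
  have ev: "\<bar>mean_eigenvalue l / ?\<kappa>\<bar> \<le> 1" "\<bar>shape_eigenvalue l / ?\<kappa>\<bar> \<le> 1"
    using eigenvalue_sum[of l] mean_eigenvalue_pos[OF l0] l \<kappa>0 by (simp_all add: abs_le_iff field_simps)
  have conf: "configuration (invariants (V p)) (normalized (V p))" if "p \<in> cube w r" for p
    using positive_lift_configuration(1) r(2) that by blast
  have "\<forall>jc. \<exists>g r. analytic_near w g \<and> 0 < r \<and> (\<forall>p\<in>cube w r. (\<lambda>k. ?S p (fst jc) (snd jc) k) \<longlonglongrightarrow> g p)"
    by (intro allI analytic_limit(2)[OF l0 \<kappa> ev r(1) conf an(2)[rule_format] an(1)[rule_format] one])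
  from choice[OF this] obtain g where
    g: "\<forall>jc. \<exists>r. analytic_near w (g jc) \<and> 0 < r \<and> (\<forall>p\<in>cube w r. (\<lambda>k. ?S p (fst jc) (snd jc) k) \<longlonglongrightarrow> g jc p)" ..
  then have "\<exists>r>0. \<forall>p\<in>cube w r. (\<lambda>k. ?S p (fst jc) (snd jc) k) \<longlonglongrightarrow> g jc p" for jc
    by (elim allE[of _ jc] exE conjE) (rule exI, rule conjI)
  from finite_cube[of w "\<lambda>jc p. (\<lambda>k. ?S p (fst jc) (snd jc) k) \<longlonglongrightarrow> g jc p", OF this] obtain s where s: "s > 0"
    "\<forall>p\<in>cube w s. \<forall>jc. (\<lambda>k. ?S p (fst jc) (snd jc) k) \<longlonglongrightarrow> g jc p" by (elim exE conjE) (rule that)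
  define t where "t = min r s"
  have t: "t > 0" "t \<le> r" "t \<le> s" using r(1) s(1) by (auto simp: t_def)
  define y where "y j p = (\<chi> c. g (j, c) p)" for j p
  have A: "cross3 (y 0 p) (y 1 p) \<noteq> 0 \<and>
      (THE q. collapses_to_line d l (pentagon_chart i p) q) = point (cross3 (y 0 p) (y 1 p))"
    if "p \<in> cube w t" for p
  proof -
    have pr: "p \<in> cube w r" "p \<in> cube w s" using that cube_mono t by blast+
    obtain Y where Y: "\<forall>j. (\<lambda>k. ?X p k j) \<longlonglongrightarrow> Y j" "\<forall>j. Y (j + 1) + Y (j + 4) = (golden - 1) *\<^sub>R Y j"
      "\<forall>\<alpha> \<beta>. \<alpha> *\<^sub>R Y 0 + \<beta> *\<^sub>R Y 1 = 0 \<longrightarrow> \<alpha> = 0 \<and> \<beta> = 0" using line_case[OF l conf[OF pr(1)]] by (elim exE conjE) (rule that)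
    have "Y j $ c = g (j, c) p" for j c
    proof (rule LIMSEQ_unique)
      have "(\<lambda>k. ?X p k j $ c - (?X p k 0 $ c + ?X p k 1 $ c + ?X p k 2 $ c + ?X p k 3 $ c + ?X p k 4 $ c) / 5)
        \<longlonglongrightarrow> Y j $ c - (Y 0 $ c + Y 1 $ c + Y 2 $ c + Y 3 $ c + Y 4 $ c) / 5" by (intro tendsto_intros Y(1)[rule_format]) simp_all
      then show "(\<lambda>k. ?S p j c k) \<longlonglongrightarrow> Y j $ c"
        using shape_sum[of Y c, OF Y(2)[rule_format]] by (simp add: mean5_def)
      show "(\<lambda>k. ?S p j c k) \<longlonglongrightarrow> g (j, c) p" using s(2) pr(2) by force
    qed
    then have Yy: "Y j = y j p" for j by (simp add: vec_eq_iff y_def)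
    have "positive_lift (V p)" using r(2) pr(1) by blast
    from collapse_line_iff[OF d l0 \<kappa> this Y(1)[rule_format] Y(2)[rule_format] Y(3)[rule_format]]
    have "collapses_to_line d l (pentagon_chart i p) q \<longleftrightarrow> q = point (cross3 (Y 0) (Y 1))" for q by (simp only: V[rule_format])
    moreover have "cross3 (Y 0) (Y 1) \<noteq> 0" by (rule cross3_nonzero) (use Y(3) in blast)
    ultimately show ?thesis unfolding Yy by simp
  qed
  have gy: "analytic_near w (\<lambda>p. y j p $ c)" for j c using g by (auto simp: y_def)
  show "\<exists>g r. (\<forall>c. analytic_near w (\<lambda>p. g p $ c)) \<and> g w \<noteq> 0 \<and> r > 0 \<and>
    (\<forall>p\<in>cube w r. (THE q. collapses_to_line d l (pentagon_chart i p) q) = point (g p))"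
  proof (intro exI[of _ "\<lambda>p. cross3 (y 0 p) (y 1 p)"] exI[of _ t] conjI allI ballI t(1))
    show "analytic_near w (\<lambda>p. cross3 (y 0 p) (y 1 p) $ c)" for c
      using exhaust_3[of c] by (auto simp: cross3_def intro!: analytic_intros gy)
    have "w \<in> cube w t" using t(1) by (simp add: cube_def)
    then show "cross3 (y 0 w) (y 1 w) \<noteq> 0" using A by blast
  qed (use A in blast)
qed

lemma convex_pentagon_collapse_point:
  fixes d :: "rp2 \<Rightarrow> rp2 \<Rightarrow> real"
  assumes d: "Metric_space UNIV d" "Metric_space.mtopology UNIV d = euclidean"
    and l: "l > 0" "l < golden" and P: "convex_pentagon P"
  shows "\<exists>p. \<forall>q. collapses_to_point l P q \<longleftrightarrow> q = p"
proof -
  obtain V where V: "positive_lift V" "P = (\<chi> j. point (V j))" using convex_pentagon_lift[OF P] by blast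
  have \<kappa>: "mean_eigenvalue l \<noteq> 0" using mean_eigenvalue_pos[OF l(1)] by simp
  obtain A where A: "A \<noteq> 0" "\<forall>j. (\<lambda>k. lift_orbit l (mean_eigenvalue l) (invariants V) (normalized V) k j) \<longlonglongrightarrow> A"
    using point_case[OF l positive_lift_configuration(1)[OF V(1)]] by (elim exE conjE) (rule that)
  from collapse_point_iff[OF d l(1) \<kappa> V(1) A(2)[rule_format] A(1)] show ?thesis unfolding V(2) by blast
qed

lemma convex_pentagon_collapse_line:
  fixes d :: "rp2 \<Rightarrow> rp2 \<Rightarrow> real"
  assumes d: "Metric_space UNIV d" "Metric_space.mtopology UNIV d = euclidean"
    and l: "l > golden" and P: "convex_pentagon P"
  shows "\<exists>p. \<forall>q. collapses_to_line d l P q \<longleftrightarrow> q = p"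
proof -
  have l0: "l > 0" using l golden_bounds by simp
  obtain V where V: "positive_lift V" "P = (\<chi> j. point (V j))" using convex_pentagon_lift[OF P] by blast
  have \<kappa>: "shape_eigenvalue l \<noteq> 0" using shape_eigenvalue_neg[OF l0] by simp
  obtain Y where Y: "\<forall>j. (\<lambda>k. lift_orbit l (shape_eigenvalue l) (invariants V) (normalized V) k j) \<longlonglongrightarrow> Y j"
    "\<forall>j. Y (j + 1) + Y (j + 4) = (golden - 1) *\<^sub>R Y j"
    "\<forall>\<alpha> \<beta>. \<alpha> *\<^sub>R Y 0 + \<beta> *\<^sub>R Y 1 = 0 \<longrightarrow> \<alpha> = 0 \<and> \<beta> = 0"
    using line_case[OF l positive_lift_configuration(1)[OF V(1)]] by (elim exE conjE) (rule that)
  from collapse_line_iff[OF d l0 \<kappa> V(1) Y(1)[rule_format] Y(2)[rule_format] Y(3)[rule_format]]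
  show ?thesis unfolding V(2) by blast
qed

lemma convex_pentagon_balanced:
  assumes l: "l = golden" and P: "convex_pentagon P"
  shows "\<exists>Q R. projectively_regular Q \<and> projectively_regular R \<and> Q \<noteq> R \<and>
    (\<lambda>k. (heat_map l ^^ (2 * k)) P) \<longlonglongrightarrow> Q \<and> (\<lambda>k. (heat_map l ^^ (2 * k + 1)) P) \<longlonglongrightarrow> R \<and>
    (\<exists>D :: rp2^10. projectively_regular D \<and> range (\<lambda>j. D $ j) = range (\<lambda>j. Q $ j) \<union> range (\<lambda>j. R $ j))"
proof -
  have l0: "l > 0" using l golden_bounds by simp
  obtain V where V: "positive_lift V" "P = (\<chi> j. point (V j))" using convex_pentagon_lift[OF P] by blast
  have \<kappa>: "mean_eigenvalue l \<noteq> 0" using mean_eigenvalue_pos[OF l0] by simp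
  let ?X = "lift_orbit l (mean_eigenvalue l) (invariants V) (normalized V)"
  obtain A Y where lim: "\<forall>j. (\<lambda>k. ?X (2 * k) j) \<longlonglongrightarrow> A + Y j \<and> (\<lambda>k. ?X (2 * k + 1) j) \<longlonglongrightarrow> A - Y j"
    and Y: "\<forall>j. Y (j + 1) + Y (j + 4) = (golden - 1) *\<^sub>R Y j"
    and ind: "\<forall>\<gamma> \<alpha> \<beta>. \<gamma> *\<^sub>R A + \<alpha> *\<^sub>R Y 0 + \<beta> *\<^sub>R Y 1 = 0 \<longrightarrow> \<gamma> = 0 \<and> \<alpha> = 0 \<and> \<beta> = 0"
    using balanced_case[OF l positive_lift_configuration(1)[OF V(1)]] by (elim exE conjE) (rule that)
  note b = balanced_pentagons[of Y A, OF Y[rule_format] ind[rule_format]]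
  have "(\<lambda>k. (heat_map l ^^ (2 * k)) P) \<longlonglongrightarrow> (\<chi> j. point (A + Y j))"
    unfolding V(2) heat_map_positive_lift[OF l0 \<kappa> V(1)]
    by (rule vec_tendstoI) (use lim b(5) in \<open>auto intro!: tendsto_point\<close>)
  moreover have "(\<lambda>k. (heat_map l ^^ (2 * k + 1)) P) \<longlonglongrightarrow> (\<chi> j. point (A - Y j))"
    unfolding V(2) heat_map_positive_lift[OF l0 \<kappa> V(1)]
    by (rule vec_tendstoI) (use lim b(6) in \<open>auto intro!: tendsto_point\<close>)
  ultimately show ?thesis
    by (intro exI[of _ "\<chi> j. point (A + Y j)"] exI[of _ "\<chi> j. point (A - Y j)"] conjI b(1-4))
qed

theorem theorem4:
  fixes lam lam0 :: real and d :: "rp2 \<Rightarrow> rp2 \<Rightarrow> real"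
  assumes "lam > 0" and "lam0 = 2 * cos (pi / 5)"
    and "Metric_space UNIV d" and "Metric_space.mtopology UNIV d = euclidean"
  shows "(\<forall>P. convex_pentagon P \<longrightarrow>
            (lam < lam0 \<longrightarrow> (\<exists>p. collapses_to_point lam P p)) \<and>
            (lam = lam0 \<longrightarrow>
               (\<exists>Q R. projectively_regular Q \<and> projectively_regular R \<and> Q \<noteq> R \<and>
                  (\<lambda>k. (heat_map lam ^^ (2 * k)) P) \<longlonglongrightarrow> Q \<and>
                  (\<lambda>k. (heat_map lam ^^ (2 * k + 1)) P) \<longlonglongrightarrow> R \<and>
                  (\<exists>D :: rp2^10. projectively_regular D \<and>
                     range (\<lambda>j. D $ j) = range (\<lambda>j. Q $ j) \<union> range (\<lambda>j. R $ j)))) \<and>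
            (lam > lam0 \<longrightarrow> (\<exists>l. collapses_to_line d lam P l))) \<and>
         (lam < lam0 \<longrightarrow>
            (\<exists>F. rp2_analytic_on F {P. convex_pentagon P} \<and>
               (\<forall>P. convex_pentagon P \<longrightarrow> (\<forall>p. collapses_to_point lam P p \<longleftrightarrow> p = F P)))) \<and>
         (lam > lam0 \<longrightarrow>
            (\<exists>F. rp2_analytic_on F {P. convex_pentagon P} \<and>
               (\<forall>P. convex_pentagon P \<longrightarrow> (\<forall>l. collapses_to_line d lam P l \<longleftrightarrow> l = F P))))"
proof -
  have lam0: "lam0 = golden" using assms(2) golden_eq by simp
  note pt = convex_pentagon_collapse_point[OF assms(3,4,1)]
  note ln = convex_pentagon_collapse_line[OF assms(3,4)]
  have "\<forall>p. collapses_to_point lam P p \<longleftrightarrow> p = (THE p. collapses_to_point lam P p)"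
    if h: "lam < golden" "convex_pentagon P" for P
  proof -
    obtain p where "\<forall>q. collapses_to_point lam P q \<longleftrightarrow> q = p" using pt[OF h] by blast
    then show ?thesis by simp
  qed
  then have "\<exists>F. rp2_analytic_on F {P. convex_pentagon P} \<and>
      (\<forall>P. convex_pentagon P \<longrightarrow> (\<forall>p. collapses_to_point lam P p \<longleftrightarrow> p = F P))" if "lam < golden"
    using point_of_collapse_analytic[OF assms(3,4,1) that] that
    by (intro exI[of _ "\<lambda>P. THE p. collapses_to_point lam P p"]) simp
  moreover have "\<forall>q. collapses_to_line d lam P q \<longleftrightarrow> q = (THE q. collapses_to_line d lam P q)"
    if h: "lam > golden" "convex_pentagon P" for P
  proof -
    obtain p where "\<forall>q. collapses_to_line d lam P q \<longleftrightarrow> q = p" using ln[OF h] by blast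
    then show ?thesis by simp
  qed
  then have "\<exists>F. rp2_analytic_on F {P. convex_pentagon P} \<and>
      (\<forall>P. convex_pentagon P \<longrightarrow> (\<forall>q. collapses_to_line d lam P q \<longleftrightarrow> q = F P))" if "lam > golden"
    using line_of_collapse_analytic[OF assms(3,4) that] that
    by (intro exI[of _ "\<lambda>P. THE q. collapses_to_line d lam P q"]) simp
  moreover have "\<exists>p. collapses_to_point lam P p" if "convex_pentagon P" "lam < golden" for P
    using pt[OF that(2,1)] by blast
  moreover have "\<exists>q. collapses_to_line d lam P q" if "convex_pentagon P" "lam > golden" for P
    using ln[OF that(2,1)] by blast
  ultimately show ?thesis
    unfolding lam0 using convex_pentagon_balanced by (intro conjI allI impI) simp_all
qed

end
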